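(* Consider the bivariate renewal risk model with surplus process $$U_1(t)=x+\int_{0-}^te^{-rs}C_1(ds)-D^{(1)}_r(t),\qquad U_2(t)=y+\int_{0-}^te^{-rs}C_2(ds)-D^{(2)}_r(t),\quad t\ge0,$$ with constant interest rate $r\ge0$ and initial capitals $x,y$. Assume: $\{(X_i,Y_i)\}_{i\ge1}$, $\{(C_1(t),C_2(t))\}_{t\ge0}$ and $\{N(t)\}_{t\ge0}$ are mutually independent; the pairs $(X_i,Y_i)$ are identically distributed with non-negative marginals with distributions $F\in\mathcal{D}\cap\mathcal{L}$ and $G\in\mathcal{D}\cap\mathcal{L}$; each pair $(X_i,Y_i)$ is SAI with common constant $C>0$; $X_i,Y_j$ are independent for $i\neq j$; and for every $n\in\mathbb{N}$ the variables $X_1,\ldots,X_n,Y_1,\ldots,Y_n$ are GTAI. Then for every finite $T>0$ with $\lambda(T)>0$, $$\psi_{\max}(x,y;T)\sim\psi_{\mathrm{and}}(x,y;T)\sim\Delta(x,y;T),\qquad x\wedge y\to\infty,$$ where $$\Delta(x,y;T)=\iint_{s,t\ge0,\;s+t\le T}\Big[\overline F(xe^{r(t+s)})\overline G(ye^{rt})+\overline F(xe^{rt})\overline G(ye^{r(t+s)})\Big]\lambda(ds)\lambda(dt)+C\int_0^T\overline F(xe^{rt})\overline G(ye^{rt})\lambda(dt).$$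
   Context: Model: claims $(X_i,Y_i)$, $i\ge1$, arrive at times $T_1<T_2<\cdots$, $T_1=\theta_1$, $T_i-T_{i-1}=\theta_i$, with $\{\theta_i\}$ i.i.d. positive; $N(t)=\sum_{i\ge1}\mathbf 1_{\{T_i\le t\}}$, $\lambda(t)=\mathbb{E}N(t)$. $D^{(1)}_r(t)=\sum_{i=1}^{N(t)}X_ie^{-rT_i}$, $D^{(2)}_r(t)=\sum_{j=1}^{N(t)}Y_je^{-rT_j}$. $(C_1(t),C_2(t))$ has non-decreasing càdlàg paths with $C_1(0)=C_2(0)=0$. Ruin probabilities: $\psi_*(x,y;T)=\mathbb{P}(T_*\le T\mid (U_1(0),U_2(0))=(x,y))$ for $*\in\{\max,\mathrm{and}\}$, where $T_{\max}=\inf\{t>0: U_1(t)\vee U_2(t)<0\}$ (both lines simultaneously negative) and $T_{\mathrm{and}}=\inf\{t>0:\inf_{0\le s\le t}U_1(s)<0,\ \inf_{0\le s\le t}U_2(s)<0\}$ (both lines negative, not necessarily simultaneously). All distributions have infinite right endpoint; $\overline V=1-V$. $V\in\mathcal{D}$ if $\limsup_{x\to\infty}\overline V(tx)/\overline V(x)<\infty$ for some (equivalently all) $t\in(0,1)$; $V\in\mathcal{L}$ if $\lim_{x\to\infty}\overline V(x-a)/\overline V(x)=1$ for all $a>0$. SAI (for non-negative $X,Y$ with distributions $F,G$): $\mathbb{P}(X>x,Y>y)\sim C\overline F(x)\overline G(y)$ as $x\wedge y\to\infty$. GTAI: random variables $X_1,\ldots,X_n,Y_1,\ldots,Y_m$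 with supports unbounded above are GTAI if $\lim_{x_i\wedge x_k\wedge y_j\to\infty}\mathbb{P}(|X_i|>x_i\mid X_k>x_k,Y_j>y_j)=0$ for all $1\le i\neq k\le n$, $1\le j\le m$, and $\lim_{x_i\wedge y_j\wedge y_k\to\infty}\mathbb{P}(|Y_j|>y_j\mid X_i>x_i,Y_k>y_k)=0$ for all $1\le j\neq k\le m$, $1\le i\le n$. *)

theory Defs
  imports "HOL-Probability.Probability" "HOL-Library.Landau_Symbols"
begin

definition tailf :: "(real \<Rightarrow> real) \<Rightarrow> real \<Rightarrow> real" where
  "tailf V x = 1 - V x"

definition classD :: "(real \<Rightarrow> real) \<Rightarrow> bool" where
  "classD V \<longleftrightarrow> (\<exists>t. 0 < t \<and> t < 1 \<and>
     Limsup at_top (\<lambda>x. ereal (tailf V (t * x) / tailf V x)) < \<infinity>)"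

definition classL :: "(real \<Rightarrow> real) \<Rightarrow> bool" where
  "classL V \<longleftrightarrow> (\<forall>a>0. ((\<lambda>x. tailf V (x - a) / tailf V x) \<longlongrightarrow> 1) at_top)"

definition events_of ::
  "'a measure \<Rightarrow> ('i \<Rightarrow> 'a \<Rightarrow> real) \<Rightarrow> 'i set \<Rightarrow> 'a set set" where
  "events_of M Z I = (\<Union>i\<in>I. {Z i -` A \<inter> space M | A. A \<in> sets borel})"

definition cond_prob :: "'a measure \<Rightarrow> 'a set \<Rightarrow> 'a set \<Rightarrow> real" where
  "cond_prob M A B = measure M (A \<inter> B) / measure M B"

definition GTAI :: "'a measure \<Rightarrow> (nat \<Rightarrow> 'a \<Rightarrow> real) \<Rightarrow> nat \<Rightarrow> (nat \<Rightarrow> 'a \<Rightarrow> real) \<Rightarrow> nat \<Rightarrow> bool" where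
  "GTAI M X n Y m \<longleftrightarrow>
     (\<forall>i\<in>{1..n}. \<forall>x. measure M {\<omega>\<in>space M. X i \<omega> > x} > 0) \<and>
     (\<forall>j\<in>{1..m}. \<forall>y. measure M {\<omega>\<in>space M. Y j \<omega> > y} > 0) \<and>
     (\<forall>i\<in>{1..n}. \<forall>k\<in>{1..n}. \<forall>j\<in>{1..m}. i \<noteq> k \<longrightarrow>
        ((\<lambda>(xi, xk, yj). cond_prob M {\<omega>\<in>space M. \<bar>X i \<omega>\<bar> > xi}
             {\<omega>\<in>space M. X k \<omega> > xk \<and> Y j \<omega> > yj}) \<longlongrightarrow> 0)
        (at_top \<times>\<^sub>F at_top \<times>\<^sub>F at_top)) \<and>
     (\<forall>j\<in>{1..m}. \<forall>k\<in>{1..m}. \<forall>i\<in>{1..n}. j \<noteq> k \<longrightarrow>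
        ((\<lambda>(yj, xi, yk). cond_prob M {\<omega>\<in>space M. \<bar>Y j \<omega>\<bar> > yj}
             {\<omega>\<in>space M. X i \<omega> > xi \<and> Y k \<omega> > yk}) \<longlongrightarrow> 0)
        (at_top \<times>\<^sub>F at_top \<times>\<^sub>F at_top))"

definition arrival :: "(nat \<Rightarrow> 'a \<Rightarrow> real) \<Rightarrow> nat \<Rightarrow> 'a \<Rightarrow> real" where
  "arrival \<theta> i \<omega> = (\<Sum>k\<in>{1..i}. \<theta> k \<omega>)"

definition count_proc :: "(nat \<Rightarrow> 'a \<Rightarrow> real) \<Rightarrow> real \<Rightarrow> 'a \<Rightarrow> ennreal" where
  "count_proc \<theta> t \<omega> = (\<Sum>i. indicator {..t} (arrival \<theta> (Suc i) \<omega>))"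

definition renewal_fn :: "'a measure \<Rightarrow> (nat \<Rightarrow> 'a \<Rightarrow> real) \<Rightarrow> real \<Rightarrow> ennreal" where
  "renewal_fn M \<theta> t = (\<integral>\<^sup>+\<omega>. count_proc \<theta> t \<omega> \<partial>M)"

definition renewal_measure :: "'a measure \<Rightarrow> (nat \<Rightarrow> 'a \<Rightarrow> real) \<Rightarrow> real measure" where
  "renewal_measure M \<theta> = measure_of UNIV (sets borel)
     (\<lambda>A. \<integral>\<^sup>+\<omega>. (\<Sum>i. indicator A (arrival \<theta> (Suc i) \<omega>)) \<partial>M)"

definition disc_claims :: "real \<Rightarrow> (nat \<Rightarrow> 'a \<Rightarrow> real) \<Rightarrow> (nat \<Rightarrow> 'a \<Rightarrow> real) \<Rightarrow> real \<Rightarrow> 'a \<Rightarrow> real" where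
  "disc_claims r \<theta> Z t \<omega> =
     (\<Sum>i\<in>{i. 1 \<le> i \<and> arrival \<theta> i \<omega> \<le> t}. Z i \<omega> * exp (- r * arrival \<theta> i \<omega>))"

definition ext_path :: "(real \<Rightarrow> 'a \<Rightarrow> real) \<Rightarrow> 'a \<Rightarrow> real \<Rightarrow> real" where
  "ext_path Cp \<omega> s = (if s < 0 then 0 else Cp s \<omega>)"

definition disc_premium :: "real \<Rightarrow> (real \<Rightarrow> 'a \<Rightarrow> real) \<Rightarrow> real \<Rightarrow> 'a \<Rightarrow> real" where
  "disc_premium r Cp t \<omega> =
     set_lebesgue_integral (interval_measure (ext_path Cp \<omega>)) {0..t} (\<lambda>s. exp (- r * s))"

definition surplus :: "real \<Rightarrow> real \<Rightarrow> (real \<Rightarrow> 'a \<Rightarrow> real) \<Rightarrow> (nat \<Rightarrow> 'a \<Rightarrow> real)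
    \<Rightarrow> (nat \<Rightarrow> 'a \<Rightarrow> real) \<Rightarrow> real \<Rightarrow> 'a \<Rightarrow> real" where
  "surplus r u Cp \<theta> Z t \<omega> = u + disc_premium r Cp t \<omega> - disc_claims r \<theta> Z t \<omega>"

text \<open>Ruin times (Inf of empty set is infinity).\<close>
definition T_max :: "(real \<Rightarrow> 'a \<Rightarrow> real) \<Rightarrow> (real \<Rightarrow> 'a \<Rightarrow> real) \<Rightarrow> 'a \<Rightarrow> ereal" where
  "T_max U1 U2 \<omega> = Inf (ereal ` {t. t > 0 \<and> max (U1 t \<omega>) (U2 t \<omega>) < 0})"

definition T_and :: "(real \<Rightarrow> 'a \<Rightarrow> real) \<Rightarrow> (real \<Rightarrow> 'a \<Rightarrow> real) \<Rightarrow> 'a \<Rightarrow> ereal" where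
  "T_and U1 U2 \<omega> = Inf (ereal ` {t. t > 0 \<and>
      (\<exists>s\<in>{0..t}. U1 s \<omega> < 0) \<and> (\<exists>s\<in>{0..t}. U2 s \<omega> < 0)})"

definition psi_max :: "'a measure \<Rightarrow> real \<Rightarrow> (real \<Rightarrow> 'a \<Rightarrow> real) \<Rightarrow> (real \<Rightarrow> 'a \<Rightarrow> real)
    \<Rightarrow> (nat \<Rightarrow> 'a \<Rightarrow> real) \<Rightarrow> (nat \<Rightarrow> 'a \<Rightarrow> real) \<Rightarrow> (nat \<Rightarrow> 'a \<Rightarrow> real)
    \<Rightarrow> real \<Rightarrow> real \<Rightarrow> real \<Rightarrow> real" where
  "psi_max M r C1 C2 \<theta> X Y x y T = measure M {\<omega>\<in>space M.
     T_max (surplus r x C1 \<theta> X) (surplus r y C2 \<theta> Y) \<omega> \<le> ereal T}"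

definition psi_and :: "'a measure \<Rightarrow> real \<Rightarrow> (real \<Rightarrow> 'a \<Rightarrow> real) \<Rightarrow> (real \<Rightarrow> 'a \<Rightarrow> real)
    \<Rightarrow> (nat \<Rightarrow> 'a \<Rightarrow> real) \<Rightarrow> (nat \<Rightarrow> 'a \<Rightarrow> real) \<Rightarrow> (nat \<Rightarrow> 'a \<Rightarrow> real)
    \<Rightarrow> real \<Rightarrow> real \<Rightarrow> real \<Rightarrow> real" where
  "psi_and M r C1 C2 \<theta> X Y x y T = measure M {\<omega>\<in>space M.
     T_and (surplus r x C1 \<theta> X) (surplus r y C2 \<theta> Y) \<omega> \<le> ereal T}"

definition Delta :: "real measure \<Rightarrow> (real \<Rightarrow> real) \<Rightarrow> (real \<Rightarrow> real) \<Rightarrow> real \<Rightarrow> real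
    \<Rightarrow> real \<Rightarrow> real \<Rightarrow> real \<Rightarrow> real" where
  "Delta lam F G C r x y T =
     enn2real (\<integral>\<^sup>+t. \<integral>\<^sup>+s. indicator {(s, t). 0 \<le> s \<and> 0 \<le> t \<and> s + t \<le> T} (s, t) *
        ennreal (tailf F (x * exp (r * (t + s))) * tailf G (y * exp (r * t))
               + tailf F (x * exp (r * t)) * tailf G (y * exp (r * (t + s)))) \<partial>lam \<partial>lam)
   + C * enn2real (\<integral>\<^sup>+t. indicator {0..T} t *
        ennreal (tailf F (x * exp (r * t)) * tailf G (y * exp (r * t))) \<partial>lam)"

end

theory Submission
  imports Defs
begin

text \<open>
Premiums only delay ruin by a tight random amount, so both ruin probabilities are squeezed between
\<open>P(D\<^sub>1(T) > x + L, D\<^sub>2(T) > y + L)\<close> times a probability close to 1 and \<open>P(D\<^sub>1(T) > x, D\<^sub>2(T) > y)\<close>.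
For the first \<open>m\<close> claims the principle of a single big jump holds in each line: GTAI makes two big jumps in
one line, together with one in the other, negligible, while class L absorbs shifts by constants. Hence the
probability is asymptotically the sum over \<open>i, j \<le> m\<close> of the probabilities that claim \<open>i\<close> of line 1
and claim \<open>j\<close> of line 2 are both large, which SAI (\<open>i = j\<close>) and independence (\<open>i \<noteq> j\<close>) evaluate.
The claims beyond \<open>m\<close> are uniformly negligible, because class D gives a bound polynomial in the
number \<open>n\<close> of claims whereas \<open>P(T\<^sub>n \<le> T)\<close> decays geometrically. Summing over all
\<open>i, j\<close> and using that \<open>T\<^sub>j - T\<^sub>i\<close> is independent of \<open>T\<^sub>i\<close> and distributed as \<open>T\<^sub>j\<^sub>-\<^sub>i\<close> gives \<open>Delta\<close>.
\<close>

section \<open>Tails and limits\<close>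

text \<open>All errors are measured in one unit, \<open>Fb x * Gb y\<close>. Class D and
  \<open>lam_pos\<close> show that \<open>Delta\<close> dominates a multiple of it, since
  discounting over \<open>[0, T]\<close> rescales levels by at most \<open>exp (r * T)\<close>; so
  an error that is small in this unit is small relative to \<open>Delta\<close>. As \<open>x\<close>
  and \<open>y\<close> grow without any relation to each other, every estimate has to be uniform
  over \<open>x \<ge> N\<close> and \<open>y \<ge> N\<close>. This dictates the order of choices:
  the truncation \<open>m\<close> first (its error is already uniform in \<open>x\<close> and
  \<open>y\<close>), then the GTAI tolerance, which pays for powers of \<open>m\<close>, then the
  constant shift \<open>a\<close>, and only then \<open>N\<close>. The two big claims may arrive at
  different times, yet this costs \<open>psi_max\<close> nothing: off the null event of explosion,
  discounted claims never decrease, so if both big claims have arrived by \<open>T\<close> and the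
  premiums are at most \<open>L\<close>, both lines are negative at the common time
  \<open>T\<close>.\<close>

lemma eventually_prod_at_top_iff:
  fixes P :: "real \<times> real \<Rightarrow> bool"
  shows "eventually P (at_top \<times>\<^sub>F at_top) \<longleftrightarrow> (\<exists>N. \<forall>x\<ge>N. \<forall>y\<ge>N. P (x, y))"
proof
  assume "eventually P (at_top \<times>\<^sub>F at_top)"
  then obtain Q R where QR: "eventually Q at_top" "eventually R at_top" "\<And>x y. Q x \<Longrightarrow> R y \<Longrightarrow> P (x, y)"
    unfolding eventually_prod_filter by auto
  then obtain a b where "\<forall>x\<ge>a. Q x" "\<forall>x\<ge>b. R x"
    by (auto simp: eventually_at_top_linorder)
  then show "\<exists>N. \<forall>x\<ge>N. \<forall>y\<ge>N. P (x, y)"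
    by (intro exI[of _ "max a b"]) (auto intro: QR)
next
  assume "\<exists>N. \<forall>x\<ge>N. \<forall>y\<ge>N. P (x, y)"
  then obtain N where "\<forall>x\<ge>N. \<forall>y\<ge>N. P (x, y)" by blast
  then show "eventually P (at_top \<times>\<^sub>F at_top)"
    unfolding eventually_prod_filter
    by (intro exI[of _ "\<lambda>x. x \<ge> N"]) (auto simp: eventually_ge_at_top)
qed

lemma asymp_equiv_prod_at_top_iff:
  fixes f g :: "real \<times> real \<Rightarrow> real"
  assumes pos: "eventually (\<lambda>p. g p > 0) (at_top \<times>\<^sub>F at_top)"
  shows "f \<sim>[at_top \<times>\<^sub>F at_top] g \<longleftrightarrow>
    (\<forall>\<epsilon>>0. \<exists>N. \<forall>x\<ge>N. \<forall>y\<ge>N. \<bar>f (x, y) - g (x, y)\<bar> \<le> \<epsilon> * g (x, y))"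
proof -
  have "f \<sim>[at_top \<times>\<^sub>F at_top] g \<longleftrightarrow> ((\<lambda>p. f p / g p) \<longlongrightarrow> 1) (at_top \<times>\<^sub>F at_top)"
    unfolding asymp_equiv_def
    by (intro tendsto_cong) (use pos in \<open>auto elim!: eventually_mono\<close>)
  also have "\<dots> \<longleftrightarrow> (\<forall>\<epsilon>>0. eventually (\<lambda>p. \<bar>f p - g p\<bar> \<le> \<epsilon> * g p) (at_top \<times>\<^sub>F at_top))"
  proof (intro iffI allI impI)
    fix \<epsilon> :: real assume \<epsilon>: "\<epsilon> > 0" and lim: "((\<lambda>p. f p / g p) \<longlongrightarrow> 1) (at_top \<times>\<^sub>F at_top)"
    from tendstoD[OF lim \<epsilon>] pos
    show "eventually (\<lambda>p. \<bar>f p - g p\<bar> \<le> \<epsilon> * g p) (at_top \<times>\<^sub>F at_top)"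
    proof eventually_elim
      case (elim p)
      then have "\<bar>f p / g p - 1\<bar> * g p \<le> \<epsilon> * g p"
        by (intro mult_right_mono) (auto simp: dist_real_def)
      moreover have "\<bar>f p / g p - 1\<bar> * g p = \<bar>f p - g p\<bar>"
      proof -
        have "\<bar>f p / g p - 1\<bar> * g p = \<bar>(f p / g p - 1) * g p\<bar>" using elim by (simp add: abs_mult)
        also have "(f p / g p - 1) * g p = f p - g p" using elim by (simp add: field_simps)
        finally show ?thesis .
      qed
      ultimately show ?case by simp
    qed
  next
    assume *: "\<forall>\<epsilon>>0. eventually (\<lambda>p. \<bar>f p - g p\<bar> \<le> \<epsilon> * g p) (at_top \<times>\<^sub>F at_top)"
    show "((\<lambda>p. f p / g p) \<longlongrightarrow> 1) (at_top \<times>\<^sub>F at_top)"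
    proof (rule tendstoI)
      fix e :: real assume "e > 0"
      then have "eventually (\<lambda>p. \<bar>f p - g p\<bar> \<le> (e/2) * g p) (at_top \<times>\<^sub>F at_top)"
        using * by (meson half_gt_zero)
      then show "eventually (\<lambda>p. dist (f p / g p) 1 < e) (at_top \<times>\<^sub>F at_top)"
        using pos
      proof eventually_elim
        case (elim p)
        have "f p / g p - 1 = (f p - g p) / g p" using elim by (simp add: field_simps)
        then have "\<bar>f p / g p - 1\<bar> = \<bar>f p - g p\<bar> / g p" using elim by simp
        also have "\<dots> \<le> e / 2" using elim by (simp add: field_simps)
        finally show ?case using \<open>e > 0\<close> by (simp add: dist_real_def)
      qed
    qed
  qed
  also have "\<dots> \<longleftrightarrow> (\<forall>\<epsilon>>0. \<exists>N. \<forall>x\<ge>N. \<forall>y\<ge>N. \<bar>f (x, y) - g (x, y)\<bar> \<le> \<epsilon> * g (x, y))"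
    by (simp add: eventually_prod_at_top_iff)
  finally show ?thesis .
qed

lemma classL_shift_le:
  assumes L: "classL V" and pos: "\<And>x. tailf V x > 0" and a: "a \<ge> 0" and e: "\<epsilon> > 0"
  shows "\<exists>x0. \<forall>x\<ge>x0. tailf V (x - a) \<le> (1 + \<epsilon>) * tailf V x"
proof (cases "a = 0")
  case True
  then show ?thesis using pos e by (intro exI[of _ 0]) (auto intro!: mult_right_mono[of 1, simplified] less_imp_le)
next
  case False
  then have "((\<lambda>x. tailf V (x - a) / tailf V x) \<longlongrightarrow> 1) at_top"
    using L a by (simp add: classL_def)
  then have "eventually (\<lambda>x. tailf V (x - a) / tailf V x < 1 + \<epsilon>) at_top"
    by (rule order_tendstoD) (use e in auto)
  then obtain x0 where "\<forall>x\<ge>x0. tailf V (x - a) / tailf V x < 1 + \<epsilon>"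
    by (auto simp: eventually_at_top_linorder)
  then show ?thesis using pos
    by (intro exI[of _ x0]) (auto simp: divide_less_eq intro!: less_imp_le)
qed

text \<open>Class D bounds the tail ratio for a single factor \<open>t\<close>. Iterating it
  \<open>j\<close> times costs \<open>B ^ j\<close>, and reaching the factor \<open>1 / n\<close>
  takes about \<open>log n\<close> iterations, so the total cost is polynomial in \<open>n\<close>.
  A polynomial can be beaten by the geometric decay of the arrival probabilities.\<close>

lemma classD_dilation_le:
  assumes D: "classD V" and pos: "\<And>x. tailf V x > 0" and le1: "\<And>x. tailf V x \<le> 1"
    and anti: "antimono (tailf V)"
  shows "\<exists>K q. K > 0 \<and> (\<forall>n\<ge>1. \<forall>x\<ge>0. tailf V (x / real n) \<le> K * real n ^ q * tailf V x)"
proof -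
  obtain t where t: "0 < t" "t < 1"
    and lim: "Limsup at_top (\<lambda>x. ereal (tailf V (t * x) / tailf V x)) < \<infinity>"
    using D by (auto simp: classD_def)
  then obtain b where b: "Limsup at_top (\<lambda>x. ereal (tailf V (t * x) / tailf V x)) < ereal b"
    using less_PInf_Ex_of_nat by auto
  have "eventually (\<lambda>x. ereal (tailf V (t * x) / tailf V x) < ereal b) at_top"
    using b by (rule Limsup_lessD)
  then obtain x0 where x0: "\<And>x. x \<ge> x0 \<Longrightarrow> tailf V (t * x) / tailf V x < b"
    by (auto simp: eventually_at_top_linorder)
  \<comment> \<open>\<open>b\<close> serves \<open>x \<ge> x0\<close>. Below \<open>x0\<close> the
    tail is at least \<open>tailf V x0\<close>, so \<open>1 / tailf V x0\<close> makes the right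
    side at least 1.\<close>
  define B where "B = max 1 (max b (1 / tailf V x0))"
  have B1: "B \<ge> 1" by (simp add: B_def)
  have step: "tailf V (t * x) \<le> B * tailf V x" for x
  proof (cases "x \<ge> x0")
    case True
    then have "tailf V (t * x) \<le> b * tailf V x"
      using x0[of x] pos[of x] by (simp add: divide_less_eq)
    also have "\<dots> \<le> B * tailf V x"
      using pos[of x] by (intro mult_right_mono) (auto simp: B_def)
    finally show ?thesis .
  next
    case False
    then have "tailf V x0 \<le> tailf V x" using anti by (auto simp: antimono_def)
    then have "1 \<le> (1 / tailf V x0) * tailf V x"
      using pos[of x0] by (simp add: field_simps)
    also have "\<dots> \<le> B * tailf V x"
      using pos[of x] by (intro mult_right_mono) (auto simp: B_def)
    finally show ?thesis using le1[of "t * x"] by simp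
  qed
  have steps: "tailf V (t ^ j * x) \<le> B ^ j * tailf V x" for j x
  proof (induction j)
    case (Suc j)
    have "tailf V (t ^ Suc j * x) \<le> B * tailf V (t ^ j * x)"
      using step[of "t ^ j * x"] by (simp add: mult.assoc)
    also have "\<dots> \<le> B * (B ^ j * tailf V x)"
      using Suc B1 by (intro mult_left_mono) auto
    finally show ?case by (simp add: mult.assoc)
  qed simp
  \<comment> \<open>The exponent: with it, \<open>B ^ j\<close> is at most the \<open>q\<close>-th
    power of \<open>(1 / t) ^ j\<close>.\<close>
  obtain q where q: "B < (1 / t) ^ q"
    using real_arch_pow[of "1 / t" B] t by auto
  have "tailf V (x / real n) \<le> (1 / t) ^ q * real n ^ q * tailf V x" if n: "n \<ge> 1" and x: "x \<ge> 0" for n x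
  proof -
    \<comment> \<open>Minimality places \<open>(1 / t) ^ j\<close> between \<open>n\<close> and
      \<open>n / t\<close>: large enough for the dilation, small enough for the cost.\<close>
    define j where "j = (LEAST j. real n \<le> (1 / t) ^ j)"
    have ex: "\<exists>j. real n \<le> (1 / t) ^ j"
      using real_arch_pow[of "1 / t" "real n"] t by (auto intro: less_imp_le)
    have j1: "real n \<le> (1 / t) ^ j" unfolding j_def using ex by (rule LeastI_ex)
    have j2: "(1 / t) ^ j \<le> (1 / t) * real n"
    proof (cases j)
      case 0 then show ?thesis using t n by (simp add: field_simps)
    next
      case (Suc k)
      then have "\<not> real n \<le> (1 / t) ^ k" unfolding j_def using not_less_Least by (metis lessI)
      then have "(1 / t) * (1 / t) ^ k \<le> (1 / t) * real n"
        using t by (intro mult_left_mono) auto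
      then show ?thesis by (simp add: Suc)
    qed
    have "t ^ j * real n \<le> 1"
      using j1 t by (simp add: power_divide field_simps)
    then have "t ^ j \<le> 1 / real n" using n by (simp add: field_simps)
    then have "t ^ j * x \<le> x / real n" using x mult_right_mono[of "t ^ j" "1 / real n" x] by simp
    then have "tailf V (x / real n) \<le> tailf V (t ^ j * x)"
      using anti by (auto simp: antimono_def)
    also have "\<dots> \<le> B ^ j * tailf V x" by (rule steps)
    also have "B ^ j \<le> ((1 / t) ^ q) ^ j" using q B1 by (intro power_mono) auto
    also have "((1 / t) ^ q) ^ j = ((1 / t) ^ j) ^ q" by (simp add: power_mult[symmetric] mult.commute)
    also have "\<dots> \<le> ((1 / t) * real n) ^ q" using j2 t by (intro power_mono) auto
    also have "\<dots> = (1 / t) ^ q * real n ^ q" by (simp add: power_mult_distrib[symmetric])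
    finally show ?thesis using pos[of x] by (simp add: mult_right_mono)
  qed
  then show ?thesis using t by (intro exI[of _ "(1 / t) ^ q"] exI[of _ q]) auto
qed

lemma obtain_small_factor:
  fixes \<epsilon> :: real
  assumes "\<epsilon> > 0"
  obtains \<delta> where "\<delta> > 0" "(1 + \<delta>) * (1 + \<delta>) \<le> 1 + \<epsilon>"
proof
  define \<delta> where "\<delta> = min 1 (\<epsilon> / 3)"
  show d: "\<delta> > 0" using assms by (simp add: \<delta>_def)
  have "\<delta> * \<delta> \<le> 1 * \<delta>" using d by (intro mult_right_mono) (auto simp: \<delta>_def)
  moreover have "3 * \<delta> \<le> \<epsilon>" by (simp add: \<delta>_def)
  ultimately show "(1 + \<delta>) * (1 + \<delta>) \<le> 1 + \<epsilon>" by (simp add: algebra_simps)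
qed

section \<open>Paths of the surplus process\<close>

locale cadlag_premium =
  fixes c :: "real \<Rightarrow> real" and r :: real
  assumes r0: "r \<ge> 0" and c0: "c 0 = 0" and mono: "mono_on {0..} c"
    and rcont: "\<And>t. t \<ge> 0 \<Longrightarrow> continuous (at_right t) c"
begin

text \<open>\<open>interval_measure\<close> expects a nondecreasing right-continuous function on the
  whole line. Because \<open>c 0 = 0\<close>, extending by 0 creates no atom at 0, so an integral
  that starts at 0- has the same value as one that starts just after 0.\<close>

definition "ext s = (if s < 0 then 0 else c s)"
definition "prem t = set_lebesgue_integral (interval_measure ext) {0..t} (\<lambda>s. exp (- r * s))"

lemma ext_mono: "x \<le> y \<Longrightarrow> ext x \<le> ext y"
  using mono c0 by (auto simp: ext_def mono_on_def) (metis atLeast_iff linorder_not_less order_refl)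

lemma ext_rcont: "continuous (at_right a) ext"
proof (cases "a < 0")
  case True
  have "\<forall>\<^sub>F x in at_right a. ext x = ext a"
    using True by (auto simp: eventually_at_right ext_def intro!: exI[of _ 0])
  then show ?thesis by (simp add: continuous_within tendsto_eventually)
next
  case False
  have "\<forall>\<^sub>F x in at_right a. c x = ext x"
    using False by (auto simp: eventually_at_right_field ext_def intro!: exI[of _ "a+1"])
  moreover have "(c \<longlongrightarrow> ext a) (at_right a)"
    using rcont[of a] False by (simp add: continuous_within ext_def)
  ultimately show ?thesis unfolding continuous_within
    by (rule Lim_transform_eventually[rotated])
qed

lemma emeasure_Ioc: "s \<le> t \<Longrightarrow> emeasure (interval_measure ext) {s<..t} = ennreal (ext t - ext s)"
  by (rule emeasure_interval_measure_Ioc[OF _ ext_mono ext_rcont])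

lemma measure_Ioc: "s \<le> t \<Longrightarrow> measure (interval_measure ext) {s<..t} = ext t - ext s"
  by (simp add: emeasure_Ioc measure_def ext_mono)

lemma emeasure_Icc_fin: "emeasure (interval_measure ext) {0..t} < \<infinity>"
proof -
  have "emeasure (interval_measure ext) {0..t} \<le> emeasure (interval_measure ext) {-1<..max t 0}"
    by (intro emeasure_mono) auto
  then show ?thesis by (simp add: emeasure_Ioc) (metis ennreal_less_top infinity_ennreal_def order_le_less_trans)
qed

lemma set_integrable_exp: "set_integrable (interval_measure ext) {0..t} (\<lambda>s. exp (- r * s))"
  unfolding set_integrable_def
proof (rule Bochner_Integration.integrable_bound)
  show "integrable (interval_measure ext) (indicat_real {0..t})"
    using emeasure_Icc_fin by (simp add: integrable_indicator_iff)
  show "(\<lambda>x. indicat_real {0..t} x *\<^sub>R exp (- r * x)) \<in> borel_measurable (interval_measure ext)"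
    by measurable
qed (auto simp: indicator_def r0)

lemma prem_0: "prem 0 = 0"
proof -
  have "emeasure (interval_measure ext) {0} \<le> emeasure (interval_measure ext) {-1<..0}"
    by (intro emeasure_mono) auto
  also have "\<dots> = 0" by (simp add: emeasure_Ioc ext_def c0)
  finally have "AE s in interval_measure ext. s \<notin> {0}"
    by (intro AE_not_in) (auto simp: null_sets_def)
  then have "prem 0 = (\<integral>s. 0 \<partial>interval_measure ext)"
    unfolding prem_def set_lebesgue_integral_def
    by (intro integral_cong_AE) (auto simp: indicator_def elim!: eventually_mono)
  then show ?thesis by simp
qed

text \<open>On \<open>(s, t]\<close> the discount factor lies between its values at the two
  endpoints. The later properties of \<open>prem\<close> come from this sandwich together with
  \<open>prem_0\<close>, without returning to the integral.\<close>

lemma prem_diff: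
  assumes "0 \<le> s" "s \<le> t"
  shows "prem t - prem s \<le> exp (- r * s) * (c t - c s)"
    and "exp (- r * t) * (c t - c s) \<le> prem t - prem s"
proof -
  have un: "{0..t} = {0..s} \<union> {s<..t}" using assms by auto
  have int: "set_integrable (interval_measure ext) {s<..t} (\<lambda>s. exp (- r * s))"
    using set_integrable_exp by (rule set_integrable_subset) (use assms in auto)
  have eq: "prem t - prem s = set_lebesgue_integral (interval_measure ext) {s<..t} (\<lambda>s. exp (- r * s))"
    unfolding prem_def un
    by (subst set_integral_Un) (use set_integrable_exp int in auto)
  have ic: "set_integrable (interval_measure ext) {s<..t} (\<lambda>_. k)" for k :: real
    unfolding set_integrable_def using emeasure_Ioc[OF assms(2)] 
    by (auto simp: integrable_indicator_iff)
  have val: "set_lebesgue_integral (interval_measure ext) {s<..t} (\<lambda>_. k) = k * (c t - c s)" for k :: real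
    unfolding set_lebesgue_integral_def using measure_Ioc[OF assms(2)] assms
    by (simp add: ext_def)
  have "set_lebesgue_integral (interval_measure ext) {s<..t} (\<lambda>s. exp (- r * s)) 
     \<le> set_lebesgue_integral (interval_measure ext) {s<..t} (\<lambda>_. exp (- r * s))"
    by (rule set_integral_mono[OF int ic]) (auto intro!: mult_left_mono r0)
  then show "prem t - prem s \<le> exp (- r * s) * (c t - c s)" by (simp add: eq val)
  have "set_lebesgue_integral (interval_measure ext) {s<..t} (\<lambda>_. exp (- r * t))
     \<le> set_lebesgue_integral (interval_measure ext) {s<..t} (\<lambda>s. exp (- r * s))"
    by (rule set_integral_mono[OF ic int]) (auto intro!: mult_left_mono r0)
  then show "exp (- r * t) * (c t - c s) \<le> prem t - prem s" by (simp add: eq val)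
qed

lemma c_mono: "0 \<le> s \<Longrightarrow> s \<le> t \<Longrightarrow> c s \<le> c t"
  using mono by (auto simp: mono_on_def)

lemma prem_mono: "0 \<le> s \<Longrightarrow> s \<le> t \<Longrightarrow> prem s \<le> prem t"
  using prem_diff(2)[of s t] c_mono[of s t] 
  by (smt (verit) exp_ge_zero mult_nonneg_nonneg)

lemma prem_diff_le: "0 \<le> s \<Longrightarrow> s \<le> t \<Longrightarrow> prem t - prem s \<le> c t - c s"
proof -
  assume st: "0 \<le> s" "s \<le> t"
  have "exp (- r * s) * (c t - c s) \<le> 1 * (c t - c s)"
    using st r0 c_mono[OF st] by (intro mult_right_mono) auto
  then show ?thesis using prem_diff(1)[OF st] by simp
qed

lemma prem_le: "0 \<le> t \<Longrightarrow> prem t \<le> c t"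
  using prem_diff_le[of 0 t] by (simp add: prem_0 c0)

lemma prem_nonneg: "0 \<le> t \<Longrightarrow> 0 \<le> prem t"
  using prem_mono[of 0 t] by (simp add: prem_0)

lemma prem_rcont: "0 \<le> t \<Longrightarrow> (prem \<longlongrightarrow> prem t) (at_right t)"
proof -
  assume t: "0 \<le> t"
  have lim: "((\<lambda>s. prem t + (c s - c t)) \<longlongrightarrow> prem t + (c t - c t)) (at_right t)"
    using rcont[OF t] by (intro tendsto_intros) (simp add: continuous_within)
  have ev: "\<forall>\<^sub>F s in at_right t. s \<ge> t"
    by (auto simp: eventually_at_right_field intro!: exI[of _ "t+1"])
  show ?thesis
  proof (rule tendsto_sandwich[OF _ _ tendsto_const[of "prem t"] lim[simplified]])
    show "\<forall>\<^sub>F s in at_right t. prem t \<le> prem s" using ev by eventually_elim (use t prem_mono in auto)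
    show "\<forall>\<^sub>F s in at_right t. prem s \<le> prem t + (c s - c t)"
      using ev by eventually_elim (use t prem_diff_le in \<open>auto simp: algebra_simps\<close>)
  qed
qed

text \<open>The premium integral is taken against a measure that depends on the path, so its
  measurability in the path is not immediate. Finite sums of values of \<open>c\<close> with this
  limit provide it. On a cell of length \<open>t / n\<close> the factor \<open>exp (- r * s)\<close>
  varies by at most \<open>r * t / n\<close>, and the increments of \<open>c\<close> add up to
  \<open>c t\<close>, which gives an error of order \<open>1 / n\<close>.\<close>

lemma prem_Riemann:
  assumes t: "0 \<le> t"
  shows "(\<lambda>n. \<Sum>k<n. exp (- r * (t * real k / real n)) * (c (t * real (Suc k) / real n) - c (t * real k / real n))) \<longlonglongrightarrow> prem t"
proof -
  let ?S = "\<lambda>n::nat. \<Sum>k<n. exp (- r * (t * real k / real n)) * (c (t * real (Suc k) / real n) - c (t * real k / real n))"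
  have bound: "dist (?S n) (prem t) \<le> (r * t * c t) * (1 / real n)" if n: "n > 0" for n :: nat
  proof -
    let ?t = "\<lambda>k. t * real k / real n"
    have tel_c: "(\<Sum>k<n. c (?t (Suc k)) - c (?t k)) = c t"
      using sum_lessThan_telescope[of "\<lambda>k. c (?t k)" n] n by (simp add: c0)
    have tel_p: "(\<Sum>k<n. prem (?t (Suc k)) - prem (?t k)) = prem t"
      using sum_lessThan_telescope[of "\<lambda>k. prem (?t k)" n] n by (simp add: prem_0)
    have tk: "0 \<le> ?t k" "?t k \<le> ?t (Suc k)" for k
      using t n by (auto intro!: divide_right_mono mult_left_mono)
    have dt: "?t (Suc k) - ?t k = t / n" for k using n by (simp add: field_simps)
    have "\<bar>?S n - prem t\<bar> = \<bar>\<Sum>k<n. exp (- r * ?t k) * (c (?t (Suc k)) - c (?t k)) - (prem (?t (Suc k)) - prem (?t k))\<bar>"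
      by (simp add: tel_p[symmetric] sum_subtractf)
    also have "\<dots> \<le> (\<Sum>k<n. \<bar>exp (- r * ?t k) * (c (?t (Suc k)) - c (?t k)) - (prem (?t (Suc k)) - prem (?t k))\<bar>)"
      by (rule sum_abs)
    also have "\<dots> \<le> (\<Sum>k<n. (r * t / n) * (c (?t (Suc k)) - c (?t k)))"
    proof (rule sum_mono)
      fix k
      have e: "exp (- r * ?t k) - exp (- r * ?t (Suc k)) \<le> r * t / n"
      proof -
        have "exp (- r * ?t (Suc k)) = exp (- r * ?t k) * exp (- (r * (t / n)))"
        proof -
          have *: "exp (- r * v) = exp (- r * w) * exp (- (r * (v - w)))" for v w
            by (simp add: exp_add[symmetric] algebra_simps)
          show ?thesis using *[of "?t (Suc k)" "?t k"] by (simp only: dt)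
        qed
        then have "exp (- r * ?t k) - exp (- r * ?t (Suc k)) = exp (- r * ?t k) * (1 - exp (- (r * (t / n))))"
          by (simp add: algebra_simps)
        also have "\<dots> \<le> 1 * (r * (t / n))"
          using exp_ge_add_one_self[of "- (r * (t / n))"] r0 t tk(1)[of k]
          by (intro mult_mono) auto
        finally show ?thesis by simp
      qed
      have "\<bar>exp (- r * ?t k) * (c (?t (Suc k)) - c (?t k)) - (prem (?t (Suc k)) - prem (?t k))\<bar>
          \<le> (exp (- r * ?t k) - exp (- r * ?t (Suc k))) * (c (?t (Suc k)) - c (?t k))"
        using prem_diff[OF tk, of k] unfolding left_diff_distrib by linarith
      also have "\<dots> \<le> (r * t / n) * (c (?t (Suc k)) - c (?t k))"
        using e c_mono[OF tk, of k] by (intro mult_right_mono) auto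
      finally show "\<bar>exp (- r * ?t k) * (c (?t (Suc k)) - c (?t k)) - (prem (?t (Suc k)) - prem (?t k))\<bar>
          \<le> (r * t / n) * (c (?t (Suc k)) - c (?t k))" .
    qed
    also have "\<dots> = (r * t / n) * c t" by (simp only: sum_distrib_left[symmetric] tel_c)
    finally show ?thesis by (simp add: dist_real_def)
  qed
  have "(\<lambda>n. (r * t * c t) * (1 / real n)) \<longlonglongrightarrow> (r * t * c t) * 0"
    by (intro tendsto_intros lim_1_over_n)
  then have lim: "(\<lambda>n. (r * t * c t) * (1 / real n)) \<longlonglongrightarrow> 0" by simp
  have "(\<lambda>n. dist (?S n) (prem t)) \<longlonglongrightarrow> 0"
  proof (rule tendsto_sandwich[OF _ _ tendsto_const lim])
    show "\<forall>\<^sub>F n in sequentially. dist (?S n) (prem t) \<le> (r * t * c t) * (1 / real n)"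
      using eventually_gt_at_top[of "0::nat"] by eventually_elim (rule bound)
  qed (rule always_eventually, simp)
  then show ?thesis by (rule tendsto_dist_iff[THEN iffD2])
qed

end

section \<open>Ruin times and claim sums along one path\<close>

lemma arrival_0 [simp]: "arrival \<theta> 0 \<omega> = 0"
  by (simp add: arrival_def)

lemma arrival_Suc: "arrival \<theta> (Suc n) \<omega> = arrival \<theta> n \<omega> + \<theta> (Suc n) \<omega>"
  by (simp add: arrival_def)

text \<open>Between claims the surplus does not decrease, so a nonnegative value persists until the
  next claim; a negative value persists for a while by right continuity. Right continuity alone
  would not suffice, since a path at the value 0 could become negative at once.\<close>

definition right_stable :: "(real \<Rightarrow> real) \<Rightarrow> bool" where
  "right_stable U \<longleftrightarrow> (\<forall>t\<ge>0. \<exists>\<delta>>0. \<forall>s. t \<le> s \<and> s < t + \<delta> \<longrightarrow> (U s < 0 \<longleftrightarrow> U t < 0))"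

lemma right_stableD:
  assumes "right_stable U" "t \<ge> 0"
  obtains \<delta> where "\<delta> > 0" "\<And>s. t \<le> s \<Longrightarrow> s < t + \<delta> \<Longrightarrow> U s < 0 \<longleftrightarrow> U t < 0"
  using assms unfolding right_stable_def by blast

lemma right_stable_max:
  assumes "right_stable U" "right_stable V"
  shows "right_stable (\<lambda>t. max (U t) (V t))"
  unfolding right_stable_def
proof (intro allI impI)
  fix t :: real assume t: "t \<ge> 0"
  obtain d1 where d1: "d1 > 0" "\<And>s. t \<le> s \<Longrightarrow> s < t + d1 \<Longrightarrow> U s < 0 \<longleftrightarrow> U t < 0"
    using right_stableD[OF assms(1) t] by blast
  obtain d2 where d2: "d2 > 0" "\<And>s. t \<le> s \<Longrightarrow> s < t + d2 \<Longrightarrow> V s < 0 \<longleftrightarrow> V t < 0"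
    using right_stableD[OF assms(2) t] by blast
  show "\<exists>\<delta>>0. \<forall>s. t \<le> s \<and> s < t + \<delta> \<longrightarrow> (max (U s) (V s) < 0 \<longleftrightarrow> max (U t) (V t) < 0)"
  proof (intro exI[of _ "min d1 d2"] conjI allI impI)
    show "0 < min d1 d2" using d1(1) d2(1) by simp
    fix s assume "t \<le> s \<and> s < t + min d1 d2"
    then have "t \<le> s" "s < t + d1" "s < t + d2" by auto
    then show "max (U s) (V s) < 0 \<longleftrightarrow> max (U t) (V t) < 0"
      using d1(2)[of s] d2(2)[of s] by simp
  qed
qed

text \<open>A negative value at \<open>t < T\<close> spreads to a rational point just to the right
  of \<open>t\<close>. At \<open>t = T\<close> there is no room left inside the interval, hence the
  separate disjunct.\<close>

lemma right_stable_rational: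
  assumes U: "right_stable U" and T: "0 \<le> a" "a \<le> T"
  shows "(\<exists>t\<in>{a..T}. U t < 0) \<longleftrightarrow> U T < 0 \<or> (\<exists>q\<in>{a..T} \<inter> \<rat>. U q < 0)"
proof
  assume "\<exists>t\<in>{a..T}. U t < 0"
  then obtain t where t: "a \<le> t" "t \<le> T" "U t < 0" by auto
  show "U T < 0 \<or> (\<exists>q\<in>{a..T} \<inter> \<rat>. U q < 0)"
  proof (cases "t = T")
    case False
    obtain d where d: "d > 0" "\<And>s. t \<le> s \<Longrightarrow> s < t + d \<Longrightarrow> U s < 0 \<longleftrightarrow> U t < 0"
      using right_stableD[OF U, of t] t T by auto
    obtain q where q: "q \<in> \<rat>" "t < q" "q < min T (t + d)"
      using Rats_dense_in_real[of t "min T (t + d)"] t(2) False d(1) by force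
    have "U q < 0" using d(2)[of q] q(2,3) t(3) by simp
    moreover have "q \<in> {a..T} \<inter> \<rat>" using q t(1) by simp
    ultimately show ?thesis by blast
  qed (use t in auto)
qed (use T in auto)

text \<open>The infimum could be at most \<open>T\<close> without ruin in \<open>[0, T]\<close> only
  if ruin times decreased to \<open>T\<close>, and stability at \<open>T\<close> excludes that. The
  premise \<open>init\<close> reconciles the two sides at time 0, which the right side admits and
  the ruin time does not.\<close>

lemma T_max_le_iff:
  assumes "right_stable (\<lambda>t. U1 t \<omega>)" "right_stable (\<lambda>t. U2 t \<omega>)" and T: "T > 0"
    and init: "max (U1 0 \<omega>) (U2 0 \<omega>) \<ge> 0"
  shows "T_max U1 U2 \<omega> \<le> ereal T \<longleftrightarrow> (\<exists>t\<in>{0..T}. max (U1 t \<omega>) (U2 t \<omega>) < 0)"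
proof
  assume "\<exists>t\<in>{0..T}. max (U1 t \<omega>) (U2 t \<omega>) < 0"
  then obtain t where t: "0 \<le> t" "t \<le> T" "max (U1 t \<omega>) (U2 t \<omega>) < 0" by auto
  moreover have "t \<noteq> 0" using t init by auto
  ultimately show "T_max U1 U2 \<omega> \<le> ereal T"
    unfolding T_max_def by (intro Inf_lower2[of "ereal t"]) auto
next
  assume le: "T_max U1 U2 \<omega> \<le> ereal T"
  show "\<exists>t\<in>{0..T}. max (U1 t \<omega>) (U2 t \<omega>) < 0"
  proof (rule ccontr)
    assume neg: "\<not> ?thesis"
    obtain d where d: "d > 0" "\<And>s. T \<le> s \<Longrightarrow> s < T + d \<Longrightarrow>
        max (U1 s \<omega>) (U2 s \<omega>) < 0 \<longleftrightarrow> max (U1 T \<omega>) (U2 T \<omega>) < 0"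
      using right_stableD[OF right_stable_max[OF assms(1,2)], of T] T by auto
    have "s \<ge> T + d" if "s > 0" "max (U1 s \<omega>) (U2 s \<omega>) < 0" for s
    proof (rule ccontr)
      assume "\<not> s \<ge> T + d"
      then show False using that neg d(2)[of s] T by (cases "s \<le> T") auto
    qed
    then have "ereal (T + d) \<le> T_max U1 U2 \<omega>"
      unfolding T_max_def by (intro Inf_greatest) auto
    then have "ereal (T + d) \<le> ereal T" using le order_trans by blast
    then show False using d by simp
  qed
qed

lemma T_and_le_iff:
  assumes U: "right_stable (\<lambda>t. U1 t \<omega>)" "right_stable (\<lambda>t. U2 t \<omega>)" and T: "T > 0"
  shows "T_and U1 U2 \<omega> \<le> ereal T \<longleftrightarrow> (\<exists>t\<in>{0..T}. U1 t \<omega> < 0) \<and> (\<exists>t\<in>{0..T}. U2 t \<omega> < 0)"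
proof
  assume "(\<exists>t\<in>{0..T}. U1 t \<omega> < 0) \<and> (\<exists>t\<in>{0..T}. U2 t \<omega> < 0)"
  then show "T_and U1 U2 \<omega> \<le> ereal T"
    \<comment> \<open>\<open>T\<close> itself belongs to the set whose infimum is taken, so even
      ruin at time 0 needs no special treatment here.\<close>
    using T unfolding T_and_def by (intro Inf_lower2[of "ereal T"]) auto
next
  assume le: "T_and U1 U2 \<omega> \<le> ereal T"
  \<comment> \<open>\<open>V\<close> stands for either line. If it stays nonnegative on
    \<open>[0, T]\<close>, stability delays its ruin, and with it the joint ruin, to
    \<open>T + d\<close> at the earliest.\<close>
  have "\<exists>t\<in>{0..T}. V t \<omega> < 0" if V: "right_stable (\<lambda>t. V t \<omega>)" and
    VU: "\<And>t. (\<exists>s\<in>{0..t}. U1 s \<omega> < 0) \<Longrightarrow> (\<exists>s\<in>{0..t}. U2 s \<omega> < 0) \<Longrightarrow> (\<exists>s\<in>{0..t}. V s \<omega> < 0)" for V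
  proof (rule ccontr)
    assume neg: "\<not> ?thesis"
    obtain d where d: "d > 0" "\<And>s. T \<le> s \<Longrightarrow> s < T + d \<Longrightarrow> V s \<omega> < 0 \<longleftrightarrow> V T \<omega> < 0"
      using right_stableD[OF V, of T] T by auto
    have "t \<ge> T + d" if t: "(\<exists>s\<in>{0..t}. V s \<omega> < 0)" for t
    proof (rule ccontr)
      assume lt: "\<not> t \<ge> T + d"
      obtain s where "s \<in> {0..t}" "V s \<omega> < 0" using t by blast
      then show False using neg d(2)[of s] T lt by (cases "s \<le> T") auto
    qed
    then have "ereal (T + d) \<le> T_and U1 U2 \<omega>"
      unfolding T_and_def by (intro Inf_greatest) (use VU in \<open>blast intro: ereal_less_eq(3)[THEN iffD2]\<close>)
    then have "ereal (T + d) \<le> ereal T" using le order_trans by blast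
    then show False using d by simp
  qed
  from this[of U1] this[of U2] U
  show "(\<exists>t\<in>{0..T}. U1 t \<omega> < 0) \<and> (\<exists>t\<in>{0..T}. U2 t \<omega> < 0)" by blast
qed

lemma (in cadlag_premium) disc_premium_eq_prem:
  assumes "\<And>t. Cp t \<omega> = c t"
  shows "disc_premium r Cp t \<omega> = prem t"
proof -
  have "ext_path Cp \<omega> = ext" by (auto simp: ext_path_def ext_def fun_eq_iff assms)
  then show ?thesis by (simp add: disc_premium_def prem_def)
qed

context
  fixes \<theta> :: "nat \<Rightarrow> 'a \<Rightarrow> real" and \<omega> :: 'a
  assumes \<theta>_pos: "\<And>i. i \<ge> 1 \<Longrightarrow> \<theta> i \<omega> > 0"
begin

lemma arrival_strict_mono: "strict_mono (\<lambda>n. arrival \<theta> n \<omega>)"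
  unfolding strict_mono_Suc_iff using \<theta>_pos by (simp add: arrival_Suc)

lemma arrival_less_iff: "arrival \<theta> i \<omega> < arrival \<theta> j \<omega> \<longleftrightarrow> i < j"
  using arrival_strict_mono by (rule strict_mono_less)

lemma arrival_le_iff: "arrival \<theta> i \<omega> \<le> arrival \<theta> j \<omega> \<longleftrightarrow> i \<le> j"
  using arrival_strict_mono by (rule strict_mono_less_eq)

lemma arrival_nonneg: "arrival \<theta> i \<omega> \<ge> 0"
  using arrival_le_iff[of 0 i] by simp

text \<open>The witness is the number of claims up to \<open>t\<close>; it exists unless all
  arrivals occur by time \<open>t\<close>.\<close>

lemma arrival_bracket:
  assumes "t \<ge> 0" "\<not> (\<forall>n. arrival \<theta> n \<omega> \<le> t)"
  obtains n where "arrival \<theta> n \<omega> \<le> t" "t < arrival \<theta> (Suc n) \<omega>"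
proof -
  define k where "k = (LEAST n. t < arrival \<theta> n \<omega>)"
  have k: "t < arrival \<theta> k \<omega>" unfolding k_def by (rule LeastI_ex) (use assms in \<open>auto simp: not_le\<close>)
  then obtain n where n: "k = Suc n" using assms(1) by (cases k) auto
  have "\<not> t < arrival \<theta> n \<omega>" using not_less_Least[of n "\<lambda>n. t < arrival \<theta> n \<omega>"] n k_def by auto
  then show ?thesis using that[of n] k n by simp
qed

lemma disc_claims_between:
  assumes "arrival \<theta> n \<omega> \<le> t" "t < arrival \<theta> (Suc n) \<omega>"
  shows "disc_claims r \<theta> Z t \<omega> = (\<Sum>i\<in>{1..n}. Z i \<omega> * exp (- r * arrival \<theta> i \<omega>))"
proof -
  have "1 \<le> i \<and> arrival \<theta> i \<omega> \<le> t \<longleftrightarrow> i \<in> {1..n}" for i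
  proof
    assume i: "1 \<le> i \<and> arrival \<theta> i \<omega> \<le> t"
    then have "arrival \<theta> i \<omega> < arrival \<theta> (Suc n) \<omega>" using assms by simp
    then show "i \<in> {1..n}" using i by (simp add: arrival_less_iff)
  next
    assume "i \<in> {1..n}"
    then show "1 \<le> i \<and> arrival \<theta> i \<omega> \<le> t" using arrival_le_iff[of i n] assms by auto
  qed
  then have "{i. 1 \<le> i \<and> arrival \<theta> i \<omega> \<le> t} = {1..n}" by blast
  then show ?thesis by (simp only: disc_claims_def)
qed

text \<open>On an exploding path the index set is infinite and the sum takes the junk value 0.\<close>

lemma disc_claims_explosion:
  assumes "\<forall>n. arrival \<theta> n \<omega> \<le> t"
  shows "disc_claims r \<theta> Z t \<omega> = 0"
proof -
  have "{i. 1 \<le> i \<and> arrival \<theta> i \<omega> \<le> t} = {1..}" using assms by auto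
  moreover have "infinite {1::nat..}" by (rule infinite_Ici)
  ultimately show ?thesis by (simp add: disc_claims_def)
qed

context
  fixes r u :: real and Cp :: "real \<Rightarrow> 'a \<Rightarrow> real" and Z :: "nat \<Rightarrow> 'a \<Rightarrow> real"
  assumes prem: "cadlag_premium (\<lambda>t. Cp t \<omega>) r" and u: "u > 0"
begin

interpretation cadlag_premium "\<lambda>t. Cp t \<omega>" r by (fact prem)

lemma right_stable_surplus: "right_stable (\<lambda>t. surplus r u Cp \<theta> Z t \<omega>)"
  unfolding right_stable_def
proof (intro allI impI)
  fix t :: real assume t: "t \<ge> 0"
  let ?U = "\<lambda>t. surplus r u Cp \<theta> Z t \<omega>"
  have U: "?U s = u + prem s - disc_claims r \<theta> Z s \<omega>" for s
    by (simp add: surplus_def disc_premium_eq_prem)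
  show "\<exists>\<delta>>0. \<forall>s. t \<le> s \<and> s < t + \<delta> \<longrightarrow> (?U s < 0 \<longleftrightarrow> ?U t < 0)"
  proof (cases "\<forall>n. arrival \<theta> n \<omega> \<le> t")
    case True
    \<comment> \<open>After an explosion the claim sum is 0 by convention, so the surplus is at
      least \<open>u\<close>.\<close>
    have "?U s > 0" if "t \<le> s" for s
    proof -
      have "\<forall>n. arrival \<theta> n \<omega> \<le> s" using True that order_trans by blast
      then show ?thesis using disc_claims_explosion[of s] prem_nonneg[of s] t u that by (simp add: U)
    qed
    then show ?thesis by (intro exI[of _ 1]) (metis less_asym order_refl zero_less_one)
  next
    case False
    then obtain n where n: "arrival \<theta> n \<omega> \<le> t" "t < arrival \<theta> (Suc n) \<omega>"
      using arrival_bracket t by blast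
    define d0 where "d0 = arrival \<theta> (Suc n) \<omega> - t"
    have D: "disc_claims r \<theta> Z s \<omega> = disc_claims r \<theta> Z t \<omega>" if "t \<le> s" "s < t + d0" for s
      using that n disc_claims_between[of n s] disc_claims_between[of n t] by (simp add: d0_def)
    show ?thesis
    proof (cases "?U t < 0")
      case True
      \<comment> \<open>The claim sum is frozen until the next arrival, so only the right-continuous
        premium moves.\<close>
      have "\<forall>\<^sub>F s in at_right t. prem s < disc_claims r \<theta> Z t \<omega> - u"
        using prem_rcont[OF t] by (rule order_tendstoD) (use True U in auto)
      then obtain b where b: "b > t" "\<And>s. t < s \<Longrightarrow> s < b \<Longrightarrow> prem s < disc_claims r \<theta> Z t \<omega> - u"
        unfolding eventually_at_right_field by auto
      have "?U s < 0" if "t \<le> s" "s < t + min d0 (b - t)" for s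
      proof (cases "s = t")
        case False
        moreover have "s < b" "s < t + d0" using that by auto
        ultimately show ?thesis using that b(2)[of s] D[of s] by (simp add: U)
      qed (use True in simp)
      moreover have "min d0 (b - t) > 0" using b(1) n by (simp add: d0_def)
      ultimately show ?thesis using True by blast
    next
      case False
      have "?U s \<ge> 0" if "t \<le> s" "s < t + d0" for s
        using that D[of s] prem_mono[of t s] False t by (simp add: U)
      moreover have "d0 > 0" using n by (simp add: d0_def)
      ultimately show ?thesis using False not_less by blast
    qed
  qed
qed

lemma surplus_0_pos: "surplus r u Cp \<theta> Z 0 \<omega> > 0"
proof -
  have "disc_claims r \<theta> Z 0 \<omega> = 0"
    using disc_claims_between[of 0 0] arrival_less_iff[of 0 1] by simp
  then show ?thesis using u by (simp add: surplus_def disc_premium_eq_prem prem_0)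
qed

text \<open>Premiums are nonnegative, so ruin at \<open>t\<close> forces the claims up to
  \<open>t\<close> above \<open>u\<close>; the nonnegative claims between \<open>t\<close> and
  \<open>T\<close> only increase the sum. This removes the unknown time of ruin and leaves a
  condition at \<open>T\<close> alone.\<close>

lemma surplus_neg_imp_claims_gt:
  assumes Z: "\<And>i. i \<ge> 1 \<Longrightarrow> Z i \<omega> \<ge> 0" and t: "0 \<le> t" "t \<le> T" "surplus r u Cp \<theta> Z t \<omega> < 0"
    and n: "arrival \<theta> n \<omega> \<le> T" "T < arrival \<theta> (Suc n) \<omega>"
  shows "(\<Sum>i\<in>{1..n}. Z i \<omega> * exp (- r * arrival \<theta> i \<omega>)) > u"
proof -
  have *: "disc_claims r \<theta> Z t \<omega> > u"
    using t prem_nonneg[of t] by (simp add: surplus_def disc_premium_eq_prem)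
  then have "\<not> (\<forall>n. arrival \<theta> n \<omega> \<le> t)" using disc_claims_explosion[of t r Z] u by auto
  then obtain k where k: "arrival \<theta> k \<omega> \<le> t" "t < arrival \<theta> (Suc k) \<omega>"
    using arrival_bracket t by blast
  then have "arrival \<theta> k \<omega> < arrival \<theta> (Suc n) \<omega>" using n t by simp
  then have "k \<le> n" by (simp add: arrival_less_iff)
  then have "(\<Sum>i\<in>{1..k}. Z i \<omega> * exp (- r * arrival \<theta> i \<omega>)) \<le> (\<Sum>i\<in>{1..n}. Z i \<omega> * exp (- r * arrival \<theta> i \<omega>))"
    by (intro sum_mono2) (auto intro!: mult_nonneg_nonneg Z)
  then show ?thesis using * disc_claims_between[OF k, of r Z] by simp
qed

lemma surplus_neg_of_claims_gt:
  assumes t: "0 \<le> t" "Cp t \<omega> \<le> L" and n: "arrival \<theta> n \<omega> \<le> t" "t < arrival \<theta> (Suc n) \<omega>"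
    and gt: "(\<Sum>i\<in>{1..n}. Z i \<omega> * exp (- r * arrival \<theta> i \<omega>)) > u + L"
  shows "surplus r u Cp \<theta> Z t \<omega> < 0"
  using prem_le[of t] t gt disc_claims_between[OF n, of r Z] by (simp add: surplus_def disc_premium_eq_prem)

end

end

section \<open>Independence\<close>

text \<open>Preimages under \<open>f\<close> and \<open>g\<close> stay inside \<open>N1\<close> and
  \<open>N2\<close>, so the product rule for two sub-sigma-algebras passes to all variables
  measurable with respect to them.\<close>

lemma (in prob_space) indep_var_of_subalgebras:
  assumes N1: "sets N1 \<subseteq> events" "space N1 = space M" and N2: "sets N2 \<subseteq> events" "space N2 = space M"
    and ind: "\<And>A B. A \<in> sets N1 \<Longrightarrow> B \<in> sets N2 \<Longrightarrow> prob (A \<inter> B) = prob A * prob B"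
    and f: "f \<in> measurable N1 S" and g: "g \<in> measurable N2 S'"
  shows "indep_var S f S' g"
proof -
  have sub1: "sigma_sets (space M) {f -` A \<inter> space M |A. A \<in> sets S} \<subseteq> sets N1"
    unfolding N1(2)[symmetric] using measurable_sets[OF f] by (intro sets.sigma_sets_subset) auto
  have sub2: "sigma_sets (space M) {g -` A \<inter> space M |A. A \<in> sets S'} \<subseteq> sets N2"
    unfolding N2(2)[symmetric] using measurable_sets[OF g] by (intro sets.sigma_sets_subset) auto
  have "random_variable S f"
    by (rule measurableI) (use measurable_space[OF f] measurable_sets[OF f] N1 in auto)
  moreover have "random_variable S' g"
    by (rule measurableI) (use measurable_space[OF g] measurable_sets[OF g] N2 in auto)
  ultimately show ?thesis
    unfolding indep_var_eq indep_sets2_eq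
    using sub1 sub2 N1(1) N2(1) ind by (intro conjI ballI) (assumption | blast)+
qed

text \<open>Freezing of \<open>g\<close>: independence makes the joint law a product measure, and
  Tonelli integrates out \<open>f\<close> while the value of \<open>g\<close> is held fixed.\<close>

lemma (in prob_space) indep_var_prob_expectation:
  assumes ind: "indep_var S f S' g" and A: "A \<in> sets (S \<Otimes>\<^sub>M S')"
  shows "(\<lambda>\<omega>. prob {\<omega>'\<in>space M. (f \<omega>', g \<omega>) \<in> A}) \<in> borel_measurable M"
    and "prob {\<omega>\<in>space M. (f \<omega>, g \<omega>) \<in> A} = expectation (\<lambda>\<omega>. prob {\<omega>'\<in>space M. (f \<omega>', g \<omega>) \<in> A})"
proof -
  have f [measurable]: "f \<in> measurable M S" and g [measurable]: "g \<in> measurable M S'"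
    using ind by (auto dest: indep_var_rv1 indep_var_rv2)
  interpret f: prob_space "distr M S f" by (rule prob_space_distr) fact
  interpret g: prob_space "distr M S' g" by (rule prob_space_distr) fact
  interpret fg: pair_prob_space "distr M S f" "distr M S' g" ..
  have A': "A \<in> sets (distr M S f \<Otimes>\<^sub>M distr M S' g)" using A by (simp cong: sets_pair_measure_cong)
  have sect: "emeasure (distr M S f) ((\<lambda>x. (x, g \<omega>)) -` A) = ennreal (prob {\<omega>'\<in>space M. (f \<omega>', g \<omega>) \<in> A})" for \<omega>
  proof -
    have "(\<lambda>x. (x, g \<omega>)) -` A \<in> sets S" using A by (rule sets_Pair2)
    then have "emeasure (distr M S f) ((\<lambda>x. (x, g \<omega>)) -` A) = emeasure M (f -` ((\<lambda>x. (x, g \<omega>)) -` A) \<inter> space M)"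
      by (rule emeasure_distr[OF f])
    also have "f -` ((\<lambda>x. (x, g \<omega>)) -` A) \<inter> space M = {\<omega>'\<in>space M. (f \<omega>', g \<omega>) \<in> A}" by auto
    finally show ?thesis by (simp add: emeasure_eq_measure)
  qed
  have m: "(\<lambda>y. emeasure (distr M S f) ((\<lambda>x. (x, y)) -` A)) \<in> borel_measurable S'"
    using fg.measurable_emeasure_Pair2[OF A'] by simp
  have "(\<lambda>\<omega>. emeasure (distr M S f) ((\<lambda>x. (x, g \<omega>)) -` A)) \<in> borel_measurable M"
    using measurable_compose[OF g m] .
  then have "(\<lambda>\<omega>. enn2real (ennreal (prob {\<omega>'\<in>space M. (f \<omega>', g \<omega>) \<in> A}))) \<in> borel_measurable M"
    unfolding sect by measurable
  then show bm: "(\<lambda>\<omega>. prob {\<omega>'\<in>space M. (f \<omega>', g \<omega>) \<in> A}) \<in> borel_measurable M" by simp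
  have "emeasure M {\<omega>\<in>space M. (f \<omega>, g \<omega>) \<in> A} = emeasure (distr M (S \<Otimes>\<^sub>M S') (\<lambda>\<omega>. (f \<omega>, g \<omega>))) A"
    using A by (subst emeasure_distr) (auto intro!: arg_cong[where f="emeasure M"])
  also have "\<dots> = emeasure (distr M S f \<Otimes>\<^sub>M distr M S' g) A"
    using ind by (simp add: indep_var_distribution_eq)
  also have "\<dots> = (\<integral>\<^sup>+y. emeasure (distr M S f) ((\<lambda>x. (x, y)) -` A) \<partial>distr M S' g)"
    by (rule fg.emeasure_pair_measure_alt2[OF A'])
  also have "\<dots> = (\<integral>\<^sup>+\<omega>. ennreal (prob {\<omega>'\<in>space M. (f \<omega>', g \<omega>) \<in> A}) \<partial>M)"
    by (subst nn_integral_distr[OF g]) (simp_all add: m sect)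
  also have "\<dots> = ennreal (expectation (\<lambda>\<omega>. prob {\<omega>'\<in>space M. (f \<omega>', g \<omega>) \<in> A}))"
    by (intro nn_integral_eq_integral integrable_const_bound[where B=1] bm) auto
  finally show "prob {\<omega>\<in>space M. (f \<omega>, g \<omega>) \<in> A} = expectation (\<lambda>\<omega>. prob {\<omega>'\<in>space M. (f \<omega>', g \<omega>) \<in> A})"
    by (simp add: emeasure_eq_measure)
qed

lemma (in prob_space) indep_vars_sum_disjoint:
  fixes Z :: "'i \<Rightarrow> 'a \<Rightarrow> real"
  assumes "indep_vars (\<lambda>_. borel) Z I" "A \<inter> B = {}" "A \<subseteq> I" "B \<subseteq> I"
  shows "indep_var borel (\<lambda>\<omega>. \<Sum>i\<in>A. Z i \<omega>) borel (\<lambda>\<omega>. \<Sum>i\<in>B. Z i \<omega>)"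
proof -
  have "indep_var borel ((\<lambda>f. \<Sum>i\<in>A. f i) \<circ> (\<lambda>\<omega>. restrict (\<lambda>i. Z i \<omega>) A))
    borel ((\<lambda>f. \<Sum>i\<in>B. f i) \<circ> (\<lambda>\<omega>. restrict (\<lambda>i. Z i \<omega>) B))"
    by (intro indep_var_compose[OF indep_var_restrict[OF assms]]) auto
  then show ?thesis by (simp add: comp_def)
qed

text \<open>Splitting one index off each set leaves equally many summands on both sides; by
  independence both laws are the convolution of \<open>D\<close> with the law of the remaining
  sum.\<close>

lemma (in prob_space) distr_sum_iid_cong:
  fixes Z :: "nat \<Rightarrow> 'a \<Rightarrow> real"
  assumes ind: "indep_vars (\<lambda>_. borel) Z I"
    and idn: "\<And>i. i \<in> I \<Longrightarrow> distr M borel (Z i) = D"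
    and "finite A" "A \<subseteq> I" "B \<subseteq> I" "card A = card B"
  shows "distr M borel (\<lambda>\<omega>. \<Sum>i\<in>A. Z i \<omega>) = distr M borel (\<lambda>\<omega>. \<Sum>i\<in>B. Z i \<omega>)"
  using assms(3-)
proof (induction A arbitrary: B rule: finite_induct)
  case empty
  show ?case
  \<comment> \<open>Cardinality 0 also allows an infinite \<open>B\<close>; its sum is 0 by
    convention.\<close>
  proof (cases "finite B")
    case True then show ?thesis using empty by simp
  qed simp
next
  case (insert a A B)
  have rv: "Z i \<in> borel_measurable M" if "i \<in> I" for i using ind that by (auto simp: indep_vars_def)
  have "finite B" "B \<noteq> {}" using insert by (auto intro: card_ge_0_finite)
  then obtain b where b: "b \<in> B" by auto
  have B: "B = Set.insert b (B - {b})" "card A = card (B - {b})" using b insert \<open>finite B\<close> by auto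
  have IH: "distr M borel (\<lambda>\<omega>. \<Sum>i\<in>A. Z i \<omega>) = distr M borel (\<lambda>\<omega>. \<Sum>i\<in>B - {b}. Z i \<omega>)"
    using insert B by (intro insert.IH) auto
  have conv: "distr M borel (\<lambda>\<omega>. \<Sum>i\<in>Set.insert c E. Z i \<omega>) = convolution D (distr M borel (\<lambda>\<omega>. \<Sum>i\<in>E. Z i \<omega>))"
    if "finite E" "c \<notin> E" "Set.insert c E \<subseteq> I" for c E
  proof -
    have "indep_var borel (Z c) borel (\<lambda>\<omega>. \<Sum>i\<in>E. Z i \<omega>)"
      using that by (intro indep_vars_sum indep_vars_subset[OF ind]) auto
    moreover have "(\<lambda>\<omega>. \<Sum>i\<in>E. Z i \<omega>) \<in> borel_measurable M" using that rv by (intro borel_measurable_sum) auto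
    moreover have "Z c \<in> borel_measurable M" using that rv by auto
    ultimately have "distr M borel (\<lambda>\<omega>. Z c \<omega> + (\<Sum>i\<in>E. Z i \<omega>)) = convolution (distr M borel (Z c)) (distr M borel (\<lambda>\<omega>. \<Sum>i\<in>E. Z i \<omega>))"
      by (intro sum_indep_random_variable)
    then show ?thesis using that idn[of c] by (simp add: sum.insert)
  qed
  have "distr M borel (\<lambda>\<omega>. \<Sum>i\<in>Set.insert a A. Z i \<omega>) = convolution D (distr M borel (\<lambda>\<omega>. \<Sum>i\<in>A. Z i \<omega>))"
    using insert by (intro conv) auto
  also have "\<dots> = distr M borel (\<lambda>\<omega>. \<Sum>i\<in>Set.insert b (B - {b}). Z i \<omega>)"
    unfolding IH using insert b \<open>finite B\<close> by (intro conv[symmetric]) auto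
  finally show ?case using B(1) by simp
qed

lemma measurable_subalgebra_events_of:
  "i \<in> I \<Longrightarrow> E \<supseteq> events_of M Z I \<Longrightarrow> E \<subseteq> Pow (space M) \<Longrightarrow> Z i \<in> borel_measurable (sigma (space M) E)"
  by (intro measurableI) (auto simp: events_of_def space_measure_of_conv sets_measure_of intro!: sigma_sets.Basic)

section \<open>The renewal risk model\<close>

locale renewal_risk = prob_space M
  for M :: "'a measure" +
  fixes X Y \<theta> :: "nat \<Rightarrow> 'a \<Rightarrow> real"
    and C1 C2 :: "real \<Rightarrow> 'a \<Rightarrow> real"
    and F G :: "real \<Rightarrow> real"
    and r C T :: real
  assumes r_nonneg: "r \<ge> 0"
    and theta_rv: "\<And>i. \<theta> i \<in> borel_measurable M"
    and theta_pos: "\<And>i \<omega>. i \<ge> 1 \<Longrightarrow> \<omega> \<in> space M \<Longrightarrow> \<theta> i \<omega> > 0"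
    and theta_indep: "indep_vars (\<lambda>_. borel) \<theta> {1..}"
    and theta_ident: "\<And>i. i \<ge> 1 \<Longrightarrow> distr M borel (\<theta> i) = distr M borel (\<theta> 1)"
    and X_rv: "\<And>i. X i \<in> borel_measurable M"
    and Y_rv: "\<And>i. Y i \<in> borel_measurable M"
    and XY_ident: "\<And>i. i \<ge> 1 \<Longrightarrow>
        distr M (borel \<Otimes>\<^sub>M borel) (\<lambda>\<omega>. (X i \<omega>, Y i \<omega>)) =
        distr M (borel \<Otimes>\<^sub>M borel) (\<lambda>\<omega>. (X 1 \<omega>, Y 1 \<omega>))"
    and X_nonneg: "\<And>i \<omega>. i \<ge> 1 \<Longrightarrow> \<omega> \<in> space M \<Longrightarrow> X i \<omega> \<ge> 0"
    and Y_nonneg: "\<And>i \<omega>. i \<ge> 1 \<Longrightarrow> \<omega> \<in> space M \<Longrightarrow> Y i \<omega> \<ge> 0"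
    and F_dist: "\<And>i x. i \<ge> 1 \<Longrightarrow> F x = prob {\<omega>\<in>space M. X i \<omega> \<le> x}"
    and G_dist: "\<And>i y. i \<ge> 1 \<Longrightarrow> G y = prob {\<omega>\<in>space M. Y i \<omega> \<le> y}"
    and F_endpoint: "\<And>x. F x < 1"
    and G_endpoint: "\<And>y. G y < 1"
    and F_class: "classD F" "classL F"
    and G_class: "classD G" "classL G"
    and C_pos: "C > 0"
    and SAI: "(\<lambda>(u, v). prob {\<omega>\<in>space M. X 1 \<omega> > u \<and> Y 1 \<omega> > v})
          \<sim>[at_top \<times>\<^sub>F at_top] (\<lambda>(u, v). C * tailf F u * tailf G v)"
    and XY_indep: "\<And>i j. i \<ge> 1 \<Longrightarrow> j \<ge> 1 \<Longrightarrow> i \<noteq> j \<Longrightarrow> indep_var borel (X i) borel (Y j)"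
    and gtai: "\<And>n. n \<ge> 1 \<Longrightarrow> GTAI M X n Y n"
    and C1_rv: "\<And>t. C1 t \<in> borel_measurable M"
    and C2_rv: "\<And>t. C2 t \<in> borel_measurable M"
    and C1_0: "\<And>\<omega>. \<omega> \<in> space M \<Longrightarrow> C1 0 \<omega> = 0"
    and C2_0: "\<And>\<omega>. \<omega> \<in> space M \<Longrightarrow> C2 0 \<omega> = 0"
    and C1_mono: "\<And>\<omega>. \<omega> \<in> space M \<Longrightarrow> mono_on {0..} (\<lambda>t. C1 t \<omega>)"
    and C2_mono: "\<And>\<omega>. \<omega> \<in> space M \<Longrightarrow> mono_on {0..} (\<lambda>t. C2 t \<omega>)"
    and C1_rcont: "\<And>\<omega> t. \<omega> \<in> space M \<Longrightarrow> t \<ge> 0 \<Longrightarrow> continuous (at_right t) (\<lambda>s. C1 s \<omega>)"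
    and C2_rcont: "\<And>\<omega> t. \<omega> \<in> space M \<Longrightarrow> t \<ge> 0 \<Longrightarrow> continuous (at_right t) (\<lambda>s. C2 s \<omega>)"
    and mutual_indep: "indep_sets
        (\<lambda>k::nat. if k = 0 then sigma_sets (space M) (events_of M X {1..} \<union> events_of M Y {1..})
                  else if k = 1 then sigma_sets (space M) (events_of M C1 {0..} \<union> events_of M C2 {0..})
                  else sigma_sets (space M) (events_of M \<theta> {1..}))
        {0, 1, 2}"
    and T_pos: "T > 0"
    and lam_pos: "renewal_fn M \<theta> T > 0"
begin

declare theta_rv [measurable] X_rv [measurable] Y_rv [measurable] C1_rv [measurable] C2_rv [measurable]

abbreviation "Fb \<equiv> tailf F"
abbreviation "Gb \<equiv> tailf G"
abbreviation "\<tau> \<equiv> arrival \<theta>"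

section \<open>Marginal and joint tails of the claims\<close>

lemma Fb_eq: "i \<ge> 1 \<Longrightarrow> Fb u = prob {\<omega>\<in>space M. X i \<omega> > u}"
proof -
  assume i: "i \<ge> 1"
  have "{\<omega>\<in>space M. X i \<omega> > u} = space M - {\<omega>\<in>space M. X i \<omega> \<le> u}" by auto
  then show ?thesis using i by (simp add: tailf_def F_dist[OF i] prob_compl)
qed

lemma Gb_eq: "i \<ge> 1 \<Longrightarrow> Gb u = prob {\<omega>\<in>space M. Y i \<omega> > u}"
proof -
  assume i: "i \<ge> 1"
  have "{\<omega>\<in>space M. Y i \<omega> > u} = space M - {\<omega>\<in>space M. Y i \<omega> \<le> u}" by auto
  then show ?thesis using i by (simp add: tailf_def G_dist[OF i] prob_compl)
qed

lemma Fb_pos: "Fb x > 0" and Gb_pos: "Gb x > 0"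
  using F_endpoint G_endpoint by (simp_all add: tailf_def)

lemma Fb_le1: "Fb x \<le> 1" and Gb_le1: "Gb x \<le> 1"
  by (simp_all add: Fb_eq[of 1] Gb_eq[of 1])

lemma Fb_antimono: "antimono Fb" and Gb_antimono: "antimono Gb"
  by (auto simp: antimono_def Fb_eq[of 1] Gb_eq[of 1] intro!: finite_measure_mono)

lemma Fb_anti: "x \<le> y \<Longrightarrow> Fb y \<le> Fb x" and Gb_anti: "x \<le> y \<Longrightarrow> Gb y \<le> Gb x"
  using Fb_antimono Gb_antimono by (auto simp: antimono_def)

lemma Fb_measurable [measurable]: "Fb \<in> borel_measurable borel"
proof -
  have "(\<lambda>x. - Fb x) \<in> borel_measurable borel"
    by (rule borel_measurable_mono) (auto simp: mono_def Fb_anti)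
  then have "(\<lambda>x. - (- Fb x)) \<in> borel_measurable borel" by (rule borel_measurable_uminus)
  then show ?thesis by simp
qed

lemma Gb_measurable [measurable]: "Gb \<in> borel_measurable borel"
proof -
  have "(\<lambda>x. - Gb x) \<in> borel_measurable borel"
    by (rule borel_measurable_mono) (auto simp: mono_def Gb_anti)
  then have "(\<lambda>x. - (- Gb x)) \<in> borel_measurable borel" by (rule borel_measurable_uminus)
  then show ?thesis by simp
qed

lemma arrival_measurable [measurable]: "\<tau> i \<in> borel_measurable M"
  unfolding arrival_def[abs_def] by measurable

definition "tail_XY i j u v = prob {\<omega>\<in>space M. X i \<omega> > u \<and> Y j \<omega> > v}"

text \<open>The factor by which the joint tail of \<open>X i\<close> and \<open>Y j\<close> differs
  asymptotically from the product of the marginal tails: \<open>C\<close> by SAI within a pair, 1 by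
  independence across pairs.\<close>

definition coef :: "nat \<Rightarrow> nat \<Rightarrow> real" where "coef i j = (if i = j then C else 1)"

lemma coef_pos: "coef i j > 0" using C_pos by (simp add: coef_def)

lemma tail_XY_offdiag:
  assumes "i \<ge> 1" "j \<ge> 1" "i \<noteq> j"
  shows "tail_XY i j u v = Fb u * Gb v"
proof -
  have "indep_var borel (X i) borel (Y j)" using assms by (rule XY_indep)
  from indep_varD[OF this, of "{u<..}" "{v<..}"]
  have "prob ((\<lambda>x. (X i x, Y j x)) -` ({u<..} \<times> {v<..}) \<inter> space M) =
    prob (X i -` {u<..} \<inter> space M) * prob (Y j -` {v<..} \<inter> space M)" by simp
  moreover have "(\<lambda>x. (X i x, Y j x)) -` ({u<..} \<times> {v<..}) \<inter> space M = {\<omega>\<in>space M. X i \<omega> > u \<and> Y j \<omega> > v}"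
    "X i -` {u<..} \<inter> space M = {\<omega>\<in>space M. X i \<omega> > u}" "Y j -` {v<..} \<inter> space M = {\<omega>\<in>space M. Y j \<omega> > v}" by auto
  ultimately show ?thesis using assms by (simp add: tail_XY_def Fb_eq[of i] Gb_eq[of j])
qed

lemma tail_XY_diag:
  assumes "i \<ge> 1"
  shows "tail_XY i i u v = tail_XY 1 1 u v"
proof -
  have *: "tail_XY k k u v = measure (distr M (borel \<Otimes>\<^sub>M borel) (\<lambda>\<omega>. (X k \<omega>, Y k \<omega>))) ({u<..} \<times> {v<..})" for k
    unfolding tail_XY_def by (subst measure_distr) (auto intro!: arg_cong[where f=prob])
  show ?thesis unfolding * XY_ident[OF assms] ..
qed

text \<open>One threshold \<open>N\<close> serves all index pairs, because off the diagonal the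
  relation is exact and on the diagonal every pair has the law of the first. This uniformity allows
  random levels to be inserted later.\<close>

lemma tail_XY_approx:
  assumes e: "\<epsilon> > 0"
  shows "\<exists>N. \<forall>u\<ge>N. \<forall>v\<ge>N. \<forall>i\<ge>1. \<forall>j\<ge>1.
    \<bar>tail_XY i j u v - coef i j * (Fb u * Gb v)\<bar> \<le> \<epsilon> * (coef i j * (Fb u * Gb v))"
proof -
  have "\<forall>\<epsilon>>0. \<exists>N. \<forall>x\<ge>N. \<forall>y\<ge>N. \<bar>(\<lambda>(u, v). tail_XY 1 1 u v) (x, y) - (\<lambda>(u, v). C * Fb u * Gb v) (x, y)\<bar>
      \<le> \<epsilon> * (\<lambda>(u, v). C * Fb u * Gb v) (x, y)"
    using SAI unfolding tail_XY_def
    by (subst (asm) asymp_equiv_prod_at_top_iff)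
      (auto intro!: always_eventually mult_pos_pos C_pos Fb_pos Gb_pos)
  from this[rule_format, OF e]
  have "\<exists>N. \<forall>x\<ge>N. \<forall>y\<ge>N. \<bar>tail_XY 1 1 x y - C * Fb x * Gb y\<bar> \<le> \<epsilon> * (C * Fb x * Gb y)"
    unfolding case_prod_conv .
  then obtain N where N: "\<And>x y. x \<ge> N \<Longrightarrow> y \<ge> N \<Longrightarrow> \<bar>tail_XY 1 1 x y - C * Fb x * Gb y\<bar> \<le> \<epsilon> * (C * Fb x * Gb y)"
    by blast
  show ?thesis
  proof (intro exI[of _ N] allI impI)
    fix u v :: real and i j :: nat assume uv: "u \<ge> N" "v \<ge> N" and ij: "i \<ge> 1" "j \<ge> 1"
    show "\<bar>tail_XY i j u v - coef i j * (Fb u * Gb v)\<bar> \<le> \<epsilon> * (coef i j * (Fb u * Gb v))"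
    proof (cases "i = j")
      case True
      then show ?thesis using N[OF uv] tail_XY_diag[OF ij(1), of u v] by (simp add: coef_def mult.assoc)
    next
      case False
      then show ?thesis using tail_XY_offdiag[OF ij False] e Fb_pos[of u] Gb_pos[of v] by (simp add: coef_def)
    qed
  qed
qed

text \<open>In contrast to the asymptotic relation this holds at all levels. It is needed at levels
  such as \<open>x / n\<close>, which may be small even when \<open>x\<close> is large. Where one
  level is below \<open>N\<close> and SAI is silent, the joint tail is at most the other marginal
  tail, and the tail at the low level is at least its value at \<open>N\<close>.\<close>

lemma tail_XY_bound:
  "\<exists>K>0. \<forall>i\<ge>1. \<forall>j\<ge>1. \<forall>u v. tail_XY i j u v \<le> K * (Fb u * Gb v)"
proof -
  obtain N where N: "\<And>u v i j. u \<ge> N \<Longrightarrow> v \<ge> N \<Longrightarrow> i \<ge> 1 \<Longrightarrow> j \<ge> 1 \<Longrightarrow>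
    \<bar>tail_XY i j u v - coef i j * (Fb u * Gb v)\<bar> \<le> 1 * (coef i j * (Fb u * Gb v))"
    using tail_XY_approx[OF zero_less_one] by blast
  define K where "K = max (2 * C + 2) (max (1 / Fb N) (1 / Gb N))"
  have "tail_XY i j u v \<le> K * (Fb u * Gb v)" if ij: "i \<ge> 1" "j \<ge> 1" for i j u v
  proof -
    have FG: "0 \<le> Fb u * Gb v" using Fb_pos[of u] Gb_pos[of v] by simp
    consider "u \<ge> N" "v \<ge> N" | "u < N" | "v < N" by linarith
    then have "\<exists>K'\<le>K. tail_XY i j u v \<le> K' * (Fb u * Gb v)"
    proof cases
      case 1
      have "tail_XY i j u v \<le> 2 * coef i j * (Fb u * Gb v)"
        using N[OF 1 ij] unfolding mult.assoc by linarith
      then show ?thesis using C_pos by (intro exI[of _ "2 * coef i j"]) (auto simp: K_def coef_def)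
    next
      case 2
      have "tail_XY i j u v \<le> Gb v"
        unfolding tail_XY_def Gb_eq[OF ij(2)] by (intro finite_measure_mono) auto
      also have "\<dots> \<le> (1 / Fb N) * (Fb u * Gb v)"
        using Fb_anti[of u N] 2 Fb_pos[of N] Gb_pos[of v] by (simp add: field_simps)
      finally show ?thesis by (intro exI[of _ "1 / Fb N"]) (auto simp: K_def)
    next
      case 3
      have "tail_XY i j u v \<le> Fb u"
        unfolding tail_XY_def Fb_eq[OF ij(1)] by (intro finite_measure_mono) auto
      also have "\<dots> \<le> (1 / Gb N) * (Fb u * Gb v)"
        using Gb_anti[of v N] 3 Gb_pos[of N] Fb_pos[of u] by (simp add: field_simps)
      finally show ?thesis by (intro exI[of _ "1 / Gb N"]) (auto simp: K_def)
    qed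
    then obtain K' where "K' \<le> K" "tail_XY i j u v \<le> K' * (Fb u * Gb v)" by blast
    then show ?thesis using mult_right_mono[OF _ FG, of K' K] by linarith
  qed
  moreover have "K > 0" using C_pos by (simp add: K_def)
  ultimately show ?thesis by blast
qed

lemma tail_XY_dilation_bound:
  "\<exists>K>0. \<exists>q. \<forall>i\<ge>1. \<forall>j\<ge>1. \<forall>n\<ge>1. \<forall>x\<ge>0. \<forall>y\<ge>0.
     tail_XY i j (x / real n) (y / real n) \<le> K * real n ^ q * (Fb x * Gb y)"
proof -
  obtain K0 where K0: "K0 > 0" "\<And>i j u v. i \<ge> 1 \<Longrightarrow> j \<ge> 1 \<Longrightarrow> tail_XY i j u v \<le> K0 * (Fb u * Gb v)"
    using tail_XY_bound by blast
  obtain K1 q1 where K1: "K1 > 0" "\<And>n x. n \<ge> 1 \<Longrightarrow> x \<ge> 0 \<Longrightarrow> Fb (x / real n) \<le> K1 * real n ^ q1 * Fb x"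
    using classD_dilation_le[OF F_class(1) Fb_pos Fb_le1 Fb_antimono] by blast
  obtain K2 q2 where K2: "K2 > 0" "\<And>n x. n \<ge> 1 \<Longrightarrow> x \<ge> 0 \<Longrightarrow> Gb (x / real n) \<le> K2 * real n ^ q2 * Gb x"
    using classD_dilation_le[OF G_class(1) Gb_pos Gb_le1 Gb_antimono] by blast
  show ?thesis
  proof (intro exI[of _ "K0 * (K1 * K2)"] exI[of _ "q1 + q2"] conjI allI impI)
    show "K0 * (K1 * K2) > 0" using K0 K1 K2 by simp
    fix i j n :: nat and x y :: real assume *: "i \<ge> 1" "j \<ge> 1" "n \<ge> 1" "x \<ge> 0" "y \<ge> 0"
    have "tail_XY i j (x / real n) (y / real n) \<le> K0 * (Fb (x / real n) * Gb (y / real n))"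
      using * by (intro K0)
    also have "\<dots> \<le> K0 * ((K1 * real n ^ q1 * Fb x) * (K2 * real n ^ q2 * Gb y))"
      using K0(1) K1 K2 Fb_pos Gb_pos * by (intro mult_left_mono mult_mono) (auto intro: less_imp_le)
    also have "\<dots> = K0 * (K1 * K2) * real n ^ (q1 + q2) * (Fb x * Gb y)" by (simp add: power_add algebra_simps)
    finally show "tail_XY i j (x / real n) (y / real n) \<le> K0 * (K1 * K2) * real n ^ (q1 + q2) * (Fb x * Gb y)" .
  qed
qed


text \<open>Exponential Markov inequality: \<open>\<tau> n \<omega> \<le> T\<close> means
  \<open>1 \<le> exp (T - \<tau> n \<omega>)\<close>, and the expectation of
  \<open>exp (- \<tau> n \<omega>)\<close> factors into \<open>n\<close> equal Laplace transforms.
  They are below 1 because the waiting times are strictly positive.\<close>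

lemma arrival_geometric:
  "\<exists>\<rho>. 0 < \<rho> \<and> \<rho> < 1 \<and> (\<forall>n. prob {\<omega>\<in>space M. \<tau> n \<omega> \<le> T} \<le> exp T * \<rho> ^ n)"
proof -
  have integrable_exp: "integrable M (\<lambda>\<omega>. exp (- \<theta> i \<omega>))" if "i \<ge> 1" for i
    using theta_pos[OF that] by (intro integrable_const_bound[where B=1] AE_I2) (auto intro: less_imp_le)
  define \<rho> where "\<rho> = expectation (\<lambda>\<omega>. exp (- \<theta> 1 \<omega>))"
  have same: "expectation (\<lambda>\<omega>. exp (- \<theta> i \<omega>)) = \<rho>" if "i \<ge> 1" for i
  proof -
    have "expectation (\<lambda>\<omega>. exp (- \<theta> i \<omega>)) = (\<integral>x. exp (- x) \<partial>distr M borel (\<theta> i))"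
      by (subst integral_distr) auto
    also have "\<dots> = \<rho>" unfolding theta_ident[OF that] \<rho>_def by (subst integral_distr) auto
    finally show ?thesis .
  qed
  have "expectation (\<lambda>\<omega>. exp (- \<theta> 1 \<omega>)) < expectation (\<lambda>\<omega>. 1)"
    using theta_pos[of 1] by (intro integral_less_AE_space integrable_exp AE_I2) (auto simp: emeasure_space_1)
  then have "\<rho> < 1" by (simp add: \<rho>_def prob_space)
  have "expectation (\<lambda>\<omega>. 0) < expectation (\<lambda>\<omega>. exp (- \<theta> 1 \<omega>))"
    by (intro integral_less_AE_space integrable_exp AE_I2) (auto simp: emeasure_space_1)
  then have "0 < \<rho>" by (simp add: \<rho>_def)
  have "prob {\<omega>\<in>space M. \<tau> n \<omega> \<le> T} \<le> exp T * \<rho> ^ n" for n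
  proof -
    have ind: "indep_vars (\<lambda>_. borel) (\<lambda>i \<omega>. exp (- \<theta> i \<omega>)) {1..n}"
      by (rule indep_vars_compose2[OF indep_vars_subset[OF theta_indep]]) auto
    have prod: "(\<Prod>i\<in>{1..n}. exp (- \<theta> i \<omega>)) = exp (- \<tau> n \<omega>)" for \<omega>
      by (simp add: arrival_def exp_sum[symmetric] sum_negf)
    have int: "integrable M (\<lambda>\<omega>. exp (- \<tau> n \<omega>))"
      using indep_vars_integrable[OF finite_atLeastAtMost ind] integrable_exp unfolding prod by simp
    have E: "expectation (\<lambda>\<omega>. exp (- \<tau> n \<omega>)) = \<rho> ^ n"
      using indep_vars_lebesgue_integral[OF finite_atLeastAtMost ind] integrable_exp same unfolding prod by simp
    have "prob {\<omega>\<in>space M. \<tau> n \<omega> \<le> T} = expectation (indicat_real {\<omega>\<in>space M. \<tau> n \<omega> \<le> T})" by simp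
    also have "\<dots> \<le> expectation (\<lambda>\<omega>. exp T * exp (- \<tau> n \<omega>))"
    proof (intro integral_mono)
      fix \<omega>
      have "exp T * exp (- \<tau> n \<omega>) = exp (T - \<tau> n \<omega>)" by (simp add: exp_diff exp_minus divide_inverse)
      moreover have "indicat_real {\<omega>\<in>space M. \<tau> n \<omega> \<le> T} \<omega> \<le> exp (T - \<tau> n \<omega>)"
        by (cases "\<tau> n \<omega> \<le> T") (auto simp: indicator_def)
      ultimately show "indicat_real {\<omega>\<in>space M. \<tau> n \<omega> \<le> T} \<omega> \<le> exp T * exp (- \<tau> n \<omega>)" by simp
    qed (use int in \<open>auto intro!: integrable_real_indicator simp: emeasure_eq_measure\<close>)
    finally show ?thesis by (simp add: E)
  qed
  then show ?thesis using \<open>\<rho> < 1\<close> \<open>0 < \<rho>\<close> by blast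
qed

end

section \<open>Limits in three variables\<close>

lemma eventually_prod3_at_topD:
  fixes P :: "real \<times> real \<times> real \<Rightarrow> bool"
  assumes "eventually P (at_top \<times>\<^sub>F at_top \<times>\<^sub>F at_top)"
  shows "\<exists>N. \<forall>x\<ge>N. \<forall>y\<ge>N. \<forall>z\<ge>N. P (x, y, z)"
proof -
  obtain Q R where Q: "eventually Q at_top" and R: "eventually R (at_top \<times>\<^sub>F at_top)"
    and P: "\<And>x p. Q x \<Longrightarrow> R p \<Longrightarrow> P (x, p)"
    using assms unfolding eventually_prod_filter[of P] by blast
  obtain a where a: "\<And>x. x \<ge> a \<Longrightarrow> Q x" using Q by (auto simp: eventually_at_top_linorder)
  obtain b where b: "\<And>x y. x \<ge> b \<Longrightarrow> y \<ge> b \<Longrightarrow> R (x, y)"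
    using R unfolding eventually_prod_at_top_iff by blast
  show ?thesis
    by (intro exI[of _ "max a b"] allI impI P a b) auto
qed

lemma (in prob_space) cond_prob_tendsto_0_uniform:
  assumes J: "finite J"
    and lim: "\<And>p. p \<in> J \<Longrightarrow> ((\<lambda>(a, x, y). cond_prob M (A p a) (B p x y)) \<longlongrightarrow> 0)
      (at_top \<times>\<^sub>F at_top \<times>\<^sub>F at_top)"
    and B: "\<And>p x y. B p x y \<in> events" and e: "\<epsilon> > 0"
  shows "\<exists>N::real. \<forall>a\<ge>N. \<forall>x\<ge>N. \<forall>y\<ge>N. \<forall>p\<in>J. prob (A p a \<inter> B p x y) \<le> \<epsilon> * prob (B p x y)"
proof -
  have "eventually (\<lambda>q. \<forall>p\<in>J. (case q of (a, x, y) \<Rightarrow> cond_prob M (A p a) (B p x y)) < \<epsilon>)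
    (at_top \<times>\<^sub>F at_top \<times>\<^sub>F at_top)"
    using order_tendstoD(2)[OF lim e] by (intro eventually_ball_finite[OF J] ballI)
  from eventually_prod3_at_topD[OF this]
  obtain N where N: "\<forall>a\<ge>N. \<forall>x\<ge>N. \<forall>y\<ge>N. \<forall>p\<in>J. cond_prob M (A p a) (B p x y) < \<epsilon>"
    unfolding case_prod_conv by blast
  show ?thesis
  proof (intro exI[of _ N] allI impI ballI)
    fix a x y p assume *: "a \<ge> N" "x \<ge> N" "y \<ge> N" "p \<in> J"
    have le: "prob (A p a \<inter> B p x y) \<le> prob (B p x y)" using B by (intro finite_measure_mono) auto
    show "prob (A p a \<inter> B p x y) \<le> \<epsilon> * prob (B p x y)"
    \<comment> \<open>If the conditioning event is null, \<open>cond_prob\<close> is a division by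
      zero and carries no information, but then both sides of the inequality are 0.\<close>
    proof (cases "prob (B p x y) = 0")
      case True
      then show ?thesis using le by simp
    next
      case False
      then have "prob (B p x y) > 0" by (simp add: zero_less_measure_iff)
      then show ?thesis using N[rule_format, OF *] by (simp add: cond_prob_def divide_less_eq)
    qed
  qed
qed

context renewal_risk
begin

section \<open>Independence of claims, arrivals and premiums\<close>

definition "claim_alg = sigma (space M) (events_of M X {1..} \<union> events_of M Y {1..})"
definition "arrival_alg = sigma (space M) (events_of M \<theta> {1..})"
definition "prem_alg = sigma (space M) (events_of M C1 {0..} \<union> events_of M C2 {0..})"
definition "model_alg = sigma (space M) (sets claim_alg \<union> sets arrival_alg)"

lemma events_of_Pow: "events_of M Z I \<subseteq> Pow (space M)"
  by (auto simp: events_of_def)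

lemma space_algs [simp]:
  "space claim_alg = space M" "space arrival_alg = space M" "space prem_alg = space M" "space model_alg = space M"
  by (simp_all add: claim_alg_def arrival_alg_def prem_alg_def model_alg_def space_measure_of_conv)

lemma sets_algs:
  "sets claim_alg = sigma_sets (space M) (events_of M X {1..} \<union> events_of M Y {1..})"
  "sets arrival_alg = sigma_sets (space M) (events_of M \<theta> {1..})"
  "sets prem_alg = sigma_sets (space M) (events_of M C1 {0..} \<union> events_of M C2 {0..})"
  unfolding claim_alg_def arrival_alg_def prem_alg_def
  by (simp_all add: sets_measure_of events_of_Pow)

lemma sets_model_alg: "sets model_alg = sigma_sets (space M) (sets claim_alg \<union> sets arrival_alg)"
  unfolding model_alg_def using sets.space_closed[of claim_alg] sets.space_closed[of arrival_alg]
  by (intro sets_measure_of) auto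

lemma mutual_indep_algs:
  "indep_sets (\<lambda>k::nat. if k = 0 then sets claim_alg else if k = 1 then sets prem_alg else sets arrival_alg) {0, 1, 2}"
  using mutual_indep unfolding sets_algs .

lemma algs_events: "sets claim_alg \<subseteq> events" "sets arrival_alg \<subseteq> events" "sets prem_alg \<subseteq> events"
  using mutual_indep_algs by (auto simp: indep_sets_def)

lemma indep_claim_arrival:
  assumes "A \<in> sets claim_alg" "B \<in> sets arrival_alg"
  shows "prob (A \<inter> B) = prob A * prob B"
  using indep_setsD[OF mutual_indep_algs, of "{0, 2}" "\<lambda>k. if k = 0 then A else B"] assms by (simp add: Int_commute)

text \<open>Mutual independence survives grouping: the index sets \<open>{1}\<close> and
  \<open>{0, 2}\<close> are disjoint and each algebra is intersection-stable. The grouping is needed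
  because the events of big discounted claims involve claims and arrival times together.\<close>

lemma indep_prem_model:
  assumes A: "A \<in> sets prem_alg" and B: "B \<in> sets model_alg"
  shows "prob (A \<inter> B) = prob A * prob B"
proof -
  let ?E = "\<lambda>k::nat. if k = 0 then sets claim_alg else if k = 1 then sets prem_alg else sets arrival_alg"
  let ?I = "\<lambda>j::bool. if j then {1::nat} else {0, 2}"
  have un: "(\<Union>j\<in>UNIV. ?I j) = {0, 1, 2}" by (auto simp: UNIV_bool)
  have "indep_sets (\<lambda>j. sigma_sets (space M) (\<Union>i\<in>?I j. ?E i)) UNIV"
  proof (rule indep_sets_collect_sigma)
    show "indep_sets ?E (\<Union>j\<in>UNIV. ?I j)" unfolding un by (rule mutual_indep_algs)
    show "Int_stable (?E i)" for i by (auto simp: Int_stable_def)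
    show "disjoint_family_on ?I UNIV" by (auto simp: disjoint_family_on_def)
  qed
  from indep_setsD[OF this, of UNIV "\<lambda>j. if j then A else B"]
  have "prob (\<Inter>j\<in>UNIV. if j then A else B) = (\<Prod>j\<in>UNIV. prob (if j then A else B))"
    using A B by (auto simp: sets_model_alg intro: sigma_sets.Basic)
  then show ?thesis by (simp add: UNIV_bool Int_commute mult.commute)
qed

lemma X_claim_alg: "i \<ge> 1 \<Longrightarrow> X i \<in> borel_measurable claim_alg"
  and Y_claim_alg: "i \<ge> 1 \<Longrightarrow> Y i \<in> borel_measurable claim_alg"
  unfolding claim_alg_def
  by (rule measurable_subalgebra_events_of[where I="{1..}"]; simp add: events_of_Pow)+

lemma arrival_arrival_alg: "\<tau> i \<in> borel_measurable arrival_alg"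
proof -
  have "\<theta> k \<in> borel_measurable arrival_alg" if "k \<ge> 1" for k
    unfolding arrival_alg_def using that
    by (intro measurable_subalgebra_events_of[where I="{1..}"]) (simp_all add: events_of_Pow)
  then show ?thesis unfolding arrival_def[abs_def] by (intro borel_measurable_sum) auto
qed

lemma C1_prem_alg: "t \<ge> 0 \<Longrightarrow> C1 t \<in> borel_measurable prem_alg"
  and C2_prem_alg: "t \<ge> 0 \<Longrightarrow> C2 t \<in> borel_measurable prem_alg"
  unfolding prem_alg_def
  by (rule measurable_subalgebra_events_of[where I="{0..}"]; simp add: events_of_Pow)+

lemma measurable_model_alg:
  "f \<in> borel_measurable claim_alg \<Longrightarrow> f \<in> borel_measurable model_alg"
  "f \<in> borel_measurable arrival_alg \<Longrightarrow> f \<in> borel_measurable model_alg"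
  by (auto intro!: measurableI simp: sets_model_alg dest: measurable_sets intro: sigma_sets.Basic)

lemma indep_pairs:
  assumes "i \<ge> 1" "j \<ge> 1"
  shows "indep_var (borel \<Otimes>\<^sub>M borel) (\<lambda>\<omega>. (X i \<omega>, Y j \<omega>)) (borel \<Otimes>\<^sub>M borel) (\<lambda>\<omega>. (\<tau> k \<omega>, \<tau> l \<omega>))"
  using assms
  by (intro indep_var_of_subalgebras[of claim_alg arrival_alg] algs_events indep_claim_arrival
      measurable_Pair X_claim_alg Y_claim_alg arrival_arrival_alg) auto

lemma \<tau>_nonneg: "\<omega> \<in> space M \<Longrightarrow> \<tau> i \<omega> \<ge> 0"
  using theta_pos by (intro arrival_nonneg) auto

lemma \<tau>_le_iff: "\<omega> \<in> space M \<Longrightarrow> \<tau> i \<omega> \<le> \<tau> j \<omega> \<longleftrightarrow> i \<le> j"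
  using theta_pos by (intro arrival_le_iff) auto

text \<open>The discount factors are moved to the levels, so that conditionally on the arrival times
  this is a joint tail event of two claims.\<close>

definition "claim_event i j x y =
  {\<omega>\<in>space M. \<tau> i \<omega> \<le> T \<and> \<tau> j \<omega> \<le> T \<and> X i \<omega> > x * exp (r * \<tau> i \<omega>) \<and> Y j \<omega> > y * exp (r * \<tau> j \<omega>)}"

text \<open>\<open>mean_tail i j\<close> is the contribution of the \<open>i\<close>-th claim of the first line and the \<open>j\<close>-th claim of
the second line to \<open>Delta\<close>, up to the factor \<open>C\<close> when \<open>i = j\<close>.\<close>

definition "mean_tail i j x y = expectation (\<lambda>\<omega>. if \<tau> i \<omega> \<le> T \<and> \<tau> j \<omega> \<le> T
  then Fb (x * exp (r * \<tau> i \<omega>)) * Gb (y * exp (r * \<tau> j \<omega>)) else 0)"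

lemma claim_event_measurable [measurable]: "claim_event i j x y \<in> events"
  unfolding claim_event_def by measurable

lemma prob_claim_event:
  assumes "i \<ge> 1" "j \<ge> 1"
  shows "(\<lambda>\<omega>. if \<tau> i \<omega> \<le> T \<and> \<tau> j \<omega> \<le> T
      then tail_XY i j (x * exp (r * \<tau> i \<omega>)) (y * exp (r * \<tau> j \<omega>)) else 0) \<in> borel_measurable M" (is "?f \<in> _")
    and "prob (claim_event i j x y) = expectation (\<lambda>\<omega>. if \<tau> i \<omega> \<le> T \<and> \<tau> j \<omega> \<le> T
      then tail_XY i j (x * exp (r * \<tau> i \<omega>)) (y * exp (r * \<tau> j \<omega>)) else 0)"
proof -
  define A :: "((real \<times> real) \<times> (real \<times> real)) set" where "A = {p\<in>space ((borel \<Otimes>\<^sub>M borel) \<Otimes>\<^sub>M (borel \<Otimes>\<^sub>M borel)).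
    fst (snd p) \<le> T \<and> snd (snd p) \<le> T \<and> fst (fst p) > x * exp (r * fst (snd p)) \<and> snd (fst p) > y * exp (r * snd (snd p))}"
  have A: "A \<in> sets ((borel \<Otimes>\<^sub>M borel) \<Otimes>\<^sub>M (borel \<Otimes>\<^sub>M borel))" unfolding A_def by measurable
  \<comment> \<open>With the arrival times frozen, the section is a joint tail at deterministic
    levels, or empty when an arrival comes after \<open>T\<close>.\<close>
  have sect: "prob {\<omega>'\<in>space M. ((X i \<omega>', Y j \<omega>'), (\<tau> i \<omega>, \<tau> j \<omega>)) \<in> A} = ?f \<omega>" for \<omega>
    by (auto simp: A_def space_pair_measure tail_XY_def)
  have ev: "{\<omega>\<in>space M. ((X i \<omega>, Y j \<omega>), (\<tau> i \<omega>, \<tau> j \<omega>)) \<in> A} = claim_event i j x y"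
    by (auto simp: A_def space_pair_measure claim_event_def)
  show "?f \<in> borel_measurable M"
    using indep_var_prob_expectation(1)[OF indep_pairs[OF assms, of i j] A] unfolding sect .
  show "prob (claim_event i j x y) = expectation ?f"
    using indep_var_prob_expectation(2)[OF indep_pairs[OF assms, of i j] A] unfolding sect ev .
qed

lemma mean_tail_measurable [measurable]:
  "(\<lambda>\<omega>. if \<tau> i \<omega> \<le> T \<and> \<tau> j \<omega> \<le> T then Fb (x * exp (r * \<tau> i \<omega>)) * Gb (y * exp (r * \<tau> j \<omega>)) else 0) \<in> borel_measurable M"
  by measurable

lemma FbGb_bounds: "0 \<le> Fb u * Gb v" "Fb u * Gb v \<le> 1"
  using Fb_pos[of u] Gb_pos[of v] Fb_le1[of u] Gb_le1[of v] by (auto intro: mult_le_one less_imp_le)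

lemma mean_tail_integrable:
  "integrable M (\<lambda>\<omega>. if \<tau> i \<omega> \<le> T \<and> \<tau> j \<omega> \<le> T then Fb (x * exp (r * \<tau> i \<omega>)) * Gb (y * exp (r * \<tau> j \<omega>)) else 0)"
  by (intro integrable_const_bound[where B=1] mean_tail_measurable AE_I2) (auto simp: FbGb_bounds)

lemma mean_tail_nonneg: "mean_tail i j x y \<ge> 0"
  unfolding mean_tail_def by (intro integral_nonneg_AE AE_I2) (auto simp: FbGb_bounds)

lemma exp_mult_ge: "\<omega> \<in> space M \<Longrightarrow> x \<ge> 0 \<Longrightarrow> x \<le> x * exp (r * \<tau> i \<omega>)"
proof -
  assume "\<omega> \<in> space M" "x \<ge> 0"
  then have "x * 1 \<le> x * exp (r * \<tau> i \<omega>)"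
    using \<tau>_nonneg[of \<omega> i] r_nonneg by (intro mult_left_mono) auto
  then show ?thesis by simp
qed

text \<open>As \<open>r \<ge> 0\<close>, the random levels
  \<open>x * exp (r * \<tau> i \<omega>)\<close> are never below \<open>x\<close>. The uniform
  estimate for \<open>tail_XY\<close> therefore holds for every outcome and can be integrated, with
  \<open>N\<close> independent of the indices.\<close>

lemma prob_claim_event_approx:
  assumes e: "\<epsilon> > 0"
  shows "\<exists>N. \<forall>x\<ge>N. \<forall>y\<ge>N. \<forall>i\<ge>1. \<forall>j\<ge>1.
    \<bar>prob (claim_event i j x y) - coef i j * mean_tail i j x y\<bar> \<le> \<epsilon> * (coef i j * mean_tail i j x y)"
proof -
  obtain N where N: "\<And>u v i j. u \<ge> N \<Longrightarrow> v \<ge> N \<Longrightarrow> i \<ge> 1 \<Longrightarrow> j \<ge> 1 \<Longrightarrow>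
    \<bar>tail_XY i j u v - coef i j * (Fb u * Gb v)\<bar> \<le> \<epsilon> * (coef i j * (Fb u * Gb v))"
    using tail_XY_approx[OF e] by blast
  show ?thesis
  proof (intro exI[of _ "max N 0"] allI impI)
    fix x y :: real and i j :: nat assume xy: "x \<ge> max N 0" "y \<ge> max N 0" and ij: "i \<ge> 1" "j \<ge> 1"
    let ?f = "\<lambda>\<omega>. if \<tau> i \<omega> \<le> T \<and> \<tau> j \<omega> \<le> T
      then tail_XY i j (x * exp (r * \<tau> i \<omega>)) (y * exp (r * \<tau> j \<omega>)) else 0"
    let ?g = "\<lambda>\<omega>. if \<tau> i \<omega> \<le> T \<and> \<tau> j \<omega> \<le> T then Fb (x * exp (r * \<tau> i \<omega>)) * Gb (y * exp (r * \<tau> j \<omega>)) else 0"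
    have f: "integrable M ?f"
      by (intro integrable_const_bound[where B=1] prob_claim_event(1)[OF ij] AE_I2) (auto simp: tail_XY_def)
    have g: "integrable M ?g" by (rule mean_tail_integrable)
    have *: "\<bar>?f \<omega> - coef i j * ?g \<omega>\<bar> \<le> \<epsilon> * (coef i j * ?g \<omega>)" if \<omega>: "\<omega> \<in> space M" for \<omega>
    proof -
      have "x * exp (r * \<tau> i \<omega>) \<ge> N" "y * exp (r * \<tau> j \<omega>) \<ge> N"
        using exp_mult_ge[OF \<omega>, of x i] exp_mult_ge[OF \<omega>, of y j] xy by auto
      from N[OF this ij] show ?thesis by simp
    qed
    have "expectation ?f \<le> expectation (\<lambda>\<omega>. (1 + \<epsilon>) * coef i j * ?g \<omega>)"
    proof (intro integral_mono f integrable_mult_right g)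
      fix \<omega> assume "\<omega> \<in> space M"
      from *[OF this] show "?f \<omega> \<le> (1 + \<epsilon>) * coef i j * ?g \<omega>" unfolding abs_le_iff distrib_right mult.assoc by linarith
    qed
    moreover have "expectation (\<lambda>\<omega>. (1 - \<epsilon>) * coef i j * ?g \<omega>) \<le> expectation ?f"
    proof (intro integral_mono f integrable_mult_right g)
      fix \<omega> assume "\<omega> \<in> space M"
      from *[OF this] show "(1 - \<epsilon>) * coef i j * ?g \<omega> \<le> ?f \<omega>" unfolding abs_le_iff left_diff_distrib mult.assoc by linarith
    qed
    ultimately have "prob (claim_event i j x y) \<le> (1 + \<epsilon>) * coef i j * mean_tail i j x y"
      "(1 - \<epsilon>) * coef i j * mean_tail i j x y \<le> prob (claim_event i j x y)"
      unfolding prob_claim_event(2)[OF ij] mean_tail_def by (simp_all only: integral_mult_right_zero)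
    then show "\<bar>prob (claim_event i j x y) - coef i j * mean_tail i j x y\<bar> \<le> \<epsilon> * (coef i j * mean_tail i j x y)"
      unfolding abs_le_iff left_diff_distrib distrib_right mult.assoc by linarith
  qed
qed

text \<open>A shift of the capital by \<open>a\<close> moves the random level by
  \<open>a * exp (r * \<tau> i \<omega>)\<close>, which is at most \<open>a * exp (r * T)\<close> on
  the relevant event. Class L can thus be applied with one deterministic shift.\<close>

lemma mean_tail_shift:
  assumes a: "a \<ge> 0" and e: "\<epsilon> > 0"
  shows "\<exists>N. \<forall>x\<ge>N. \<forall>y\<ge>N. \<forall>i j. mean_tail i j (x - a) (y - a) \<le> (1 + \<epsilon>) * mean_tail i j x y"
proof -
  \<comment> \<open>Each of the two tails contributes one factor
    \<open>1 + \<delta>\<close>.\<close>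
  obtain \<delta> where d: "\<delta> > 0" "(1 + \<delta>) * (1 + \<delta>) \<le> 1 + \<epsilon>" using obtain_small_factor[OF e] .
  have b: "a * exp (r * T) \<ge> 0" using a by simp
  obtain N1 where N1: "\<And>x. x \<ge> N1 \<Longrightarrow> Fb (x - a * exp (r * T)) \<le> (1 + \<delta>) * Fb x"
    using classL_shift_le[OF F_class(2) Fb_pos b d(1)] by blast
  obtain N2 where N2: "\<And>x. x \<ge> N2 \<Longrightarrow> Gb (x - a * exp (r * T)) \<le> (1 + \<delta>) * Gb x"
    using classL_shift_le[OF G_class(2) Gb_pos b d(1)] by blast
  show ?thesis
  proof (intro exI[of _ "max 0 (max N1 N2)"] allI impI)
    fix x y :: real and i j :: nat assume xy: "x \<ge> max 0 (max N1 N2)" "y \<ge> max 0 (max N1 N2)"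
    have "mean_tail i j (x - a) (y - a) \<le> expectation (\<lambda>\<omega>. (1 + \<epsilon>) * (if \<tau> i \<omega> \<le> T \<and> \<tau> j \<omega> \<le> T
        then Fb (x * exp (r * \<tau> i \<omega>)) * Gb (y * exp (r * \<tau> j \<omega>)) else 0))"
      unfolding mean_tail_def
    proof (intro integral_mono mean_tail_integrable integrable_mult_right)
      fix \<omega> assume \<omega>: "\<omega> \<in> space M"
      have sh: "z * exp (r * \<tau> k \<omega>) - a * exp (r * T) \<le> (z - a) * exp (r * \<tau> k \<omega>)" if "\<tau> k \<omega> \<le> T" for z k
      proof -
        have "a * exp (r * \<tau> k \<omega>) \<le> a * exp (r * T)" using a that r_nonneg by (intro mult_left_mono) (auto intro: mult_left_mono)
        then show ?thesis by (simp add: left_diff_distrib)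
      qed
      have "Fb ((x - a) * exp (r * \<tau> i \<omega>)) * Gb ((y - a) * exp (r * \<tau> j \<omega>))
         \<le> (1 + \<epsilon>) * (Fb (x * exp (r * \<tau> i \<omega>)) * Gb (y * exp (r * \<tau> j \<omega>)))" if t: "\<tau> i \<omega> \<le> T" "\<tau> j \<omega> \<le> T"
      proof -
        have f1: "Fb ((x - a) * exp (r * \<tau> i \<omega>)) \<le> (1 + \<delta>) * Fb (x * exp (r * \<tau> i \<omega>))"
          using Fb_anti[OF sh[OF t(1), of x]] N1[of "x * exp (r * \<tau> i \<omega>)"] exp_mult_ge[OF \<omega>, of x i] xy by auto
        have f2: "Gb ((y - a) * exp (r * \<tau> j \<omega>)) \<le> (1 + \<delta>) * Gb (y * exp (r * \<tau> j \<omega>))"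
          using Gb_anti[OF sh[OF t(2), of y]] N2[of "y * exp (r * \<tau> j \<omega>)"] exp_mult_ge[OF \<omega>, of y j] xy by auto
        have "Fb ((x - a) * exp (r * \<tau> i \<omega>)) * Gb ((y - a) * exp (r * \<tau> j \<omega>)) \<le>
          ((1 + \<delta>) * Fb (x * exp (r * \<tau> i \<omega>))) * ((1 + \<delta>) * Gb (y * exp (r * \<tau> j \<omega>)))"
          by (intro mult_mono f1 f2) (use d(1) Fb_pos Gb_pos in \<open>auto intro: less_imp_le\<close>)
        also have "\<dots> = ((1 + \<delta>) * (1 + \<delta>)) * (Fb (x * exp (r * \<tau> i \<omega>)) * Gb (y * exp (r * \<tau> j \<omega>)))"
          by (simp only: mult_ac)
        also have "\<dots> \<le> (1 + \<epsilon>) * (Fb (x * exp (r * \<tau> i \<omega>)) * Gb (y * exp (r * \<tau> j \<omega>)))"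
          by (rule mult_right_mono[OF d(2) FbGb_bounds(1)])
        finally show ?thesis .
      qed
      then show "(if \<tau> i \<omega> \<le> T \<and> \<tau> j \<omega> \<le> T then Fb ((x - a) * exp (r * \<tau> i \<omega>)) * Gb ((y - a) * exp (r * \<tau> j \<omega>)) else 0)
        \<le> (1 + \<epsilon>) * (if \<tau> i \<omega> \<le> T \<and> \<tau> j \<omega> \<le> T then Fb (x * exp (r * \<tau> i \<omega>)) * Gb (y * exp (r * \<tau> j \<omega>)) else 0)"
        by simp
    qed
    then show "mean_tail i j (x - a) (y - a) \<le> (1 + \<epsilon>) * mean_tail i j x y"
      unfolding mean_tail_def by (simp only: integral_mult_right_zero)
  qed
qed

text \<open>Both claims must arrive by \<open>T\<close>, so either arrival may be kept in the bound;
  later the larger index is kept, for the better decay.\<close>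

lemma mean_tail_le:
  assumes "x \<ge> 0" "y \<ge> 0" "k = i \<or> k = j"
  shows "mean_tail i j x y \<le> Fb x * Gb y * prob {\<omega>\<in>space M. \<tau> k \<omega> \<le> T}"
proof -
  have "mean_tail i j x y \<le> expectation (\<lambda>\<omega>. Fb x * Gb y * indicator {\<omega>\<in>space M. \<tau> k \<omega> \<le> T} \<omega>)"
    unfolding mean_tail_def
  proof (intro integral_mono mean_tail_integrable)
    fix \<omega> assume \<omega>: "\<omega> \<in> space M"
    have "Fb (x * exp (r * \<tau> i \<omega>)) * Gb (y * exp (r * \<tau> j \<omega>)) \<le> Fb x * Gb y"
      using Fb_pos Gb_pos by (intro mult_mono Fb_anti Gb_anti exp_mult_ge[OF \<omega>] assms) (auto intro: less_imp_le)
    then show "(if \<tau> i \<omega> \<le> T \<and> \<tau> j \<omega> \<le> T then Fb (x * exp (r * \<tau> i \<omega>)) * Gb (y * exp (r * \<tau> j \<omega>)) else 0)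
      \<le> Fb x * Gb y * indicator {\<omega>\<in>space M. \<tau> k \<omega> \<le> T} \<omega>"
      using \<omega> assms(3) FbGb_bounds(1)[of x y] by (auto simp: indicator_def)
  qed (intro integrable_mult_right integrable_real_indicator; simp add: emeasure_eq_measure)
  then show ?thesis by simp
qed

lemma mean_tail_diag_ge:
  assumes "x \<ge> 0" "y \<ge> 0"
  shows "Fb (x * exp (r * T)) * Gb (y * exp (r * T)) * prob {\<omega>\<in>space M. \<tau> i \<omega> \<le> T} \<le> mean_tail i i x y"
proof -
  have "expectation (\<lambda>\<omega>. Fb (x * exp (r * T)) * Gb (y * exp (r * T)) * indicator {\<omega>\<in>space M. \<tau> i \<omega> \<le> T} \<omega>) \<le> mean_tail i i x y"
    unfolding mean_tail_def
  proof (intro integral_mono mean_tail_integrable)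
    fix \<omega> assume \<omega>: "\<omega> \<in> space M"
    have "Fb (x * exp (r * T)) * Gb (y * exp (r * T)) \<le> Fb (x * exp (r * \<tau> i \<omega>)) * Gb (y * exp (r * \<tau> i \<omega>))" if "\<tau> i \<omega> \<le> T"
    proof -
      have e: "exp (r * \<tau> i \<omega>) \<le> exp (r * T)" using that r_nonneg by (simp add: mult_left_mono)
      show ?thesis
        using Fb_pos Gb_pos by (intro mult_mono Fb_anti Gb_anti mult_left_mono e assms) (auto intro: less_imp_le)
    qed
    then show "Fb (x * exp (r * T)) * Gb (y * exp (r * T)) * indicator {\<omega>\<in>space M. \<tau> i \<omega> \<le> T} \<omega> \<le>
      (if \<tau> i \<omega> \<le> T \<and> \<tau> i \<omega> \<le> T then Fb (x * exp (r * \<tau> i \<omega>)) * Gb (y * exp (r * \<tau> i \<omega>)) else 0)"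
      using \<omega> by (auto simp: indicator_def)
  qed (intro integrable_mult_right integrable_real_indicator; simp add: emeasure_eq_measure)
  then show ?thesis by simp
qed

text \<open>In GTAI the three levels grow independently. Hence \<open>a\<close> may be a fixed
  constant beyond \<open>N\<close> while \<open>x\<close> and \<open>y\<close> tend to infinity,
  which is what makes a bounded shift sufficient in the one-big-jump argument.\<close>

lemma triple_X_small:
  assumes m: "m \<ge> 1" and e: "\<epsilon> > 0"
  shows "\<exists>N. \<forall>a\<ge>N. \<forall>x\<ge>N. \<forall>y\<ge>N. \<forall>i\<in>{1..m}. \<forall>k\<in>{1..m}. \<forall>j\<in>{1..m}. i \<noteq> k \<longrightarrow>
    prob {\<omega>\<in>space M. X i \<omega> > a \<and> X k \<omega> > x \<and> Y j \<omega> > y} \<le> \<epsilon> * tail_XY k j x y"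
proof -
  define J where "J = {(i, k, j). i \<in> {1..m} \<and> k \<in> {1..m} \<and> j \<in> {1..m} \<and> i \<noteq> k}"
  define A where "A = (\<lambda>(i, k::nat, j::nat) a. {\<omega>\<in>space M. \<bar>X i \<omega>\<bar> > a})"
  define B where "B = (\<lambda>(i::nat, k, j) x y. {\<omega>\<in>space M. X k \<omega> > x \<and> Y j \<omega> > y})"
  have "J \<subseteq> {1..m} \<times> {1..m} \<times> {1..m}" by (auto simp: J_def)
  then have J: "finite J" by (rule finite_subset) auto
  have lim: "((\<lambda>(a, x, y). cond_prob M (A p a) (B p x y)) \<longlongrightarrow> 0) (at_top \<times>\<^sub>F at_top \<times>\<^sub>F at_top)"
    if p: "p \<in> J" for p
  proof -
    obtain i k j where p': "p = (i, k, j)" "i \<in> {1..m}" "k \<in> {1..m}" "j \<in> {1..m}" "i \<noteq> k"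
      using p unfolding J_def by blast
    then show ?thesis
      unfolding p'(1) A_def B_def case_prod_conv using gtai[OF m] unfolding GTAI_def by blast
  qed
  have B: "B p x y \<in> events" for p x y unfolding B_def by (cases p) simp
  obtain N where N: "\<forall>a\<ge>N. \<forall>x\<ge>N. \<forall>y\<ge>N. \<forall>p\<in>J. prob (A p a \<inter> B p x y) \<le> \<epsilon> * prob (B p x y)"
    using cond_prob_tendsto_0_uniform[where A=A and B=B, OF J lim B e] by blast
  show ?thesis
  proof (intro exI[of _ N] allI impI ballI)
    fix a x y :: real and i k j assume *: "a \<ge> N" "x \<ge> N" "y \<ge> N" "i \<in> {1..m}" "k \<in> {1..m}" "j \<in> {1..m}" "i \<noteq> k"
    have "prob {\<omega>\<in>space M. X i \<omega> > a \<and> X k \<omega> > x \<and> Y j \<omega> > y} \<le> prob (A (i, k, j) a \<inter> B (i, k, j) x y)"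
      by (intro finite_measure_mono) (auto simp: A_def B_def)
    also have "\<dots> \<le> \<epsilon> * prob (B (i, k, j) x y)" using * by (intro N[rule_format]) (auto simp: J_def)
    finally show "prob {\<omega>\<in>space M. X i \<omega> > a \<and> X k \<omega> > x \<and> Y j \<omega> > y} \<le> \<epsilon> * tail_XY k j x y"
      by (simp add: B_def tail_XY_def)
  qed
qed

lemma triple_Y_small:
  assumes m: "m \<ge> 1" and e: "\<epsilon> > 0"
  shows "\<exists>N. \<forall>a\<ge>N. \<forall>x\<ge>N. \<forall>y\<ge>N. \<forall>i\<in>{1..m}. \<forall>k\<in>{1..m}. \<forall>j\<in>{1..m}. i \<noteq> k \<longrightarrow>
    prob {\<omega>\<in>space M. Y i \<omega> > a \<and> X j \<omega> > x \<and> Y k \<omega> > y} \<le> \<epsilon> * tail_XY j k x y"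
proof -
  define J where "J = {(i, k, j). i \<in> {1..m} \<and> k \<in> {1..m} \<and> j \<in> {1..m} \<and> i \<noteq> k}"
  define A where "A = (\<lambda>(i, k::nat, j::nat) a. {\<omega>\<in>space M. \<bar>Y i \<omega>\<bar> > a})"
  define B where "B = (\<lambda>(i::nat, k, j) x y. {\<omega>\<in>space M. X j \<omega> > x \<and> Y k \<omega> > y})"
  have "J \<subseteq> {1..m} \<times> {1..m} \<times> {1..m}" by (auto simp: J_def)
  then have J: "finite J" by (rule finite_subset) auto
  have lim: "((\<lambda>(a, x, y). cond_prob M (A p a) (B p x y)) \<longlongrightarrow> 0) (at_top \<times>\<^sub>F at_top \<times>\<^sub>F at_top)"
    if p: "p \<in> J" for p
  proof -
    obtain i k j where p': "p = (i, k, j)" "i \<in> {1..m}" "k \<in> {1..m}" "j \<in> {1..m}" "i \<noteq> k"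
      using p unfolding J_def by blast
    then show ?thesis
      unfolding p'(1) A_def B_def case_prod_conv using gtai[OF m] unfolding GTAI_def by blast
  qed
  have B: "B p x y \<in> events" for p x y unfolding B_def by (cases p) simp
  obtain N where N: "\<forall>a\<ge>N. \<forall>x\<ge>N. \<forall>y\<ge>N. \<forall>p\<in>J. prob (A p a \<inter> B p x y) \<le> \<epsilon> * prob (B p x y)"
    using cond_prob_tendsto_0_uniform[where A=A and B=B, OF J lim B e] by blast
  show ?thesis
  proof (intro exI[of _ N] allI impI ballI)
    fix a x y :: real and i k j assume *: "a \<ge> N" "x \<ge> N" "y \<ge> N" "i \<in> {1..m}" "k \<in> {1..m}" "j \<in> {1..m}" "i \<noteq> k"
    have "prob {\<omega>\<in>space M. Y i \<omega> > a \<and> X j \<omega> > x \<and> Y k \<omega> > y} \<le> prob (A (i, k, j) a \<inter> B (i, k, j) x y)"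
      by (intro finite_measure_mono) (auto simp: A_def B_def)
    also have "\<dots> \<le> \<epsilon> * prob (B (i, k, j) x y)" using * by (intro N[rule_format]) (auto simp: J_def)
    finally show "prob {\<omega>\<in>space M. Y i \<omega> > a \<and> X j \<omega> > x \<and> Y k \<omega> > y} \<le> \<epsilon> * tail_XY j k x y"
      by (simp add: B_def tail_XY_def)
  qed
qed

end

section \<open>Sums of discounted claims\<close>

lemma sum_gt_obtains:
  fixes z :: "nat \<Rightarrow> real"
  assumes "(\<Sum>i\<in>{1..m}. z i) > x" "m \<ge> 1"
  obtains i where "i \<in> {1..m}" "z i > x / m"
proof -
  have "\<exists>i\<in>{1..m}. z i > x / m"
  proof (rule ccontr)
    assume "\<not> ?thesis"
    then have "(\<Sum>i\<in>{1..m}. z i) \<le> (\<Sum>i\<in>{1..m}. x / m)" by (intro sum_mono) (auto simp: not_less)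
    also have "\<dots> = x" using assms by simp
    finally show False using assms by simp
  qed
  then show ?thesis using that by blast
qed

lemma sum_gt_cases:
  fixes z :: "nat \<Rightarrow> real"
  assumes gt: "(\<Sum>i\<in>{1..m}. z i) > x" and m: "m \<ge> 1" and a: "a \<ge> 0"
  obtains i where "i \<in> {1..m}" "z i > x - a"
  | i k where "i \<in> {1..m}" "k \<in> {1..m}" "k \<noteq> i" "z i > x / m" "z k > a / m"
proof -
  obtain i where i: "i \<in> {1..m}" "z i > x / m" using sum_gt_obtains[OF gt m] .
  show ?thesis
  proof (cases "z i > x - a")
    case False
    have "\<exists>k\<in>{1..m} - {i}. z k > a / m"
    proof (rule ccontr)
      assume neg: "\<not> ?thesis"
      have "(\<Sum>k\<in>{1..m}. z k) = z i + (\<Sum>k\<in>{1..m} - {i}. z k)" using i by (simp add: sum.remove)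
      also have "(\<Sum>k\<in>{1..m} - {i}. z k) \<le> (\<Sum>k\<in>{1..m} - {i}. a / m)"
        using neg by (intro sum_mono) (auto simp: not_less)
      \<comment> \<open>Comparing the \<open>m - 1\<close> remaining terms with \<open>m\<close>
        terms avoids a division by \<open>m - 1\<close> when \<open>m = 1\<close>.\<close>
      also have "\<dots> \<le> (\<Sum>k\<in>{1..m}. a / m)" using a by (intro sum_mono2) auto
      also have "\<dots> = a" using m by simp
      finally show False using gt False by simp
    qed
    then show ?thesis using that(2) i by blast
  qed (use i that(1) in blast)
qed

text \<open>The double sum runs over ordered pairs and so counts each intersection twice. This is
  weaker than the sharp inequality, but the intersections only enter an error term.\<close>

lemma (in prob_space) Bonferroni_lower:
  assumes "finite I" "\<And>i. i \<in> I \<Longrightarrow> A i \<in> events"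
  shows "(\<Sum>i\<in>I. prob (A i)) - (\<Sum>i\<in>I. \<Sum>j\<in>I - {i}. prob (A i \<inter> A j)) \<le> prob (\<Union>i\<in>I. A i)"
  using assms
proof (induction I rule: finite_induct)
  case (insert p I)
  have ev_p: "A p \<in> events" and ev_I: "\<And>i. i \<in> I \<Longrightarrow> A i \<in> events"
    by (auto intro: insert.prems)
  then have ev_U: "(\<Union>i\<in>I. A i) \<in> events" using insert.hyps(1) by (simp add: sets.finite_UN)
  have "prob (A p \<inter> (\<Union>i\<in>I. A i)) = prob (\<Union>i\<in>I. A p \<inter> A i)" by (simp only: Int_UN_distrib)
  also have "\<dots> \<le> (\<Sum>i\<in>I. prob (A p \<inter> A i))"
    using ev_p ev_I insert.hyps by (intro finite_measure_subadditive_finite) auto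
  finally have 1: "prob (A p \<inter> (\<Union>i\<in>I. A i)) \<le> (\<Sum>i\<in>I. prob (A p \<inter> A i))" .
  have 2: "prob (\<Union>i\<in>insert p I. A i) = prob (A p) + prob (\<Union>i\<in>I. A i) - prob (A p \<inter> (\<Union>i\<in>I. A i))"
    using measure_Un3[of "A p" M "\<Union>i\<in>I. A i"] ev_p ev_U by (simp add: fmeasurable_eq_sets)
  have 3: "(\<Sum>i\<in>I. \<Sum>j\<in>I - {i}. prob (A i \<inter> A j)) \<le> (\<Sum>i\<in>I. \<Sum>j\<in>insert p I - {i}. prob (A i \<inter> A j))"
    using insert.hyps by (intro sum_mono sum_mono2) auto
  have "(\<Sum>i\<in>insert p I. \<Sum>j\<in>insert p I - {i}. prob (A i \<inter> A j))
    = (\<Sum>j\<in>I. prob (A p \<inter> A j)) + (\<Sum>i\<in>I. \<Sum>j\<in>insert p I - {i}. prob (A i \<inter> A j))"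
    using insert.hyps by simp
  moreover have "(\<Sum>i\<in>insert p I. prob (A i)) = prob (A p) + (\<Sum>i\<in>I. prob (A i))"
    using insert.hyps by simp
  ultimately show ?case using 1 2 3 insert.IH[OF ev_I] by linarith
qed simp

text \<open>Termwise differentiation of the power series with coefficients \<open>n ^ q\<close>
  multiplies them by one more factor linear in the index. The induction needs all \<open>x\<close>
  in the unit disc, since differentiation uses convergence throughout the disc.\<close>

lemma summable_power_times_geometric:
  fixes x :: real
  assumes "\<bar>x\<bar> < 1"
  shows "summable (\<lambda>n. real n ^ q * x ^ n)"
  using assms
proof (induction q arbitrary: x)
  case (Suc q)
  have "summable (\<lambda>n. diffs (\<lambda>n. real n ^ q) n * x ^ n)"
    using termdiff_converges[of x 1 "\<lambda>n. real n ^ q"] Suc by simp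
  then have "summable (\<lambda>n. x * (diffs (\<lambda>n. real n ^ q) n * x ^ n))" by (rule summable_mult)
  then have "summable (\<lambda>n. real (Suc n) ^ Suc q * x ^ Suc n)" by (simp add: diffs_def algebra_simps)
  then show ?case by (rule summable_Suc_iff[THEN iffD1])
qed (simp add: summable_geometric)

context renewal_risk
begin

text \<open>Setting the discount factor to 0 after \<open>T\<close> turns a sum with a random number
  of claims into one with a fixed number.\<close>

definition "wt i \<omega> = (if \<tau> i \<omega> \<le> T then exp (- r * \<tau> i \<omega>) else 0)"

lemma wt_measurable [measurable]: "wt i \<in> borel_measurable M"
  unfolding wt_def[abs_def] by measurable

lemma wt_bounds: "\<omega> \<in> space M \<Longrightarrow> 0 \<le> wt i \<omega> \<and> wt i \<omega> \<le> 1"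
  using \<tau>_nonneg[of \<omega> i] r_nonneg by (auto simp: wt_def)

lemma mult_wt_le: "\<omega> \<in> space M \<Longrightarrow> z \<ge> 0 \<Longrightarrow> z * wt i \<omega> \<le> z"
  using mult_left_mono[of "wt i \<omega>" 1 z] wt_bounds[of \<omega> i] by simp

lemma mult_wt_gt_iff: "u \<ge> 0 \<Longrightarrow> z * wt i \<omega> > u \<longleftrightarrow> \<tau> i \<omega> \<le> T \<and> z > u * exp (r * \<tau> i \<omega>)"
  by (auto simp: wt_def exp_minus field_simps)

lemma claim_event_eq:
  "x \<ge> 0 \<Longrightarrow> y \<ge> 0 \<Longrightarrow> claim_event i j x y = {\<omega>\<in>space M. X i \<omega> * wt i \<omega> > x \<and> Y j \<omega> * wt j \<omega> > y}"
  by (auto simp: claim_event_def mult_wt_gt_iff)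

lemma claim_event_subset:
  assumes "x \<ge> 0" "y \<ge> 0"
  shows "claim_event i j x y \<subseteq> {\<omega>\<in>space M. X i \<omega> > x \<and> Y j \<omega> > y}"
proof
  fix \<omega> assume "\<omega> \<in> claim_event i j x y"
  then show "\<omega> \<in> {\<omega>\<in>space M. X i \<omega> > x \<and> Y j \<omega> > y}"
    using exp_mult_ge[of \<omega> x i] exp_mult_ge[of \<omega> y j] assms by (auto simp: claim_event_def)
qed

text \<open>This is \<open>Delta\<close> restricted to the first \<open>m\<close> claims of each
  line; it links the ruin probabilities to \<open>Delta\<close>.\<close>

definition "main_sum m x y = (\<Sum>(i, j)\<in>{1..m} \<times> {1..m}. coef i j * mean_tail i j x y)"

text \<open>One big jump: if a sum exceeds \<open>x\<close>, then either one summand exceeds \<open>x - a\<close>, or two of them are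
large, the second one exceeding \<open>a / m\<close>. The second alternative is negligible by GTAI once the constant
\<open>a\<close> is large, and the shift by \<open>a\<close> is harmless for long-tailed distributions.\<close>

lemma finite_sum_upper:
  assumes m: "m \<ge> 1" and e: "\<epsilon> > 0"
  shows "\<exists>N. \<forall>x\<ge>N. \<forall>y\<ge>N.
    prob {\<omega>\<in>space M. (\<Sum>i\<in>{1..m}. X i \<omega> * wt i \<omega>) > x \<and> (\<Sum>j\<in>{1..m}. Y j \<omega> * wt j \<omega>) > y}
      \<le> (1 + \<epsilon>) * main_sum m x y + \<epsilon> * (Fb x * Gb y)"
proof -
  obtain \<delta> where d: "\<delta> > 0" "(1 + \<delta>) * (1 + \<delta>) \<le> 1 + \<epsilon>" using obtain_small_factor[OF e] .
  obtain K q where K0: "K > 0" and K1: "\<forall>i\<ge>1. \<forall>j\<ge>1. \<forall>n\<ge>1. \<forall>x\<ge>0. \<forall>y\<ge>0.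
     tail_XY i j (x / real n) (y / real n) \<le> K * real n ^ q * (Fb x * Gb y)"
    using tail_XY_dilation_bound by blast
  note K = K0 K1[rule_format]
  define I3 where "I3 = {(i, k, j). i \<in> {1..m} \<and> k \<in> {1..m} \<and> j \<in> {1..m} \<and> i \<noteq> k}"
  have "I3 \<subseteq> {1..m} \<times> {1..m} \<times> {1..m}" by (auto simp: I3_def)
  then have I3: "finite I3" by (rule finite_subset) auto
  \<comment> \<open>Chosen so that the two families of \<open>card I3\<close> error terms, each of
    size at most \<open>\<eta> * (K * real m ^ q)\<close>, add up to at most
    \<open>\<epsilon>\<close>. The \<open>+ 1\<close> protects against an empty \<open>I3\<close>,
    which occurs for \<open>m = 1\<close>.\<close>
  define \<eta> where "\<eta> = \<epsilon> / (2 * (real (card I3) + 1) * (K * real m ^ q))"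
  have Km: "K * real m ^ q > 0" using K m by simp
  have \<eta>: "\<eta> > 0" using e Km by (simp add: \<eta>_def)
  have \<eta>2: "2 * real (card I3) * (\<eta> * (K * real m ^ q)) \<le> \<epsilon>"
  proof -
    define d where "d = 2 * (real (card I3) + 1) * (K * real m ^ q)"
    have "d > 0" using Km by (simp add: d_def)
    have "2 * real (card I3) * (\<eta> * (K * real m ^ q)) \<le> 2 * (real (card I3) + 1) * (\<eta> * (K * real m ^ q))"
      using Km \<eta> by (intro mult_right_mono) auto
    also have "\<dots> = d * \<eta>" by (simp only: d_def mult_ac)
    also have "\<dots> = \<epsilon>" using \<open>d > 0\<close> unfolding \<eta>_def d_def[symmetric] by simp
    finally show ?thesis .
  qed
  obtain N1 where "\<forall>a\<ge>N1. \<forall>x\<ge>N1. \<forall>y\<ge>N1. \<forall>i\<in>{1..m}. \<forall>k\<in>{1..m}. \<forall>j\<in>{1..m}. i \<noteq> k \<longrightarrow>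
    prob {\<omega>\<in>space M. X i \<omega> > a \<and> X k \<omega> > x \<and> Y j \<omega> > y} \<le> \<eta> * tail_XY k j x y"
    using triple_X_small[OF m \<eta>] by blast
  note N1 = this[rule_format]
  obtain N2 where "\<forall>a\<ge>N2. \<forall>x\<ge>N2. \<forall>y\<ge>N2. \<forall>i\<in>{1..m}. \<forall>k\<in>{1..m}. \<forall>j\<in>{1..m}. i \<noteq> k \<longrightarrow>
    prob {\<omega>\<in>space M. Y i \<omega> > a \<and> X j \<omega> > x \<and> Y k \<omega> > y} \<le> \<eta> * tail_XY j k x y"
    using triple_Y_small[OF m \<eta>] by blast
  note N2 = this[rule_format]
  define N0 where "N0 = max 0 (max N1 N2)"
  \<comment> \<open>The second large summand exceeds \<open>a / m\<close>, so this choice puts it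
    exactly at the GTAI threshold \<open>N0\<close>.\<close>
  define a where "a = real m * N0"
  have a: "a \<ge> 0" "a / real m = N0" using m by (auto simp: a_def N0_def)
  obtain N3 where N3: "\<And>x y i j. x \<ge> N3 \<Longrightarrow> y \<ge> N3 \<Longrightarrow> i \<ge> 1 \<Longrightarrow> j \<ge> 1 \<Longrightarrow>
    \<bar>prob (claim_event i j x y) - coef i j * mean_tail i j x y\<bar> \<le> \<delta> * (coef i j * mean_tail i j x y)"
    using prob_claim_event_approx[OF d(1)] by blast
  obtain N4 where N4: "\<And>x y i j. x \<ge> N4 \<Longrightarrow> y \<ge> N4 \<Longrightarrow> mean_tail i j (x - a) (y - a) \<le> (1 + \<delta>) * mean_tail i j x y"
    using mean_tail_shift[OF a(1) d(1)] by blast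
  show ?thesis
  proof (intro exI[of _ "max (max 0 (N3 + a)) (max N4 a)"] allI impI)
    fix x y assume xy: "x \<ge> max (max 0 (N3 + a)) (max N4 a)" "y \<ge> max (max 0 (N3 + a)) (max N4 a)"
    then have xa: "x - a \<ge> 0" "y - a \<ge> 0" "x \<ge> 0" "y \<ge> 0" by auto
    have xm: "x / m \<ge> N0" "y / m \<ge> N0"
      using xa divide_right_mono[of a x "real m"] divide_right_mono[of a y "real m"] a(2) by auto
    \<comment> \<open>One big jump in each line, two jumps in the first line, and two jumps in the
      second. In the last two families the weights are dropped, as they are at most 1.\<close>
    let ?E1 = "\<lambda>(i, j). claim_event i j (x - a) (y - a)"
    let ?E2 = "\<lambda>(i, k, j). {\<omega>\<in>space M. X i \<omega> > N0 \<and> X k \<omega> > x / m \<and> Y j \<omega> > y / m}"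
    let ?E3 = "\<lambda>(i, k, j). {\<omega>\<in>space M. Y i \<omega> > N0 \<and> X j \<omega> > x / m \<and> Y k \<omega> > y / m}"
    let ?S = "{\<omega>\<in>space M. (\<Sum>i\<in>{1..m}. X i \<omega> * wt i \<omega>) > x \<and> (\<Sum>j\<in>{1..m}. Y j \<omega> * wt j \<omega>) > y}"
    have sub: "?S \<subseteq> (\<Union>p\<in>{1..m} \<times> {1..m}. ?E1 p) \<union> ((\<Union>p\<in>I3. ?E2 p) \<union> (\<Union>p\<in>I3. ?E3 p))"
    proof
      fix \<omega> assume "\<omega> \<in> ?S"
      then have \<omega>: "\<omega> \<in> space M" and S: "(\<Sum>i\<in>{1..m}. X i \<omega> * wt i \<omega>) > x" "(\<Sum>j\<in>{1..m}. Y j \<omega> * wt j \<omega>) > y" by auto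
      have Xw: "X i \<omega> * wt i \<omega> \<le> X i \<omega>" "Y i \<omega> * wt i \<omega> \<le> Y i \<omega>" if "i \<in> {1..m}" for i
        using mult_wt_le[OF \<omega>] X_nonneg[OF _ \<omega>, of i] Y_nonneg[OF _ \<omega>, of i] that by auto
      \<comment> \<open>Two jumps in one line are negligible only jointly with a jump in the other
        line. The pigeonhole claims \<open>i0\<close> and \<open>j0\<close> supply that third
        jump.\<close>
      obtain i0 where i0: "i0 \<in> {1..m}" "X i0 \<omega> > x / m"
        using sum_gt_obtains[OF S(1) m] Xw by (metis le_less_trans not_le)
      obtain j0 where j0: "j0 \<in> {1..m}" "Y j0 \<omega> > y / m"
        using sum_gt_obtains[OF S(2) m] Xw by (metis le_less_trans not_le)
      from S(1) m a(1) show "\<omega> \<in> (\<Union>p\<in>{1..m} \<times> {1..m}. ?E1 p) \<union> ((\<Union>p\<in>I3. ?E2 p) \<union> (\<Union>p\<in>I3. ?E3 p))"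
      proof (cases rule: sum_gt_cases)
        case (2 i k)
        then have "(k, i, j0) \<in> I3" "\<omega> \<in> ?E2 (k, i, j0)"
          using j0 \<omega> Xw(1)[of i] Xw(1)[of k] by (auto simp: I3_def a(2))
        then show ?thesis by blast
      next
        case (1 i)
        note i = this
        from S(2) m a(1) show ?thesis
        proof (cases rule: sum_gt_cases)
          case (1 j)
          then have "\<omega> \<in> ?E1 (i, j)" "(i, j) \<in> {1..m} \<times> {1..m}"
            using i \<omega> xa by (auto simp: claim_event_eq)
          then show ?thesis by blast
        next
          case (2 j k)
          then have "(k, j, i0) \<in> I3" "\<omega> \<in> ?E3 (k, j, i0)"
            using i0 \<omega> Xw(2)[of j] Xw(2)[of k] by (auto simp: I3_def a(2))
          then show ?thesis by blast
        qed
      qed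
    qed
    have ev: "?E1 p \<in> events" "?E2 t \<in> events" "?E3 t \<in> events" for p t
      by (auto split: prod.split)
    have P1: "prob (\<Union>p\<in>{1..m} \<times> {1..m}. ?E1 p) \<le> (1 + \<epsilon>) * main_sum m x y"
    proof -
      have "prob (\<Union>p\<in>{1..m} \<times> {1..m}. ?E1 p) \<le> (\<Sum>p\<in>{1..m} \<times> {1..m}. prob (?E1 p))"
        using ev by (intro finite_measure_subadditive_finite) auto
      also have "\<dots> \<le> (\<Sum>p\<in>{1..m} \<times> {1..m}. (1 + \<epsilon>) * (case p of (i, j) \<Rightarrow> coef i j * mean_tail i j x y))"
      proof (rule sum_mono)
        fix p :: "nat \<times> nat" assume "p \<in> {1..m} \<times> {1..m}"
        then obtain i j where p: "p = (i, j)" "i \<ge> 1" "j \<ge> 1" by auto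
        have "prob (claim_event i j (x - a) (y - a)) \<le> (1 + \<delta>) * (coef i j * mean_tail i j (x - a) (y - a))"
          using N3[of "x - a" "y - a" i j] xy p unfolding distrib_right by linarith
        also have "\<dots> \<le> (1 + \<delta>) * (coef i j * ((1 + \<delta>) * mean_tail i j x y))"
          using d(1) coef_pos[of i j] xy by (intro mult_left_mono N4) auto
        also have "\<dots> = ((1 + \<delta>) * (1 + \<delta>)) * (coef i j * mean_tail i j x y)" by (simp only: mult_ac)
        also have "\<dots> \<le> (1 + \<epsilon>) * (coef i j * mean_tail i j x y)"
          using coef_pos[of i j] mean_tail_nonneg[of i j x y] by (intro mult_right_mono d(2)) auto
        finally show "prob (?E1 p) \<le> (1 + \<epsilon>) * (case p of (i, j) \<Rightarrow> coef i j * mean_tail i j x y)"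
          by (simp add: p)
      qed
      finally show ?thesis by (simp only: main_sum_def sum_distrib_left)
    qed
    have bound: "\<eta> * tail_XY i j (x / m) (y / m) \<le> \<eta> * (K * real m ^ q) * (Fb x * Gb y)" if "i \<in> {1..m}" "j \<in> {1..m}" for i j
      using K(2)[of i j m x y] that m xa \<eta> by (simp add: mult.assoc)
    have P2: "prob (\<Union>p\<in>I3. ?E2 p) \<le> card I3 * (\<eta> * (K * real m ^ q) * (Fb x * Gb y))"
    proof -
      have "prob (\<Union>p\<in>I3. ?E2 p) \<le> (\<Sum>p\<in>I3. prob (?E2 p))"
        using ev I3 by (intro finite_measure_subadditive_finite) auto
      also have "\<dots> \<le> (\<Sum>p\<in>I3. \<eta> * (K * real m ^ q) * (Fb x * Gb y))"
      proof (rule sum_mono)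
        fix p assume "p \<in> I3"
        then obtain i k j where p: "p = (i, k, j)" "i \<in> {1..m}" "k \<in> {1..m}" "j \<in> {1..m}" "i \<noteq> k" by (auto simp: I3_def)
        have N0: "N0 \<ge> N1" by (simp add: N0_def)
        have "prob {\<omega>\<in>space M. X i \<omega> > N0 \<and> X k \<omega> > x / m \<and> Y j \<omega> > y / m} \<le> \<eta> * tail_XY k j (x / m) (y / m)"
          using N0 xm by (intro N1 p) auto
        also note bound[OF p(3,4)]
        finally show "prob (?E2 p) \<le> \<eta> * (K * real m ^ q) * (Fb x * Gb y)" by (simp add: p(1))
      qed
      finally show ?thesis by simp
    qed
    have P3: "prob (\<Union>p\<in>I3. ?E3 p) \<le> card I3 * (\<eta> * (K * real m ^ q) * (Fb x * Gb y))"
    proof -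
      have "prob (\<Union>p\<in>I3. ?E3 p) \<le> (\<Sum>p\<in>I3. prob (?E3 p))"
        using ev I3 by (intro finite_measure_subadditive_finite) auto
      also have "\<dots> \<le> (\<Sum>p\<in>I3. \<eta> * (K * real m ^ q) * (Fb x * Gb y))"
      proof (rule sum_mono)
        fix p assume "p \<in> I3"
        then obtain i k j where p: "p = (i, k, j)" "i \<in> {1..m}" "k \<in> {1..m}" "j \<in> {1..m}" "i \<noteq> k" by (auto simp: I3_def)
        have N0: "N0 \<ge> N2" by (simp add: N0_def)
        have "prob {\<omega>\<in>space M. Y i \<omega> > N0 \<and> X j \<omega> > x / m \<and> Y k \<omega> > y / m} \<le> \<eta> * tail_XY j k (x / m) (y / m)"
          using N0 xm by (intro N2 p) auto
        also note bound[OF p(4,3)]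
        finally show "prob (?E3 p) \<le> \<eta> * (K * real m ^ q) * (Fb x * Gb y)" by (simp add: p(1))
      qed
      finally show ?thesis by simp
    qed
    have U: "(\<Union>p\<in>{1..m} \<times> {1..m}. ?E1 p) \<in> events" "(\<Union>p\<in>I3. ?E2 p) \<in> events" "(\<Union>p\<in>I3. ?E3 p) \<in> events"
      using ev I3 by (auto intro!: sets.finite_UN)
    have "prob ?S \<le> prob ((\<Union>p\<in>{1..m} \<times> {1..m}. ?E1 p) \<union> ((\<Union>p\<in>I3. ?E2 p) \<union> (\<Union>p\<in>I3. ?E3 p)))"
      using U by (intro finite_measure_mono sub sets.Un)
    also have "\<dots> \<le> prob (\<Union>p\<in>{1..m} \<times> {1..m}. ?E1 p) + prob ((\<Union>p\<in>I3. ?E2 p) \<union> (\<Union>p\<in>I3. ?E3 p))"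
      using U by (intro measure_Un_le sets.Un)
    also have "\<dots> \<le> prob (\<Union>p\<in>{1..m} \<times> {1..m}. ?E1 p) + (prob (\<Union>p\<in>I3. ?E2 p) + prob (\<Union>p\<in>I3. ?E3 p))"
      using U by (intro add_left_mono measure_Un_le)
    also have "\<dots> \<le> (1 + \<epsilon>) * main_sum m x y + (2 * real (card I3) * (\<eta> * (K * real m ^ q))) * (Fb x * Gb y)"
      using P1 P2 P3 by (simp add: algebra_simps)
    also have "\<dots> \<le> (1 + \<epsilon>) * main_sum m x y + \<epsilon> * (Fb x * Gb y)"
      using mult_right_mono[OF \<eta>2 FbGb_bounds(1)[of x y]] by simp
    finally show "prob ?S \<le> (1 + \<epsilon>) * main_sum m x y + \<epsilon> * (Fb x * Gb y)" .
  qed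
qed

text \<open>For the lower bound one big claim in each line suffices, so a union of claim events
  replaces the sums and needs no shift. Two different index pairs differ in some coordinate, so
  their intersection involves two large claims in one line and at least one in the other, which GTAI
  makes negligible.\<close>

lemma finite_union_lower:
  assumes m: "m \<ge> 1" and e: "\<epsilon> > 0"
  shows "\<exists>N. \<forall>x\<ge>N. \<forall>y\<ge>N.
    (1 - \<epsilon>) * main_sum m x y - \<epsilon> * (Fb x * Gb y) \<le> prob (\<Union>(i, j)\<in>{1..m} \<times> {1..m}. claim_event i j x y)"
proof -
  obtain K where K: "K > 0" "\<And>i j u v. i \<ge> 1 \<Longrightarrow> j \<ge> 1 \<Longrightarrow> tail_XY i j u v \<le> K * (Fb u * Gb v)"
    using tail_XY_bound by blast
  let ?I = "{1..m} \<times> {1..m}"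
  \<comment> \<open>There are at most \<open>(m * m) * (m * m)\<close> ordered pairs of index pairs,
    each with an error of at most \<open>\<eta> * K\<close> units.\<close>
  define \<eta> where "\<eta> = \<epsilon> / (real (m * m) * real (m * m) * K)"
  have \<eta>: "\<eta> > 0" using e K m by (simp add: \<eta>_def)
  obtain N1 where "\<forall>a\<ge>N1. \<forall>x\<ge>N1. \<forall>y\<ge>N1. \<forall>i\<in>{1..m}. \<forall>k\<in>{1..m}. \<forall>j\<in>{1..m}. i \<noteq> k \<longrightarrow>
    prob {\<omega>\<in>space M. X i \<omega> > a \<and> X k \<omega> > x \<and> Y j \<omega> > y} \<le> \<eta> * tail_XY k j x y"
    using triple_X_small[OF m \<eta>] by blast
  note N1 = this[rule_format]
  obtain N2 where "\<forall>a\<ge>N2. \<forall>x\<ge>N2. \<forall>y\<ge>N2. \<forall>i\<in>{1..m}. \<forall>k\<in>{1..m}. \<forall>j\<in>{1..m}. i \<noteq> k \<longrightarrow>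
    prob {\<omega>\<in>space M. Y i \<omega> > a \<and> X j \<omega> > x \<and> Y k \<omega> > y} \<le> \<eta> * tail_XY j k x y"
    using triple_Y_small[OF m \<eta>] by blast
  note N2 = this[rule_format]
  obtain N3 where N3: "\<And>x y i j. x \<ge> N3 \<Longrightarrow> y \<ge> N3 \<Longrightarrow> i \<ge> 1 \<Longrightarrow> j \<ge> 1 \<Longrightarrow>
    \<bar>prob (claim_event i j x y) - coef i j * mean_tail i j x y\<bar> \<le> \<epsilon> * (coef i j * mean_tail i j x y)"
    using prob_claim_event_approx[OF e] by blast
  show ?thesis
  proof (intro exI[of _ "max (max 0 N1) (max N2 N3)"] allI impI)
    fix x y assume xy: "x \<ge> max (max 0 N1) (max N2 N3)" "y \<ge> max (max 0 N1) (max N2 N3)"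
    let ?A = "\<lambda>(i, j). claim_event i j x y"
    have sum: "(1 - \<epsilon>) * main_sum m x y \<le> (\<Sum>p\<in>?I. prob (?A p))"
      unfolding main_sum_def sum_distrib_left
    proof (rule sum_mono)
      fix p assume "p \<in> ?I"
      then obtain i j where p: "p = (i, j)" "i \<ge> 1" "j \<ge> 1" by auto
      have "(1 - \<epsilon>) * (coef i j * mean_tail i j x y) \<le> prob (claim_event i j x y)"
        using N3[of x y i j] xy p unfolding left_diff_distrib by linarith
      then show "(1 - \<epsilon>) * (case p of (i, j) \<Rightarrow> coef i j * mean_tail i j x y) \<le> prob (?A p)"
        by (simp add: p)
    qed
    have pair: "prob (?A p \<inter> ?A p') \<le> \<eta> * (K * (Fb x * Gb y))" if pp: "p \<in> ?I" "p' \<in> ?I" "p \<noteq> p'" for p p'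
    proof -
      obtain i j where p: "p = (i, j)" "i \<in> {1..m}" "j \<in> {1..m}" using pp by auto
      obtain k l where p': "p' = (k, l)" "k \<in> {1..m}" "l \<in> {1..m}" using pp by auto
      have sub: "claim_event i j x y \<inter> claim_event k l x y \<subseteq>
        {\<omega>\<in>space M. (X i \<omega> > x \<and> Y j \<omega> > y) \<and> (X k \<omega> > x \<and> Y l \<omega> > y)}"
        using claim_event_subset[of x y i j] claim_event_subset[of x y k l] xy by auto
      show ?thesis
      proof (cases "i = k")
        case False
        have "prob (?A p \<inter> ?A p') \<le> prob {\<omega>\<in>space M. X i \<omega> > x \<and> X k \<omega> > x \<and> Y j \<omega> > y}"
          using sub by (intro finite_measure_mono) (auto simp: p(1) p'(1))
        also have "\<dots> \<le> \<eta> * tail_XY k j x y" using xy by (intro N1 p p' False) auto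
        also have "\<dots> \<le> \<eta> * (K * (Fb x * Gb y))" using p p' \<eta> by (intro mult_left_mono K) auto
        finally show ?thesis .
      next
        case True
        then have "j \<noteq> l" using pp p p' by auto
        have "prob (?A p \<inter> ?A p') \<le> prob {\<omega>\<in>space M. Y j \<omega> > y \<and> X i \<omega> > x \<and> Y l \<omega> > y}"
          using sub by (intro finite_measure_mono) (auto simp: p(1) p'(1))
        also have "\<dots> \<le> \<eta> * tail_XY i l x y" using xy by (intro N2 p p' \<open>j \<noteq> l\<close>) auto
        also have "\<dots> \<le> \<eta> * (K * (Fb x * Gb y))" using p p' \<eta> by (intro mult_left_mono K) auto
        finally show ?thesis .
      qed
    qed
    have nn: "\<eta> * (K * (Fb x * Gb y)) \<ge> 0" using \<eta> K(1) FbGb_bounds(1)[of x y] by simp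
    have "(\<Sum>p\<in>?I. \<Sum>p'\<in>?I - {p}. prob (?A p \<inter> ?A p')) \<le> (\<Sum>p\<in>?I. \<Sum>p'\<in>?I - {p}. \<eta> * (K * (Fb x * Gb y)))"
      by (intro sum_mono pair) auto
    also have "\<dots> \<le> (\<Sum>p\<in>?I. \<Sum>p'\<in>?I. \<eta> * (K * (Fb x * Gb y)))"
      by (intro sum_mono sum_mono2 nn) auto
    also have "\<dots> = \<epsilon> * (Fb x * Gb y)"
      using m K(1) by (simp add: \<eta>_def)
    finally have dbl: "(\<Sum>p\<in>?I. \<Sum>p'\<in>?I - {p}. prob (?A p \<inter> ?A p')) \<le> \<epsilon> * (Fb x * Gb y)" .
    have "(\<Sum>p\<in>?I. prob (?A p)) - (\<Sum>p\<in>?I. \<Sum>p'\<in>?I - {p}. prob (?A p \<inter> ?A p')) \<le> prob (\<Union>p\<in>?I. ?A p)"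
      by (rule Bonferroni_lower) auto
    then show "(1 - \<epsilon>) * main_sum m x y - \<epsilon> * (Fb x * Gb y) \<le> prob (\<Union>p\<in>?I. ?A p)"
      using sum dbl by linarith
  qed
qed

text \<open>This covers the case of exactly \<open>n\<close> claims up to \<open>T\<close>, but does
  not ask that the next arrival comes after \<open>T\<close>. Thus the arrival part is the single
  event with geometrically decaying probability.\<close>

definition "late_event n x y = {\<omega>\<in>space M. \<tau> n \<omega> \<le> T \<and>
  (\<Sum>i\<in>{1..n}. X i \<omega> * exp (- r * \<tau> i \<omega>)) > x \<and> (\<Sum>j\<in>{1..n}. Y j \<omega> * exp (- r * \<tau> j \<omega>)) > y}"

lemma late_event_measurable [measurable]: "late_event n x y \<in> events"
  unfolding late_event_def by measurable

lemma late_event_bound: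
  "\<exists>K>0. \<exists>q \<rho>. 0 < \<rho> \<and> \<rho> < 1 \<and> (\<forall>n\<ge>1. \<forall>x\<ge>0. \<forall>y\<ge>0.
    prob (late_event n x y) \<le> K * (real n ^ q * \<rho> ^ n) * (Fb x * Gb y))"
proof -
  obtain K q where K0: "K > 0" and K1: "\<forall>i\<ge>1. \<forall>j\<ge>1. \<forall>n\<ge>1. \<forall>x\<ge>0. \<forall>y\<ge>0.
     tail_XY i j (x / real n) (y / real n) \<le> K * real n ^ q * (Fb x * Gb y)"
    using tail_XY_dilation_bound by blast
  note K = K0 K1[rule_format]
  obtain \<rho> where \<rho>: "0 < \<rho>" "\<rho> < 1" "\<And>n. prob {\<omega>\<in>space M. \<tau> n \<omega> \<le> T} \<le> exp T * \<rho> ^ n"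
    using arrival_geometric by blast
  \<comment> \<open>Some claim of each line exceeds its level divided by \<open>n\<close>; the two
    extra powers of \<open>n\<close> count the pairs of such claims.\<close>
  have "prob (late_event n x y) \<le> (K * exp T) * (real n ^ (q + 2) * \<rho> ^ n) * (Fb x * Gb y)"
    if n: "n \<ge> 1" and xy: "x \<ge> 0" "y \<ge> 0" for n x y
  proof -
    let ?I = "{1..n} \<times> {1..n}"
    let ?A = "\<lambda>(i, j). {\<omega>\<in>space M. X i \<omega> > x / n \<and> Y j \<omega> > y / n}"
    let ?B = "{\<omega>\<in>space M. \<tau> n \<omega> \<le> T}"
    have sub: "late_event n x y \<subseteq> (\<Union>p\<in>?I. ?A p \<inter> ?B)"
    proof
      fix \<omega> assume "\<omega> \<in> late_event n x y"
      then have \<omega>: "\<omega> \<in> space M" "\<tau> n \<omega> \<le> T" "(\<Sum>i\<in>{1..n}. X i \<omega> * exp (- r * \<tau> i \<omega>)) > x"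
        "(\<Sum>j\<in>{1..n}. Y j \<omega> * exp (- r * \<tau> j \<omega>)) > y" by (auto simp: late_event_def)
      have le: "z * exp (- r * \<tau> i \<omega>) \<le> z" if "z \<ge> 0" for z i
        using mult_left_mono[of "exp (- r * \<tau> i \<omega>)" 1 z] that r_nonneg \<tau>_nonneg[OF \<omega>(1), of i] by simp
      obtain i where i: "i \<in> {1..n}" "X i \<omega> * exp (- r * \<tau> i \<omega>) > x / n" using sum_gt_obtains[OF \<omega>(3) n] .
      obtain j where j: "j \<in> {1..n}" "Y j \<omega> * exp (- r * \<tau> j \<omega>) > y / n" using sum_gt_obtains[OF \<omega>(4) n] .
      have "X i \<omega> > x / n" "Y j \<omega> > y / n"
        using i j le[of "X i \<omega>" i] le[of "Y j \<omega>" j] X_nonneg[of i \<omega>] Y_nonneg[of j \<omega>] \<omega>(1) by auto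
      then have "\<omega> \<in> ?A (i, j) \<inter> ?B" "(i, j) \<in> ?I" using \<omega> i j by auto
      then show "\<omega> \<in> (\<Union>p\<in>?I. ?A p \<inter> ?B)" by blast
    qed
    have ev: "?A p \<in> events" for p by (auto split: prod.split)
    have "prob (late_event n x y) \<le> prob (\<Union>p\<in>?I. ?A p \<inter> ?B)"
      using ev by (intro finite_measure_mono sub sets.finite_UN) auto
    also have "\<dots> \<le> (\<Sum>p\<in>?I. prob (?A p \<inter> ?B))"
      using ev by (intro finite_measure_subadditive_finite) auto
    also have "\<dots> \<le> (\<Sum>p\<in>?I. (K * real n ^ q * (Fb x * Gb y)) * (exp T * \<rho> ^ n))"
    proof (rule sum_mono)
      fix p assume "p \<in> ?I"
      then obtain i j where p: "p = (i, j)" "i \<ge> 1" "j \<ge> 1" by auto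
      have [measurable]: "X i \<in> borel_measurable claim_alg" "Y j \<in> borel_measurable claim_alg" "\<tau> n \<in> borel_measurable arrival_alg"
        using p X_claim_alg Y_claim_alg arrival_arrival_alg by auto
      have "{\<omega>\<in>space claim_alg. X i \<omega> > x / n \<and> Y j \<omega> > y / n} \<in> sets claim_alg" by measurable
      moreover have "{\<omega>\<in>space arrival_alg. \<tau> n \<omega> \<le> T} \<in> sets arrival_alg" by measurable
      ultimately have "prob (?A p \<inter> ?B) = tail_XY i j (x / n) (y / n) * prob ?B"
        by (simp add: p(1) indep_claim_arrival tail_XY_def)
      also have "\<dots> \<le> (K * real n ^ q * (Fb x * Gb y)) * (exp T * \<rho> ^ n)"
        using p n xy K(1) FbGb_bounds(1)[of x y] by (intro mult_mono K \<rho>) auto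
      finally show "prob (?A p \<inter> ?B) \<le> (K * real n ^ q * (Fb x * Gb y)) * (exp T * \<rho> ^ n)" .
    qed
    also have "\<dots> = (K * exp T) * (real n ^ (q + 2) * \<rho> ^ n) * (Fb x * Gb y)"
      by (simp add: power_add power2_eq_square mult_ac)
    finally show ?thesis .
  qed
  moreover have "K * exp T > 0" using K by simp
  ultimately show ?thesis using \<rho>(1,2) by blast
qed

text \<open>Once \<open>Fb x * Gb y\<close> is factored out, what remains is the tail of a
  convergent numerical series. Hence \<open>m\<close> can be fixed before \<open>x\<close> and
  \<open>y\<close>.\<close>

lemma late_events_small:
  assumes e: "\<epsilon> > 0"
  shows "\<exists>m0. \<forall>m\<ge>m0. \<forall>x\<ge>0. \<forall>y\<ge>0. prob (\<Union>n. late_event (n + Suc m) x y) \<le> \<epsilon> * (Fb x * Gb y)"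
proof -
  obtain K q \<rho> where K: "K > 0" and \<rho>: "0 < \<rho>" "\<rho> < 1"
    and "\<forall>n\<ge>1. \<forall>x\<ge>0. \<forall>y\<ge>0. prob (late_event n x y) \<le> K * (real n ^ q * \<rho> ^ n) * (Fb x * Gb y)"
    using late_event_bound by blast
  note b = this(4)[rule_format]
  let ?f = "\<lambda>n. real n ^ q * \<rho> ^ n"
  have sm: "summable ?f" using \<rho> by (intro summable_power_times_geometric) auto
  have "e / K > 0" if "e > 0" for e using that K by simp
  then obtain m0 where m0: "\<And>m. m \<ge> m0 \<Longrightarrow> norm (\<Sum>i. ?f (i + m)) < \<epsilon> / K"
    using suminf_exist_split[OF _ sm, of "\<epsilon> / K"] e by blast
  show ?thesis
  proof (intro exI[of _ m0] allI impI)
    fix m x y assume m: "m \<ge> m0" and xy: "x \<ge> (0::real)" "y \<ge> (0::real)"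
    have s1: "summable (\<lambda>n. ?f (n + Suc m))" using sm by (subst summable_iff_shift)
    have s2: "summable (\<lambda>n. K * ?f (n + Suc m) * (Fb x * Gb y))"
      by (intro summable_mult summable_mult2 s1)
    have b': "prob (late_event (n + Suc m) x y) \<le> K * ?f (n + Suc m) * (Fb x * Gb y)" for n
      using xy by (intro b) auto
    have s3: "summable (\<lambda>n. prob (late_event (n + Suc m) x y))"
      using b' by (intro summable_comparison_test'[OF s2, of 0]) auto
    have "prob (\<Union>n. late_event (n + Suc m) x y) \<le> (\<Sum>n. prob (late_event (n + Suc m) x y))"
      by (intro finite_measure_subadditive_countably s3) auto
    also have "\<dots> \<le> (\<Sum>n. K * ?f (n + Suc m) * (Fb x * Gb y))"
      by (intro suminf_le b' s3 s2)
    also have "\<dots> = K * (\<Sum>n. ?f (n + Suc m)) * (Fb x * Gb y)"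
      using s1 by (simp add: suminf_mult suminf_mult2[symmetric] summable_mult del: add_Suc_right)
    also have "(\<Sum>n. ?f (n + Suc m)) \<le> \<epsilon> / K"
      using m0[of "Suc m"] m by (simp del: add_Suc_right add: abs_less_iff)
    finally show "prob (\<Union>n. late_event (n + Suc m) x y) \<le> \<epsilon> * (Fb x * Gb y)"
      using K FbGb_bounds(1)[of x y] by (simp add: mult_left_mono mult_right_mono)
  qed
qed

end

section \<open>The renewal measure\<close>

text \<open>Compares a series with a finite partial sum through a summable majorant off
  \<open>P\<close>. Writing series as integrals over the counting measure treats single and double
  sums alike.\<close>

lemma enn2real_nn_integral_count_space_bounds:
  fixes f g :: "'i \<Rightarrow> real"
  assumes f: "\<And>p. f p \<ge> 0" and g: "\<And>p. g p \<ge> 0" and c: "c \<ge> 0" and B: "B \<ge> 0" and P: "finite P"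
    and le: "\<And>p. p \<notin> P \<Longrightarrow> f p \<le> c * g p"
    and intg: "(\<integral>\<^sup>+p. ennreal (g p) \<partial>count_space UNIV) \<le> ennreal B"
  shows "sum f P \<le> enn2real (\<integral>\<^sup>+p. ennreal (f p) \<partial>count_space UNIV)"
    and "enn2real (\<integral>\<^sup>+p. ennreal (f p) \<partial>count_space UNIV) \<le> sum f P + c * B"
proof -
  let ?R = "\<integral>\<^sup>+p. ennreal (f p) * indicator (- P) p \<partial>count_space UNIV"
  have "(\<integral>\<^sup>+p. ennreal (f p) \<partial>count_space UNIV)
    = (\<integral>\<^sup>+p. ennreal (f p) * indicator P p + ennreal (f p) * indicator (- P) p \<partial>count_space UNIV)"
    by (intro nn_integral_cong) (auto simp: indicator_def)
  also have "\<dots> = (\<integral>\<^sup>+p. ennreal (f p) * indicator P p \<partial>count_space UNIV) + ?R"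
    by (intro nn_integral_add) auto
  also have "(\<integral>\<^sup>+p. ennreal (f p) * indicator P p \<partial>count_space UNIV) = (\<Sum>p\<in>P. ennreal (f p))"
    using P by (subst nn_integral_count_space'[of P]) (auto simp: indicator_def)
  also have "\<dots> = ennreal (sum f P)" using f by simp
  finally have eq: "(\<integral>\<^sup>+p. ennreal (f p) \<partial>count_space UNIV) = ennreal (sum f P) + ?R" .
  have "?R \<le> (\<integral>\<^sup>+p. ennreal c * ennreal (g p) \<partial>count_space UNIV)"
    using le c g by (intro nn_integral_mono) (auto simp: indicator_def ennreal_mult[symmetric] intro!: ennreal_leI)
  also have "\<dots> = ennreal c * (\<integral>\<^sup>+p. ennreal (g p) \<partial>count_space UNIV)" by (intro nn_integral_cmult) auto
  also have "\<dots> \<le> ennreal c * ennreal B" using intg by (intro mult_left_mono) auto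
  also have "\<dots> = ennreal (c * B)" using c B by (simp add: ennreal_mult)
  finally have R: "?R \<le> ennreal (c * B)" .
  have sP: "sum f P \<ge> 0" using f by (intro sum_nonneg)
  have cB: "c * B \<ge> 0" using c B by simp
  have up: "ennreal (sum f P) + ?R \<le> ennreal (sum f P + c * B)"
    using R sP cB by (simp add: ennreal_plus)
  show "enn2real (\<integral>\<^sup>+p. ennreal (f p) \<partial>count_space UNIV) \<le> sum f P + c * B"
    unfolding eq using up sP cB by (intro enn2real_leI) auto
  have "ennreal (sum f P) \<le> ennreal (sum f P) + ?R" by simp
  \<comment> \<open>Finiteness matters even for the lower bound, because \<open>enn2real\<close>
    sends infinity to 0.\<close>
  moreover have "ennreal (sum f P) + ?R < \<top>" using up ennreal_less_top le_less_trans by blast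
  ultimately have "enn2real (ennreal (sum f P)) \<le> enn2real (ennreal (sum f P) + ?R)" by (rule enn2real_mono)
  then show "sum f P \<le> enn2real (\<integral>\<^sup>+p. ennreal (f p) \<partial>count_space UNIV)"
    unfolding eq using sP by simp
qed

lemma nn_integral_geometric_nat:
  fixes \<sigma> :: real
  assumes "0 < \<sigma>" "\<sigma> < 1"
  shows "(\<integral>\<^sup>+i. ennreal (\<sigma> ^ i) \<partial>count_space (UNIV :: nat set)) = ennreal (1 / (1 - \<sigma>))"
proof -
  have "(\<integral>\<^sup>+i. ennreal (\<sigma> ^ i) \<partial>count_space (UNIV :: nat set)) = (\<Sum>i. ennreal (\<sigma> ^ i))"
    by (rule nn_integral_count_space_nat)
  also have "\<dots> = ennreal (\<Sum>i. \<sigma> ^ i)"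
    using assms by (intro suminf_ennreal2 summable_geometric) auto
  finally show ?thesis using assms by (simp add: suminf_geometric)
qed

context renewal_risk
begin

text \<open>The renewal measure is the image of counting measure times \<open>M\<close> under the
  map from index and outcome to arrival time. Identifying it with this genuine measure settles
  countable additivity for \<open>measure_of\<close> and reduces integration to Tonelli.\<close>

lemma nn_integral_renewal_measure:
  assumes "f \<in> borel_measurable borel"
  shows "(\<integral>\<^sup>+t. f t \<partial>renewal_measure M \<theta>) = (\<Sum>i. \<integral>\<^sup>+\<omega>. f (\<tau> (Suc i) \<omega>) \<partial>M)"
proof -
  let ?N = "distr (count_space (UNIV :: nat set) \<Otimes>\<^sub>M M) borel (\<lambda>(i, \<omega>). \<tau> (Suc i) \<omega>)"
  have g [measurable]: "(\<lambda>(i, \<omega>). \<tau> (Suc i) \<omega>) \<in> borel_measurable (count_space (UNIV :: nat set) \<Otimes>\<^sub>M M)"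
    by (rule measurable_pair_measure_countable1) auto
  have int: "(\<integral>\<^sup>+t. f t \<partial>?N) = (\<Sum>i. \<integral>\<^sup>+\<omega>. f (\<tau> (Suc i) \<omega>) \<partial>M)" if f [measurable]: "f \<in> borel_measurable borel" for f
  proof -
    have "(\<integral>\<^sup>+t. f t \<partial>?N) = (\<integral>\<^sup>+p. f ((\<lambda>(i, \<omega>). \<tau> (Suc i) \<omega>) p) \<partial>(count_space (UNIV :: nat set) \<Otimes>\<^sub>M M))"
      by (rule nn_integral_distr) measurable
    also have "\<dots> = (\<integral>\<^sup>+i. \<integral>\<^sup>+\<omega>. f ((\<lambda>(i, \<omega>). \<tau> (Suc i) \<omega>) (i, \<omega>)) \<partial>M \<partial>count_space UNIV)"
      by (rule nn_integral_fst[symmetric]) measurable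
    also have "\<dots> = (\<Sum>i. \<integral>\<^sup>+\<omega>. f (\<tau> (Suc i) \<omega>) \<partial>M)"
      by (simp add: nn_integral_count_space_nat)
    finally show ?thesis .
  qed
  have em: "emeasure ?N A = (\<integral>\<^sup>+\<omega>. (\<Sum>i. indicator A (\<tau> (Suc i) \<omega>)) \<partial>M)" if A [measurable]: "A \<in> sets borel" for A
  proof -
    have "emeasure ?N A = (\<integral>\<^sup>+t. indicator A t \<partial>?N)" using A by simp
    also have "\<dots> = (\<Sum>i. \<integral>\<^sup>+\<omega>. indicator A (\<tau> (Suc i) \<omega>) \<partial>M)" by (rule int) measurable
    also have "\<dots> = (\<integral>\<^sup>+\<omega>. (\<Sum>i. indicator A (\<tau> (Suc i) \<omega>)) \<partial>M)"
      by (rule nn_integral_suminf[symmetric]) measurable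
    finally show ?thesis .
  qed
  have "renewal_measure M \<theta> = measure_of UNIV (sets borel) (emeasure ?N)"
    unfolding renewal_measure_def
  proof (rule measure_of_eq)
    fix A :: "real set" assume "A \<in> sigma_sets UNIV (sets borel)"
    then have "A \<in> sets borel" using sets.sigma_sets_eq[of "borel :: real measure"] by simp
    then show "(\<integral>\<^sup>+\<omega>. (\<Sum>i. indicator A (\<tau> (Suc i) \<omega>)) \<partial>M) = emeasure ?N A" by (rule em[symmetric])
  qed simp
  also have "\<dots> = ?N" using measure_of_of_measure[of ?N] by simp
  finally have "renewal_measure M \<theta> = ?N" .
  then show ?thesis using int[OF assms] by simp
qed

text \<open>On the left \<open>\<omega>'\<close> acts as an independent copy. The sum
  \<open>D\<close> of the \<open>k\<close> waiting times after the \<open>i\<close>-th arrival can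
  take its place, so both arguments of \<open>h\<close> are read off one path.\<close>

lemma renewal_increment:
  assumes h [measurable]: "h \<in> borel_measurable (borel \<Otimes>\<^sub>M borel)"
  shows "(\<integral>\<^sup>+\<omega>. \<integral>\<^sup>+\<omega>'. h (\<tau> k \<omega>', \<tau> i \<omega>) \<partial>M \<partial>M) = (\<integral>\<^sup>+\<omega>. h (\<tau> (i + k) \<omega> - \<tau> i \<omega>, \<tau> i \<omega>) \<partial>M)"
proof -
  define D where "D = (\<lambda>\<omega>. \<Sum>l\<in>{i+1..i+k}. \<theta> l \<omega>)"
  have D: "D \<omega> = \<tau> (i + k) \<omega> - \<tau> i \<omega>" for \<omega>
  proof -
    have "{1..i + k} = {1..i} \<union> {i+1..i+k}" by auto
    then have "\<tau> (i + k) \<omega> = \<tau> i \<omega> + D \<omega>"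
      unfolding arrival_def D_def by (simp add: sum.union_disjoint)
    then show ?thesis by simp
  qed
  have [measurable]: "D \<in> borel_measurable M" unfolding D_def by measurable
  have "indep_var borel D borel (\<lambda>\<omega>. \<Sum>l\<in>{1..i}. \<theta> l \<omega>)"
    unfolding D_def by (rule indep_vars_sum_disjoint[OF theta_indep]) auto
  then have ind: "indep_var borel D borel (\<tau> i)" by (simp add: arrival_def[abs_def])
  have dD: "distr M borel D = distr M borel (\<tau> k)"
    unfolding D_def arrival_def[abs_def]
    by (rule distr_sum_iid_cong[OF theta_indep]) (auto intro: theta_ident)
  interpret D: prob_space "distr M borel (\<tau> k)" by (rule prob_space_distr) measurable
  interpret t: prob_space "distr M borel (\<tau> i)" by (rule prob_space_distr) measurable
  interpret p: pair_prob_space "distr M borel (\<tau> k)" "distr M borel (\<tau> i)" ..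
  have "(\<integral>\<^sup>+\<omega>. h (D \<omega>, \<tau> i \<omega>) \<partial>M) = (\<integral>\<^sup>+p. h p \<partial>distr M (borel \<Otimes>\<^sub>M borel) (\<lambda>\<omega>. (D \<omega>, \<tau> i \<omega>)))"
    by (subst nn_integral_distr) auto
  also have "\<dots> = (\<integral>\<^sup>+p. h p \<partial>(distr M borel (\<tau> k) \<Otimes>\<^sub>M distr M borel (\<tau> i)))"
    using ind by (simp add: indep_var_distribution_eq dD)
  also have "\<dots> = (\<integral>\<^sup>+t. \<integral>\<^sup>+s. h (s, t) \<partial>distr M borel (\<tau> k) \<partial>distr M borel (\<tau> i))"
    by (rule p.nn_integral_snd[symmetric]) measurable
  also have "\<dots> = (\<integral>\<^sup>+t. \<integral>\<^sup>+\<omega>'. h (\<tau> k \<omega>', t) \<partial>M \<partial>distr M borel (\<tau> i))"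
    by (intro nn_integral_cong nn_integral_distr) measurable
  also have "\<dots> = (\<integral>\<^sup>+\<omega>. \<integral>\<^sup>+\<omega>'. h (\<tau> k \<omega>', \<tau> i \<omega>) \<partial>M \<partial>M)"
    by (intro nn_integral_distr) measurable
  finally show ?thesis by (simp add: D)
qed

lemma nn_integral_mean_tail:
  "(\<integral>\<^sup>+\<omega>. ennreal (if \<tau> i \<omega> \<le> T \<and> \<tau> j \<omega> \<le> T
      then Fb (x * exp (r * \<tau> i \<omega>)) * Gb (y * exp (r * \<tau> j \<omega>)) else 0) \<partial>M) = ennreal (mean_tail i j x y)"
  unfolding mean_tail_def by (intro nn_integral_eq_integral mean_tail_integrable AE_I2) (auto simp: FbGb_bounds)

text \<open>The earlier claim has number \<open>Suc i\<close> and the later one comes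
  \<open>Suc k\<close> claims after it. The two summands say which line has the later claim, and
  correspond to the two terms in the double integral of \<open>Delta\<close>.\<close>

definition "off_diag x y = (\<lambda>(i, k). mean_tail (Suc i + Suc k) (Suc i) x y + mean_tail (Suc i) (Suc i + Suc k) x y)"

lemma Delta_eq:
  "Delta (renewal_measure M \<theta>) F G C r x y T =
    enn2real (\<integral>\<^sup>+p. ennreal (off_diag x y p) \<partial>count_space UNIV)
    + C * enn2real (\<integral>\<^sup>+i. ennreal (mean_tail (Suc i) (Suc i) x y) \<partial>count_space UNIV)"
proof -
  let ?lam = "renewal_measure M \<theta>"
  define h where "h = (\<lambda>(s, t). indicator {(s, t). 0 \<le> s \<and> 0 \<le> t \<and> s + t \<le> T} (s, t) *
        ennreal (Fb (x * exp (r * (t + s))) * Gb (y * exp (r * t))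
               + Fb (x * exp (r * t)) * Gb (y * exp (r * (t + s)))))"
  have h [measurable]: "h \<in> borel_measurable (borel \<Otimes>\<^sub>M borel)"
  proof -
    have "{p\<in>space (borel \<Otimes>\<^sub>M borel :: (real \<times> real) measure). 0 \<le> fst p \<and> 0 \<le> snd p \<and> fst p + snd p \<le> T} \<in> sets (borel \<Otimes>\<^sub>M borel)"
      by measurable
    moreover have "{(s, t). 0 \<le> s \<and> 0 \<le> t \<and> s + t \<le> T} = {p\<in>space (borel \<Otimes>\<^sub>M borel :: (real \<times> real) measure). 0 \<le> fst p \<and> 0 \<le> snd p \<and> fst p + snd p \<le> T}"
      by (auto simp: space_pair_measure)
    ultimately have [measurable]: "{(s, t). 0 \<le> s \<and> 0 \<le> t \<and> s + t \<le> T} \<in> sets (borel \<Otimes>\<^sub>M borel :: (real \<times> real) measure)" by simp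
    show ?thesis unfolding h_def by measurable
  qed
  have inner: "(\<integral>\<^sup>+s. h (s, t) \<partial>?lam) = (\<Sum>k. \<integral>\<^sup>+\<omega>. h (\<tau> (Suc k) \<omega>, t) \<partial>M)" for t
    by (rule nn_integral_renewal_measure) measurable
  have summand: "(\<integral>\<^sup>+\<omega>. \<integral>\<^sup>+\<omega>'. h (\<tau> (Suc k) \<omega>', \<tau> (Suc i) \<omega>) \<partial>M \<partial>M) = ennreal (off_diag x y (i, k))" for i k
  proof -
    let ?f = "\<lambda>i j \<omega>. if \<tau> i \<omega> \<le> T \<and> \<tau> j \<omega> \<le> T
      then Fb (x * exp (r * \<tau> i \<omega>)) * Gb (y * exp (r * \<tau> j \<omega>)) else 0"
    have "(\<integral>\<^sup>+\<omega>. \<integral>\<^sup>+\<omega>'. h (\<tau> (Suc k) \<omega>', \<tau> (Suc i) \<omega>) \<partial>M \<partial>M)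
      = (\<integral>\<^sup>+\<omega>. h (\<tau> (Suc i + Suc k) \<omega> - \<tau> (Suc i) \<omega>, \<tau> (Suc i) \<omega>) \<partial>M)"
      by (rule renewal_increment[OF h])
    also have "\<dots> = (\<integral>\<^sup>+\<omega>. ennreal (?f (Suc i + Suc k) (Suc i) \<omega>) + ennreal (?f (Suc i) (Suc i + Suc k) \<omega>) \<partial>M)"
    proof (intro nn_integral_cong)
      fix \<omega> assume \<omega>: "\<omega> \<in> space M"
      \<comment> \<open>Since arrivals are ordered and nonnegative, the triangle
        \<open>s + t \<le> T\<close> becomes the condition that the later claim arrives by
        \<open>T\<close>.\<close>
      have "\<tau> (Suc i) \<omega> \<ge> 0" "\<tau> (Suc i) \<omega> \<le> \<tau> (Suc i + Suc k) \<omega>"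
        using \<tau>_nonneg[OF \<omega>] \<tau>_le_iff[OF \<omega>] by (auto simp del: add_Suc add_Suc_right)
      then show "h (\<tau> (Suc i + Suc k) \<omega> - \<tau> (Suc i) \<omega>, \<tau> (Suc i) \<omega>)
        = ennreal (?f (Suc i + Suc k) (Suc i) \<omega>) + ennreal (?f (Suc i) (Suc i + Suc k) \<omega>)"
        by (auto simp: h_def indicator_def FbGb_bounds ennreal_plus simp del: add_Suc add_Suc_right)
    qed
    also have "\<dots> = ennreal (mean_tail (Suc i + Suc k) (Suc i) x y) + ennreal (mean_tail (Suc i) (Suc i + Suc k) x y)"
      unfolding nn_integral_mean_tail[symmetric] by (rule nn_integral_add) measurable
    finally show ?thesis by (simp add: off_diag_def mean_tail_nonneg ennreal_plus del: add_Suc add_Suc_right)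
  qed
  have "(\<integral>\<^sup>+t. \<integral>\<^sup>+s. h (s, t) \<partial>?lam \<partial>?lam) = (\<integral>\<^sup>+t. (\<Sum>k. \<integral>\<^sup>+\<omega>. h (\<tau> (Suc k) \<omega>, t) \<partial>M) \<partial>?lam)"
    by (simp only: inner)
  also have "\<dots> = (\<Sum>i. \<integral>\<^sup>+\<omega>. (\<Sum>k. \<integral>\<^sup>+\<omega>'. h (\<tau> (Suc k) \<omega>', \<tau> (Suc i) \<omega>) \<partial>M) \<partial>M)"
    by (rule nn_integral_renewal_measure) measurable
  also have "\<dots> = (\<Sum>i. \<Sum>k. \<integral>\<^sup>+\<omega>. \<integral>\<^sup>+\<omega>'. h (\<tau> (Suc k) \<omega>', \<tau> (Suc i) \<omega>) \<partial>M \<partial>M)"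
    by (intro arg_cong[where f=suminf] ext nn_integral_suminf) measurable
  also have "\<dots> = (\<integral>\<^sup>+i. \<integral>\<^sup>+k. ennreal (off_diag x y (i, k)) \<partial>count_space UNIV \<partial>count_space UNIV)"
    by (simp only: summand nn_integral_count_space_nat)
  also have "\<dots> = (\<integral>\<^sup>+p. ennreal (off_diag x y p) \<partial>count_space UNIV)"
    by (rule nn_integral_fst_count_space)
  finally have 1: "(\<integral>\<^sup>+t. \<integral>\<^sup>+s. h (s, t) \<partial>?lam \<partial>?lam) = (\<integral>\<^sup>+p. ennreal (off_diag x y p) \<partial>count_space UNIV)" .
  have "(\<integral>\<^sup>+t. indicator {0..T} t * ennreal (Fb (x * exp (r * t)) * Gb (y * exp (r * t))) \<partial>?lam)
    = (\<Sum>i. \<integral>\<^sup>+\<omega>. indicator {0..T} (\<tau> (Suc i) \<omega>) * ennreal (Fb (x * exp (r * \<tau> (Suc i) \<omega>)) * Gb (y * exp (r * \<tau> (Suc i) \<omega>))) \<partial>M)"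
    by (rule nn_integral_renewal_measure) measurable
  also have "\<dots> = (\<Sum>i. ennreal (mean_tail (Suc i) (Suc i) x y))"
    unfolding nn_integral_mean_tail[symmetric]
    by (intro arg_cong[where f=suminf] ext nn_integral_cong) (use \<tau>_nonneg in \<open>auto simp: indicator_def\<close>)
  finally have 2: "(\<integral>\<^sup>+t. indicator {0..T} t * ennreal (Fb (x * exp (r * t)) * Gb (y * exp (r * t))) \<partial>?lam)
    = (\<integral>\<^sup>+i. ennreal (mean_tail (Suc i) (Suc i) x y) \<partial>count_space UNIV)"
    by (simp only: nn_integral_count_space_nat)
  show ?thesis unfolding Delta_def 2 using 1 by (simp add: h_def)
qed

text \<open>The index square splits into the two open triangles, reparametrised by the earlier index
  and the gap, and the diagonal, the only place where \<open>coef\<close> is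
  \<open>C\<close>.\<close>

lemma main_sum_eq:
  "main_sum m x y = sum (off_diag x y) {(i, k). Suc i + Suc k \<le> m} + C * (\<Sum>i<m. mean_tail (Suc i) (Suc i) x y)"
proof -
  let ?f = "\<lambda>(i, j). coef i j * mean_tail i j x y"
  let ?P = "{(i, k). Suc i + Suc k \<le> m}"
  let ?L = "(\<lambda>(i, k). (Suc i + Suc k, Suc i)) ` ?P" and ?U = "(\<lambda>(i, k). (Suc i, Suc i + Suc k)) ` ?P"
  let ?D = "(\<lambda>i. (Suc i, Suc i)) ` {..<m}"
  have "?P \<subseteq> {..m} \<times> {..m}" by auto
  then have fin: "finite ?P" by (rule finite_subset) auto
  have split: "{1..m} \<times> {1..m} = ?L \<union> ?U \<union> ?D"
  proof (intro equalityI subsetI)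
    fix p assume "p \<in> {1..m} \<times> {1..m}"
    then obtain i j where p: "p = (i, j)" "1 \<le> i" "i \<le> m" "1 \<le> j" "j \<le> m" by auto
    consider "i < j" | "j < i" | "i = j" by linarith
    then show "p \<in> ?L \<union> ?U \<union> ?D"
    proof cases
      case 1
      then have "p = (\<lambda>(i, k). (Suc i, Suc i + Suc k)) (i - 1, j - i - 1)" "(i - 1, j - i - 1) \<in> ?P" using p by auto
      then show ?thesis by blast
    next
      case 2
      then have "p = (\<lambda>(i, k). (Suc i + Suc k, Suc i)) (j - 1, i - j - 1)" "(j - 1, i - j - 1) \<in> ?P" using p by auto
      then show ?thesis by blast
    next
      case 3
      then have "p = (\<lambda>i. (Suc i, Suc i)) (i - 1)" "i - 1 \<in> {..<m}" using p by auto
      then show ?thesis by blast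
    qed
  qed auto
  have "main_sum m x y = sum ?f (?L \<union> ?U) + sum ?f ?D"
    unfolding main_sum_def split using fin by (intro sum.union_disjoint) auto
  also have "sum ?f (?L \<union> ?U) = sum ?f ?L + sum ?f ?U"
    using fin by (intro sum.union_disjoint) auto
  also have "sum ?f ?L = (\<Sum>(i, k)\<in>?P. mean_tail (Suc i + Suc k) (Suc i) x y)"
    by (subst sum.reindex) (auto simp: inj_on_def coef_def intro!: sum.cong)
  also have "sum ?f ?U = (\<Sum>(i, k)\<in>?P. mean_tail (Suc i) (Suc i + Suc k) x y)"
    by (subst sum.reindex) (auto simp: inj_on_def coef_def intro!: sum.cong)
  also have "sum ?f ?D = C * (\<Sum>i<m. mean_tail (Suc i) (Suc i) x y)"
    by (subst sum.reindex) (auto simp: inj_on_def coef_def sum_distrib_left intro!: sum.cong)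
  also have "(\<Sum>(i, k)\<in>?P. mean_tail (Suc i + Suc k) (Suc i) x y) + (\<Sum>(i, k)\<in>?P. mean_tail (Suc i) (Suc i + Suc k) x y)
    = sum (off_diag x y) ?P"
    unfolding sum.distrib[symmetric] by (intro sum.cong) (auto simp: off_diag_def)
  finally show ?thesis .
qed

lemma Delta_main_sum:
  "\<exists>c\<ge>0. \<exists>\<sigma>. 0 < \<sigma> \<and> \<sigma> < 1 \<and> (\<forall>m. \<forall>x\<ge>0. \<forall>y\<ge>0.
    main_sum m x y \<le> Delta (renewal_measure M \<theta>) F G C r x y T \<and>
    Delta (renewal_measure M \<theta>) F G C r x y T \<le> main_sum m x y + c * \<sigma> ^ m * (Fb x * Gb y))"
proof -
  obtain \<rho> where \<rho>: "0 < \<rho>" "\<rho> < 1" and "\<forall>n. prob {\<omega>\<in>space M. \<tau> n \<omega> \<le> T} \<le> exp T * \<rho> ^ n"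
    using arrival_geometric by blast
  note geo = this(3)[rule_format]
  \<comment> \<open>The square root divides the decay in two: one factor gives smallness in
    \<open>m\<close>, the other summability over the index or index pair.\<close>
  define \<sigma> where "\<sigma> = sqrt \<rho>"
  have \<sigma>: "0 < \<sigma>" "\<sigma> < 1" "\<sigma> * \<sigma> = \<rho>" using \<rho> by (auto simp: \<sigma>_def)
  have pw: "\<rho> ^ n \<le> \<sigma> ^ m * \<sigma> ^ l" if "m \<le> n" "l \<le> n" for n m l
  proof -
    have "\<rho> ^ n = \<sigma> ^ n * \<sigma> ^ n" by (simp add: \<sigma>(3)[symmetric] power_mult_distrib)
    also have "\<dots> \<le> \<sigma> ^ m * \<sigma> ^ l" using \<sigma> that by (intro mult_mono power_decreasing) auto
    finally show ?thesis .
  qed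
  have mt: "mean_tail i j x y \<le> exp T * (Fb x * Gb y) * (\<sigma> ^ m * \<sigma> ^ l)"
    if "x \<ge> 0" "y \<ge> 0" "k = i \<or> k = j" "m \<le> k" "l \<le> k" for i j k m l x y
  proof -
    have "mean_tail i j x y \<le> Fb x * Gb y * prob {\<omega>\<in>space M. \<tau> k \<omega> \<le> T}" using that by (intro mean_tail_le)
    also have "\<dots> \<le> Fb x * Gb y * (exp T * (\<sigma> ^ m * \<sigma> ^ l))"
      using FbGb_bounds(1) geo[of k] pw[OF that(4,5)] by (intro mult_left_mono order_trans[OF geo[of k]]) auto
    finally show ?thesis by (simp only: mult_ac)
  qed
  define B where "B = 1 / (1 - \<sigma>)"
  have B: "B \<ge> 0" using \<sigma> by (simp add: B_def)
  have "(\<integral>\<^sup>+p. ennreal (case p of (i, k) \<Rightarrow> \<sigma> ^ i * \<sigma> ^ k) \<partial>count_space (UNIV :: (nat \<times> nat) set))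
    = (\<integral>\<^sup>+i. \<integral>\<^sup>+k. ennreal (\<sigma> ^ i) * ennreal (\<sigma> ^ k) \<partial>count_space (UNIV::nat set) \<partial>count_space (UNIV::nat set))"
    using \<sigma> by (subst nn_integral_fst_count_space[symmetric]) (simp add: ennreal_mult)
  also have "\<dots> = (\<integral>\<^sup>+i. ennreal (\<sigma> ^ i) * ennreal B \<partial>count_space (UNIV::nat set))"
    using \<sigma> by (simp add: nn_integral_cmult nn_integral_geometric_nat B_def)
  also have "\<dots> = ennreal B * ennreal B"
    using \<sigma> by (simp add: nn_integral_multc nn_integral_geometric_nat B_def)
  finally have geo2: "(\<integral>\<^sup>+p. ennreal (case p of (i, k) \<Rightarrow> \<sigma> ^ i * \<sigma> ^ k) \<partial>count_space (UNIV :: (nat \<times> nat) set)) \<le> ennreal (B * B)"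
    using B by (simp add: ennreal_mult)
  have geo1: "(\<integral>\<^sup>+i. ennreal (\<sigma> ^ i) \<partial>count_space (UNIV :: nat set)) \<le> ennreal B"
    using \<sigma> by (simp add: nn_integral_geometric_nat B_def)
  define c where "c = 2 * exp T * (B * B) + C * (exp T * B)"
  have c: "c \<ge> 0" using B C_pos by (simp add: c_def)
  have "main_sum m x y \<le> Delta (renewal_measure M \<theta>) F G C r x y T \<and>
    Delta (renewal_measure M \<theta>) F G C r x y T \<le> main_sum m x y + c * \<sigma> ^ m * (Fb x * Gb y)"
    if xy: "x \<ge> 0" "y \<ge> 0" for m x y
  proof -
    let ?P = "{(i, k). Suc i + Suc k \<le> m}"
    have "?P \<subseteq> {..m} \<times> {..m}" by auto
    then have fin: "finite ?P" by (rule finite_subset) auto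
    let ?c = "exp T * (Fb x * Gb y) * \<sigma> ^ m"
    have c0: "?c \<ge> 0" using \<sigma> FbGb_bounds(1)[of x y] by simp
    have le2: "off_diag x y p \<le> (2 * ?c) * (case p of (i, k) \<Rightarrow> \<sigma> ^ i * \<sigma> ^ k)" if np: "p \<notin> ?P" for p
    proof -
      obtain i k where p: "p = (i, k)" "m \<le> Suc i + Suc k" using np by (cases p) auto
      have "mean_tail (Suc i + Suc k) (Suc i) x y \<le> exp T * (Fb x * Gb y) * (\<sigma> ^ m * \<sigma> ^ (i + k))"
        using xy p by (intro mt[of _ _ "Suc i + Suc k"]) auto
      moreover have "mean_tail (Suc i) (Suc i + Suc k) x y \<le> exp T * (Fb x * Gb y) * (\<sigma> ^ m * \<sigma> ^ (i + k))"
        using xy p by (intro mt[of _ _ "Suc i + Suc k"]) auto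
      ultimately have "off_diag x y p \<le> 2 * (exp T * (Fb x * Gb y) * (\<sigma> ^ m * \<sigma> ^ (i + k)))"
        unfolding off_diag_def p(1) case_prod_conv by linarith
      also have "\<dots> = (2 * ?c) * (case p of (i, k) \<Rightarrow> \<sigma> ^ i * \<sigma> ^ k)"
        by (simp only: p(1) case_prod_conv power_add mult_ac)
      finally show ?thesis .
    qed
    have le1: "mean_tail (Suc i) (Suc i) x y \<le> ?c * \<sigma> ^ i" if "i \<notin> {..<m}" for i
    proof -
      have "mean_tail (Suc i) (Suc i) x y \<le> exp T * (Fb x * Gb y) * (\<sigma> ^ m * \<sigma> ^ i)"
        using xy that by (intro mt[of _ _ "Suc i"]) auto
      then show ?thesis by (simp only: mult_ac)
    qed
    have nn: "off_diag x y p \<ge> 0" for p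
      by (cases p) (simp add: off_diag_def mean_tail_nonneg del: add_Suc add_Suc_right)
    have g: "(case p of (i, k) \<Rightarrow> \<sigma> ^ i * \<sigma> ^ k) \<ge> 0" for p :: "nat \<times> nat" using \<sigma> by (auto split: prod.split)
    have c2: "2 * ?c \<ge> 0" and BB: "B * B \<ge> 0" and g1: "\<sigma> ^ i \<ge> 0" for i using c0 B \<sigma> by auto
    note b2 = enn2real_nn_integral_count_space_bounds[OF nn g c2 BB fin le2 geo2]
    note b1 = enn2real_nn_integral_count_space_bounds[OF mean_tail_nonneg g1 c0 B finite_lessThan le1 geo1]
    have C1: "C * (\<Sum>i<m. mean_tail (Suc i) (Suc i) x y) \<le> C * enn2real (\<integral>\<^sup>+i. ennreal (mean_tail (Suc i) (Suc i) x y) \<partial>count_space UNIV)"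
      using C_pos b1(1) by (intro mult_left_mono) auto
    have C2: "C * enn2real (\<integral>\<^sup>+i. ennreal (mean_tail (Suc i) (Suc i) x y) \<partial>count_space UNIV) \<le> C * ((\<Sum>i<m. mean_tail (Suc i) (Suc i) x y) + ?c * B)"
      using C_pos b1(2) by (intro mult_left_mono) auto
    have ceq: "c * \<sigma> ^ m * (Fb x * Gb y) = 2 * ?c * (B * B) + C * (?c * B)"
      by (simp add: c_def algebra_simps)
    show ?thesis
      unfolding Delta_eq main_sum_eq ceq using b2 C1 C2 unfolding distrib_left by linarith
  qed
  then show ?thesis using c \<sigma>(1,2) by blast
qed

text \<open>A positive renewal function at \<open>T\<close> forces some claim \<open>i\<close> to
  arrive by \<open>T\<close> with positive probability. Its diagonal term already suffices, as class
  D controls the rescaling of both levels by \<open>exp (r * T)\<close>.\<close>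

lemma Delta_lower:
  "\<exists>\<kappa>>0. \<forall>x\<ge>0. \<forall>y\<ge>0. \<kappa> * (Fb x * Gb y) \<le> Delta (renewal_measure M \<theta>) F G C r x y T"
proof -
  have "\<exists>i\<ge>1. prob {\<omega>\<in>space M. \<tau> i \<omega> \<le> T} > 0"
  proof (rule ccontr)
    assume "\<not> ?thesis"
    then have 0: "prob {\<omega>\<in>space M. \<tau> (Suc i) \<omega> \<le> T} = 0" for i
      by (metis One_nat_def le_add1 measure_le_0_iff not_less plus_1_eq_Suc)
    have "renewal_fn M \<theta> T = (\<Sum>i. \<integral>\<^sup>+\<omega>. indicator {..T} (\<tau> (Suc i) \<omega>) \<partial>M)"
      unfolding renewal_fn_def count_proc_def by (rule nn_integral_suminf) measurable
    also have "\<dots> = (\<Sum>i. emeasure M {\<omega>\<in>space M. \<tau> (Suc i) \<omega> \<le> T})"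
    proof (intro arg_cong[where f=suminf] ext)
      fix i
      have "(\<integral>\<^sup>+\<omega>. indicator {..T} (\<tau> (Suc i) \<omega>) \<partial>M) = (\<integral>\<^sup>+\<omega>. indicator {\<omega>\<in>space M. \<tau> (Suc i) \<omega> \<le> T} \<omega> \<partial>M)"
        by (intro nn_integral_cong) (auto simp: indicator_def)
      also have "\<dots> = emeasure M {\<omega>\<in>space M. \<tau> (Suc i) \<omega> \<le> T}" by (intro nn_integral_indicator) measurable
      finally show "(\<integral>\<^sup>+\<omega>. indicator {..T} (\<tau> (Suc i) \<omega>) \<partial>M) = emeasure M {\<omega>\<in>space M. \<tau> (Suc i) \<omega> \<le> T}" .
    qed
    also have "\<dots> = 0" by (simp add: emeasure_eq_measure 0)
    finally show False using lam_pos by simp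
  qed
  then obtain i where i: "i \<ge> 1" "prob {\<omega>\<in>space M. \<tau> i \<omega> \<le> T} > 0" by blast
  obtain K1 q1 where K1: "K1 > 0" "\<And>n x. n \<ge> 1 \<Longrightarrow> x \<ge> 0 \<Longrightarrow> Fb (x / real n) \<le> K1 * real n ^ q1 * Fb x"
    using classD_dilation_le[OF F_class(1) Fb_pos Fb_le1 Fb_antimono] by blast
  obtain K2 q2 where K2: "K2 > 0" "\<And>n x. n \<ge> 1 \<Longrightarrow> x \<ge> 0 \<Longrightarrow> Gb (x / real n) \<le> K2 * real n ^ q2 * Gb x"
    using classD_dilation_le[OF G_class(1) Gb_pos Gb_le1 Gb_antimono] by blast
  obtain c \<sigma> where "\<forall>m. \<forall>x\<ge>0. \<forall>y\<ge>0. main_sum m x y \<le> Delta (renewal_measure M \<theta>) F G C r x y T \<and>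
    Delta (renewal_measure M \<theta>) F G C r x y T \<le> main_sum m x y + c * \<sigma> ^ m * (Fb x * Gb y)"
    using Delta_main_sum by blast
  note ms = this[rule_format, THEN conjunct1]
  \<comment> \<open>The dilation bound is stated for integer factors; monotonicity of the tails
    permits rounding up.\<close>
  obtain n :: nat where n: "exp (r * T) \<le> real n" using real_arch_simple by blast
  have n1: "n \<ge> 1" using n exp_gt_zero[of "r * T"] by (cases n) auto
  define L1 L2 where "L1 = K1 * real n ^ q1" and "L2 = K2 * real n ^ q2"
  have L: "L1 > 0" "L2 > 0" using K1 K2 n1 by (auto simp: L1_def L2_def)
  define p where "p = prob {\<omega>\<in>space M. \<tau> i \<omega> \<le> T}"
  have "C * (1 / L1 * (1 / L2)) * p * (Fb x * Gb y) \<le> Delta (renewal_measure M \<theta>) F G C r x y T" if xy: "x \<ge> 0" "y \<ge> 0" for x y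
  proof -
    have "Fb x \<le> L1 * Fb (x * real n)" using K1(2)[of n "x * real n"] n1 xy by (simp add: L1_def)
    also have "\<dots> \<le> L1 * Fb (x * exp (r * T))" using L n xy by (intro mult_left_mono Fb_anti) auto
    finally have f: "1 / L1 * Fb x \<le> Fb (x * exp (r * T))" using L by (simp add: field_simps)
    have "Gb y \<le> L2 * Gb (y * real n)" using K2(2)[of n "y * real n"] n1 xy by (simp add: L2_def)
    also have "\<dots> \<le> L2 * Gb (y * exp (r * T))" using L n xy by (intro mult_left_mono Gb_anti) auto
    finally have g: "1 / L2 * Gb y \<le> Gb (y * exp (r * T))" using L by (simp add: field_simps)
    have "C * (1 / L1 * (1 / L2)) * p * (Fb x * Gb y) = C * ((1 / L1 * Fb x) * (1 / L2 * Gb y) * p)" by (simp only: mult_ac)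
    also have "\<dots> \<le> C * (Fb (x * exp (r * T)) * Gb (y * exp (r * T)) * p)"
      using C_pos L Fb_pos[of x] Gb_pos[of y] Fb_pos[of "x * exp (r * T)"] i
      by (intro mult_left_mono mult_right_mono mult_mono f g) (auto simp: p_def)
    also have "\<dots> \<le> C * mean_tail i i x y"
      unfolding p_def using C_pos xy by (intro mult_left_mono mean_tail_diag_ge) auto
    also have "\<dots> = (\<Sum>(i, j)\<in>{(i, i)}. coef i j * mean_tail i j x y)" by (simp add: coef_def)
    also have "\<dots> \<le> main_sum i x y"
      unfolding main_sum_def using i coef_pos mean_tail_nonneg
      by (intro sum_mono2) (auto intro!: mult_nonneg_nonneg intro: less_imp_le)
    also have "\<dots> \<le> Delta (renewal_measure M \<theta>) F G C r x y T" using xy by (rule ms)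
    finally show ?thesis .
  qed
  moreover have "C * (1 / L1 * (1 / L2)) * p > 0" using C_pos L i by (simp add: p_def)
  ultimately show ?thesis by blast
qed

end

section \<open>Ruin probabilities\<close>

context renewal_risk
begin

section \<open>Measurability of the surplus and of the ruin events\<close>

lemma cadlag_premium_C1: "\<omega> \<in> space M \<Longrightarrow> cadlag_premium (\<lambda>t. C1 t \<omega>) r"
  by (rule cadlag_premium.intro) (auto intro: r_nonneg C1_0 C1_mono C1_rcont)

lemma cadlag_premium_C2: "\<omega> \<in> space M \<Longrightarrow> cadlag_premium (\<lambda>t. C2 t \<omega>) r"
  by (rule cadlag_premium.intro) (auto intro: r_nonneg C2_0 C2_mono C2_rcont)

lemma disc_premium_measurable:
  assumes Cp: "\<And>t. Cp t \<in> borel_measurable M" "\<And>\<omega>. \<omega> \<in> space M \<Longrightarrow> cadlag_premium (\<lambda>t. Cp t \<omega>) r"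
    and t: "t \<ge> 0"
  shows "disc_premium r Cp t \<in> borel_measurable M"
proof (rule borel_measurable_LIMSEQ_real)
  fix \<omega> assume "\<omega> \<in> space M"
  then interpret cadlag_premium "\<lambda>t. Cp t \<omega>" r by (rule Cp)
  show "(\<lambda>n. \<Sum>k<n. exp (- r * (t * real k / real n)) * (Cp (t * real (Suc k) / real n) \<omega> - Cp (t * real k / real n) \<omega>))
    \<longlonglongrightarrow> disc_premium r Cp t \<omega>"
    using prem_Riemann[OF t] by (simp only: disc_premium_eq_prem)
next
  show "(\<lambda>\<omega>. \<Sum>k<n. exp (- r * (t * real k / real n)) * (Cp (t * real (Suc k) / real n) \<omega> - Cp (t * real k / real n) \<omega>))
    \<in> borel_measurable M" for n :: nat
    using Cp(1) by (intro borel_measurable_sum borel_measurable_times borel_measurable_diff) auto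
qed

lemma disc_claims_measurable:
  assumes Z [measurable]: "\<And>i. Z i \<in> borel_measurable M" and t: "t \<ge> 0"
  shows "disc_claims r \<theta> Z t \<in> borel_measurable M"
proof -
  let ?g = "\<lambda>\<omega> i. if \<tau> (Suc i) \<omega> \<le> t then Z (Suc i) \<omega> * exp (- r * \<tau> (Suc i) \<omega>) else 0"
  \<comment> \<open>On an exploding path the series may be nonzero while \<open>disc_claims\<close>
    is 0, so the case distinction is part of the formula.\<close>
  let ?f = "\<lambda>\<omega>. if \<forall>n. \<tau> n \<omega> \<le> t then 0 else (\<Sum>i. ?g \<omega> i)"
  have "disc_claims r \<theta> Z t \<omega> = ?f \<omega>" if \<omega>: "\<omega> \<in> space M" for \<omega>
  proof (cases "\<forall>n. \<tau> n \<omega> \<le> t")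
    case True
    then show ?thesis using disc_claims_explosion[of \<theta> \<omega>] theta_pos[OF _ \<omega>] by simp
  next
    case False
    obtain n where n: "\<tau> n \<omega> \<le> t" "t < \<tau> (Suc n) \<omega>"
      using arrival_bracket[of \<theta> \<omega> t] theta_pos[OF _ \<omega>] t False by blast
    have late: "\<not> \<tau> (Suc i) \<omega> \<le> t" if "i \<ge> n" for i
      using \<tau>_le_iff[OF \<omega>, of "Suc n" "Suc i"] n that by auto
    have early: "\<tau> (Suc i) \<omega> \<le> t" if "i < n" for i
      using \<tau>_le_iff[OF \<omega>, of "Suc i" n] n that by auto
    have "(\<Sum>i. ?g \<omega> i) = (\<Sum>i<n. ?g \<omega> i)"
      using late by (intro suminf_finite) auto
    also have "\<dots> = (\<Sum>i<n. Z (Suc i) \<omega> * exp (- r * \<tau> (Suc i) \<omega>))"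
      using early by (intro sum.cong) auto
    also have "\<dots> = (\<Sum>i\<in>{1..n}. Z i \<omega> * exp (- r * \<tau> i \<omega>))"
      by (simp only: sum.atLeast1_atMost_eq One_nat_def)
    also have "\<dots> = disc_claims r \<theta> Z t \<omega>"
      using disc_claims_between[of \<theta> \<omega> n t] theta_pos[OF _ \<omega>] n by simp
    finally show ?thesis using False by (simp only: if_False)
  qed
  moreover have "?f \<in> borel_measurable M" by measurable
  ultimately show ?thesis by (subst measurable_cong)
qed

lemma surplus_measurable:
  assumes "\<And>i. Z i \<in> borel_measurable M" "\<And>t. Cp t \<in> borel_measurable M"
    "\<And>\<omega>. \<omega> \<in> space M \<Longrightarrow> cadlag_premium (\<lambda>t. Cp t \<omega>) r" "t \<ge> 0"
  shows "surplus r u Cp \<theta> Z t \<in> borel_measurable M"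
  unfolding surplus_def[abs_def]
  by (intro borel_measurable_diff borel_measurable_add borel_measurable_const
      disc_premium_measurable disc_claims_measurable assms)

lemma ex_neg_measurable:
  assumes U: "\<And>t. t \<ge> 0 \<Longrightarrow> U t \<in> borel_measurable M" "\<And>\<omega>. \<omega> \<in> space M \<Longrightarrow> right_stable (\<lambda>t. U t \<omega>)"
  shows "{\<omega>\<in>space M. \<exists>t\<in>{0..T}. U t \<omega> < 0} \<in> events"
proof -
  have "{\<omega>\<in>space M. \<exists>t\<in>{0..T}. U t \<omega> < 0} = (\<Union>q\<in>insert T ({0..T} \<inter> \<rat>). {\<omega>\<in>space M. U q \<omega> < 0})"
    using right_stable_rational[OF U(2) order_refl less_imp_le[OF T_pos]] by auto
  also have "\<dots> \<in> events"
  proof (rule sets.countable_UN'')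
    show "countable (insert T ({0..T} \<inter> \<rat>))" by (intro countable_insert countable_Int2 countable_rat)
    fix q assume "q \<in> insert T ({0..T} \<inter> \<rat>)"
    then have [measurable]: "U q \<in> borel_measurable M" using T_pos by (intro U) auto
    show "{\<omega>\<in>space M. U q \<omega> < 0} \<in> events" by measurable
  qed
  finally show ?thesis .
qed

text \<open>Ruin can only occur at claim times; since the surplus keeps its sign for a while to the right of
every time, both ruin events are countable unions and hence measurable. Explosion of the arrival times
has probability 0 but must be carried along, because the measure space need not be complete.\<close>

context
  fixes x y :: real assumes x: "x > 0" and y: "y > 0"
begin

abbreviation "U1 \<equiv> surplus r x C1 \<theta> X"
abbreviation "U2 \<equiv> surplus r y C2 \<theta> Y"

lemma U1_measurable: "t \<ge> 0 \<Longrightarrow> U1 t \<in> borel_measurable M"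
  and U2_measurable: "t \<ge> 0 \<Longrightarrow> U2 t \<in> borel_measurable M"
  by (rule surplus_measurable; simp add: X_rv Y_rv C1_rv C2_rv cadlag_premium_C1 cadlag_premium_C2)+

lemma U1_stable: "\<omega> \<in> space M \<Longrightarrow> right_stable (\<lambda>t. U1 t \<omega>)"
  and U2_stable: "\<omega> \<in> space M \<Longrightarrow> right_stable (\<lambda>t. U2 t \<omega>)"
  by (rule right_stable_surplus; simp add: x y theta_pos cadlag_premium_C1 cadlag_premium_C2)+

lemma U1_0: "\<omega> \<in> space M \<Longrightarrow> U1 0 \<omega> > 0"
  by (rule surplus_0_pos; simp add: x theta_pos cadlag_premium_C1)

definition "ruin_max = {\<omega>\<in>space M. \<exists>t\<in>{0..T}. max (U1 t \<omega>) (U2 t \<omega>) < 0}"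
definition "ruin_and = {\<omega>\<in>space M. (\<exists>t\<in>{0..T}. U1 t \<omega> < 0) \<and> (\<exists>t\<in>{0..T}. U2 t \<omega> < 0)}"

lemma ruin_max_events [measurable]: "ruin_max \<in> events"
  unfolding ruin_max_def
  by (intro ex_neg_measurable[of "\<lambda>t \<omega>. max (U1 t \<omega>) (U2 t \<omega>)"] borel_measurable_max
      U1_measurable U2_measurable right_stable_max U1_stable U2_stable)

lemma ruin_and_events [measurable]: "ruin_and \<in> events"
proof -
  have "ruin_and = {\<omega>\<in>space M. \<exists>t\<in>{0..T}. U1 t \<omega> < 0} \<inter> {\<omega>\<in>space M. \<exists>t\<in>{0..T}. U2 t \<omega> < 0}"
    by (auto simp: ruin_and_def)
  also have "\<dots> \<in> events"
    by (intro sets.Int ex_neg_measurable U1_measurable U2_measurable U1_stable U2_stable)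
  finally show ?thesis .
qed

lemma psi_max_eq: "psi_max M r C1 C2 \<theta> X Y x y T = prob ruin_max"
proof -
  have "T_max U1 U2 \<omega> \<le> ereal T \<longleftrightarrow> (\<exists>t\<in>{0..T}. max (U1 t \<omega>) (U2 t \<omega>) < 0)" if "\<omega> \<in> space M" for \<omega>
    using that T_pos U1_0[OF that] by (intro T_max_le_iff U1_stable U2_stable) auto
  then show ?thesis unfolding psi_max_def ruin_max_def by (metis (mono_tags, lifting) Collect_cong)
qed

lemma psi_and_eq: "psi_and M r C1 C2 \<theta> X Y x y T = prob ruin_and"
proof -
  have "T_and U1 U2 \<omega> \<le> ereal T \<longleftrightarrow> (\<exists>t\<in>{0..T}. U1 t \<omega> < 0) \<and> (\<exists>t\<in>{0..T}. U2 t \<omega> < 0)" if "\<omega> \<in> space M" for \<omega>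
    using that T_pos by (intro T_and_le_iff U1_stable U2_stable) auto
  then show ?thesis unfolding psi_and_def ruin_and_def by (metis (mono_tags, lifting) Collect_cong)
qed

lemma psi_max_le_psi_and: "psi_max M r C1 C2 \<theta> X Y x y T \<le> psi_and M r C1 C2 \<theta> X Y x y T"
  unfolding psi_max_eq psi_and_eq
  by (rule finite_measure_mono[OF _ ruin_and_events]) (auto simp: ruin_max_def ruin_and_def)

definition "explosion = {\<omega>\<in>space M. \<forall>n. \<tau> n \<omega> \<le> T}"

lemma explosion_events [measurable]: "explosion \<in> events"
  unfolding explosion_def by measurable

lemma prob_explosion: "prob explosion = 0"
proof -
  obtain \<rho> where \<rho>: "0 < \<rho>" "\<rho> < 1" and "\<forall>n. prob {\<omega>\<in>space M. \<tau> n \<omega> \<le> T} \<le> exp T * \<rho> ^ n"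
    using arrival_geometric by blast
  note geo = this(3)[rule_format]
  have le: "prob explosion \<le> exp T * \<rho> ^ n" for n
  proof -
    have "prob explosion \<le> prob {\<omega>\<in>space M. \<tau> n \<omega> \<le> T}"
      by (intro finite_measure_mono) (auto simp: explosion_def)
    then show ?thesis using geo[of n] by simp
  qed
  have "(\<lambda>n. exp T * \<rho> ^ n) \<longlonglongrightarrow> exp T * 0"
    using \<rho> by (intro tendsto_intros LIMSEQ_realpow_zero) auto
  then have "prob explosion \<le> 0"
    using le by (intro LIMSEQ_le_const[of "\<lambda>n. exp T * \<rho> ^ n" 0]) auto
  then show ?thesis using measure_nonneg[of M explosion] by linarith
qed

lemma psi_and_le:
  "psi_and M r C1 C2 \<theta> X Y x y T \<le>
    prob {\<omega>\<in>space M. (\<Sum>i\<in>{1..m}. X i \<omega> * wt i \<omega>) > x \<and> (\<Sum>j\<in>{1..m}. Y j \<omega> * wt j \<omega>) > y}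
    + prob (\<Union>n. late_event (n + Suc m) x y)"
proof -
  let ?S = "{\<omega>\<in>space M. (\<Sum>i\<in>{1..m}. X i \<omega> * wt i \<omega>) > x \<and> (\<Sum>j\<in>{1..m}. Y j \<omega> * wt j \<omega>) > y}"
  let ?L = "\<Union>n. late_event (n + Suc m) x y"
  have "ruin_and \<subseteq> (?S \<union> ?L) \<union> explosion"
  proof
    fix \<omega> assume "\<omega> \<in> ruin_and"
    then obtain s t where \<omega>: "\<omega> \<in> space M" and st: "0 \<le> s" "s \<le> T" "U1 s \<omega> < 0" "0 \<le> t" "t \<le> T" "U2 t \<omega> < 0"
      by (auto simp: ruin_and_def)
    show "\<omega> \<in> (?S \<union> ?L) \<union> explosion"
    proof (cases "\<forall>n. \<tau> n \<omega> \<le> T")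
      case True
      then show ?thesis using \<omega> by (simp add: explosion_def)
    next
      case False
      obtain n where n: "\<tau> n \<omega> \<le> T" "T < \<tau> (Suc n) \<omega>"
        using arrival_bracket[of \<theta> \<omega> T] theta_pos[OF _ \<omega>] T_pos False by (metis less_imp_le)
      have gX: "(\<Sum>i\<in>{1..n}. X i \<omega> * exp (- r * \<tau> i \<omega>)) > x"
        by (rule surplus_neg_imp_claims_gt[OF theta_pos[OF _ \<omega>] cadlag_premium_C1[OF \<omega>] x X_nonneg[OF _ \<omega>] st(1-3) n])
      have gY: "(\<Sum>i\<in>{1..n}. Y i \<omega> * exp (- r * \<tau> i \<omega>)) > y"
        by (rule surplus_neg_imp_claims_gt[OF theta_pos[OF _ \<omega>] cadlag_premium_C2[OF \<omega>] y Y_nonneg[OF _ \<omega>] st(4-6) n])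
      show ?thesis
      \<comment> \<open>Exactly \<open>n\<close> claims arrive by \<open>T\<close>. If
        \<open>n \<le> m\<close>, the weights of the claims \<open>n + 1\<close> to \<open>m\<close>
        vanish and the weighted sums are the true ones; otherwise the outcome lies in a late
        event.\<close>
      proof (cases "n \<le> m")
        case True
        have "(\<Sum>i\<in>{1..n}. Z i \<omega> * exp (- r * \<tau> i \<omega>)) = (\<Sum>i\<in>{1..m}. Z i \<omega> * wt i \<omega>)" for Z
        proof (rule sum.mono_neutral_cong_left)
          show "{1..n} \<subseteq> {1..m}" using True by auto
          show "\<forall>i\<in>{1..m} - {1..n}. Z i \<omega> * wt i \<omega> = 0"
          proof
            fix i assume "i \<in> {1..m} - {1..n}"
            then have "\<tau> (Suc n) \<omega> \<le> \<tau> i \<omega>" using \<tau>_le_iff[OF \<omega>] by auto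
            then show "Z i \<omega> * wt i \<omega> = 0" using n by (simp add: wt_def)
          qed
          show "Z i \<omega> * exp (- r * \<tau> i \<omega>) = Z i \<omega> * wt i \<omega>" if "i \<in> {1..n}" for i
            using \<tau>_le_iff[OF \<omega>, of i n] that n by (simp add: wt_def)
        qed simp
        then have "\<omega> \<in> ?S" using gX gY \<omega> by auto
        then show ?thesis by blast
      next
        case False
        have "\<omega> \<in> late_event n x y" using gX gY \<omega> n by (simp add: late_event_def)
        moreover have "n = (n - Suc m) + Suc m" using False by simp
        ultimately have "\<omega> \<in> ?L" by (metis UNIV_I UN_I)
        then show ?thesis by blast
      qed
    qed
  qed
  then have "prob ruin_and \<le> prob ((?S \<union> ?L) \<union> explosion)"
    by (intro finite_measure_mono) measurable
  also have "\<dots> \<le> prob (?S \<union> ?L) + prob explosion"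
    by (intro measure_Un_le) measurable
  also have "\<dots> \<le> (prob ?S + prob ?L) + prob explosion"
    by (intro add_right_mono measure_Un_le) measurable
  finally show ?thesis unfolding psi_and_eq prob_explosion by simp
qed

text \<open>Both lines are examined at the single time \<open>T\<close>. One big claim already
  pushes a line below 0 there, since the other claims are nonnegative and the discounted premium is
  at most \<open>L\<close>. The premium event factors out by independence.\<close>

lemma psi_max_ge:
  assumes L: "L \<ge> 0"
  shows "prob {\<omega>\<in>space M. C1 T \<omega> \<le> L \<and> C2 T \<omega> \<le> L} *
      prob (\<Union>(i, j)\<in>{1..m} \<times> {1..m}. claim_event i j (x + L) (y + L))
    \<le> psi_max M r C1 C2 \<theta> X Y x y T"
proof -
  let ?Q = "{\<omega>\<in>space M. C1 T \<omega> \<le> L \<and> C2 T \<omega> \<le> L}"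
  let ?U = "\<Union>(i, j)\<in>{1..m} \<times> {1..m}. claim_event i j (x + L) (y + L)"
  have "?Q \<inter> ?U \<subseteq> ruin_max \<union> explosion"
  proof
    fix \<omega> assume "\<omega> \<in> ?Q \<inter> ?U"
    then obtain i j where \<omega>: "\<omega> \<in> space M" and Q: "C1 T \<omega> \<le> L" "C2 T \<omega> \<le> L" and ij: "i \<in> {1..m}" "j \<in> {1..m}"
      and E: "\<omega> \<in> claim_event i j (x + L) (y + L)" by auto
    show "\<omega> \<in> ruin_max \<union> explosion"
    proof (cases "\<forall>n. \<tau> n \<omega> \<le> T")
      case True
      then show ?thesis using \<omega> by (simp add: explosion_def)
    next
      case False
      obtain n where n: "\<tau> n \<omega> \<le> T" "T < \<tau> (Suc n) \<omega>"
        using arrival_bracket[of \<theta> \<omega> T] theta_pos[OF _ \<omega>] T_pos False by (metis less_imp_le)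
      have E': "X i \<omega> * wt i \<omega> > x + L" "Y j \<omega> * wt j \<omega> > y + L" "\<tau> i \<omega> \<le> T" "\<tau> j \<omega> \<le> T"
        using E x y L claim_event_eq[of "x + L" "y + L" i j] by (auto simp: claim_event_def)
      have big: "(\<Sum>k\<in>{1..n}. Z k \<omega> * exp (- r * \<tau> k \<omega>)) > u" if "Z l \<omega> * wt l \<omega> > u" "\<tau> l \<omega> \<le> T" "l \<ge> 1" "\<And>k. k \<ge> 1 \<Longrightarrow> Z k \<omega> \<ge> 0" for Z l u
      proof -
        have "l \<in> {1..n}" using n that \<tau>_le_iff[OF \<omega>, of "Suc n" l] by (auto simp: not_less_eq_eq)
        then have "Z l \<omega> * exp (- r * \<tau> l \<omega>) \<le> (\<Sum>k\<in>{1..n}. Z k \<omega> * exp (- r * \<tau> k \<omega>))"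
          using that by (intro member_le_sum) auto
        then show ?thesis using that by (simp add: wt_def)
      qed
      have gX: "(\<Sum>k\<in>{1..n}. X k \<omega> * exp (- r * \<tau> k \<omega>)) > x + L"
        using ij by (intro big[of "x + L" X i] E' X_nonneg \<omega>) auto
      have gY: "(\<Sum>k\<in>{1..n}. Y k \<omega> * exp (- r * \<tau> k \<omega>)) > y + L"
        using ij by (intro big[of "y + L" Y j] E' Y_nonneg \<omega>) auto
      have "U1 T \<omega> < 0"
        by (rule surplus_neg_of_claims_gt[where \<theta>=\<theta> and \<omega>=\<omega> and Cp=C1 and Z=X,
            OF theta_pos[OF _ \<omega>] cadlag_premium_C1[OF \<omega>] x less_imp_le[OF T_pos] Q(1) n gX])
      moreover have "U2 T \<omega> < 0"
        by (rule surplus_neg_of_claims_gt[where \<theta>=\<theta> and \<omega>=\<omega> and Cp=C2 and Z=Y,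
            OF theta_pos[OF _ \<omega>] cadlag_premium_C2[OF \<omega>] y less_imp_le[OF T_pos] Q(2) n gY])
      ultimately have "\<omega> \<in> ruin_max" using \<omega> T_pos by (auto simp: ruin_max_def intro!: bexI[of _ T])
      then show ?thesis by blast
    qed
  qed
  then have "prob (?Q \<inter> ?U) \<le> prob (ruin_max \<union> explosion)"
    by (intro finite_measure_mono) measurable
  also have "\<dots> \<le> prob ruin_max + prob explosion"
    by (intro measure_Un_le) measurable
  finally have "prob (?Q \<inter> ?U) \<le> psi_max M r C1 C2 \<theta> X Y x y T"
    unfolding psi_max_eq prob_explosion by simp
  moreover have "prob (?Q \<inter> ?U) = prob ?Q * prob ?U"
  proof (rule indep_prem_model)
    have [measurable]: "C1 T \<in> borel_measurable prem_alg" "C2 T \<in> borel_measurable prem_alg"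
      using T_pos C1_prem_alg C2_prem_alg by auto
    have "{\<omega>\<in>space prem_alg. C1 T \<omega> \<le> L \<and> C2 T \<omega> \<le> L} \<in> sets prem_alg" by measurable
    then show "?Q \<in> sets prem_alg" by simp
    have "claim_event i j (x + L) (y + L) \<in> sets model_alg" if "i \<ge> 1" "j \<ge> 1" for i j
    proof -
      have [measurable]: "X i \<in> borel_measurable model_alg" "Y j \<in> borel_measurable model_alg"
        "\<tau> i \<in> borel_measurable model_alg" "\<tau> j \<in> borel_measurable model_alg"
        by (rule measurable_model_alg(1)[OF X_claim_alg[OF that(1)]] measurable_model_alg(1)[OF Y_claim_alg[OF that(2)]]
            measurable_model_alg(2)[OF arrival_arrival_alg])+
      have "{\<omega>\<in>space model_alg. \<tau> i \<omega> \<le> T \<and> \<tau> j \<omega> \<le> T \<and> X i \<omega> > (x + L) * exp (r * \<tau> i \<omega>) \<and> Y j \<omega> > (y + L) * exp (r * \<tau> j \<omega>)}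
        \<in> sets model_alg" by measurable
      then show ?thesis unfolding claim_event_def space_algs .
    qed
    then have "(case p of (i, j) \<Rightarrow> claim_event i j (x + L) (y + L)) \<in> sets model_alg" if "p \<in> {1..m} \<times> {1..m}" for p
      using that by (cases p) simp
    then show "?U \<in> sets model_alg" by (intro sets.finite_UN finite_cartesian_product finite_atLeastAtMost)
  qed
  ultimately show ?thesis by simp
qed

end

text \<open>Tightness at the one time \<open>T\<close> is enough, because \<open>psi_max_ge\<close>
  examines the surplus only there.\<close>

lemma premium_bound:
  assumes e: "\<epsilon> > 0"
  shows "\<exists>L\<ge>0. prob {\<omega>\<in>space M. C1 T \<omega> \<le> L \<and> C2 T \<omega> \<le> L} \<ge> 1 - \<epsilon>"
proof -
  let ?Q = "\<lambda>n::nat. {\<omega>\<in>space M. C1 T \<omega> \<le> real n \<and> C2 T \<omega> \<le> real n}"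
  have "(\<lambda>n. prob (?Q n)) \<longlonglongrightarrow> prob (\<Union>n. ?Q n)"
    by (intro finite_Lim_measure_incseq) (auto simp: incseq_def)
  moreover have "(\<Union>n. ?Q n) = space M"
  proof -
    have "\<exists>n. C1 T \<omega> \<le> real n \<and> C2 T \<omega> \<le> real n" for \<omega>
      using real_arch_simple[of "max (C1 T \<omega>) (C2 T \<omega>)"] by simp
    then show ?thesis by auto
  qed
  ultimately have "(\<lambda>n. prob (?Q n)) \<longlonglongrightarrow> 1" by (simp add: prob_space)
  then have "eventually (\<lambda>n. prob (?Q n) > 1 - \<epsilon>) sequentially"
    by (rule order_tendstoD) (use e in auto)
  then obtain n where "prob (?Q n) > 1 - \<epsilon>" by (auto simp: eventually_sequentially)
  then show ?thesis by (intro exI[of _ "real n"]) auto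
qed

lemma psi_upper:
  assumes e: "\<epsilon> > 0"
  shows "\<exists>N. \<forall>x\<ge>N. \<forall>y\<ge>N. psi_and M r C1 C2 \<theta> X Y x y T \<le> (1 + \<epsilon>) * Delta (renewal_measure M \<theta>) F G C r x y T"
proof -
  obtain \<kappa> where \<kappa>: "\<kappa> > 0" and "\<forall>x\<ge>0. \<forall>y\<ge>0. \<kappa> * (Fb x * Gb y) \<le> Delta (renewal_measure M \<theta>) F G C r x y T"
    using Delta_lower by blast
  note low = this(2)[rule_format]
  \<comment> \<open>One \<open>\<delta>\<close> is the relative error of the main sum; the other two
    are errors in units of \<open>Fb x * Gb y\<close>, from GTAI and from the late claims, each
    costing \<open>\<delta> / \<kappa>\<close> relative to \<open>Delta\<close>.\<close>
  define \<delta> where "\<delta> = \<epsilon> / (1 + 2 / \<kappa>)"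
  have \<delta>: "\<delta> > 0" "\<delta> * (1 + 2 / \<kappa>) = \<epsilon>"
  proof -
    have "1 + 2 / \<kappa> > 0" using \<kappa> by (simp add: add_pos_pos)
    then show "\<delta> > 0" "\<delta> * (1 + 2 / \<kappa>) = \<epsilon>" using e by (simp_all add: \<delta>_def)
  qed
  obtain c \<sigma> where "\<forall>m. \<forall>x\<ge>0. \<forall>y\<ge>0. main_sum m x y \<le> Delta (renewal_measure M \<theta>) F G C r x y T \<and>
    Delta (renewal_measure M \<theta>) F G C r x y T \<le> main_sum m x y + c * \<sigma> ^ m * (Fb x * Gb y)"
    using Delta_main_sum by blast
  note ms = this[rule_format, THEN conjunct1]
  obtain m0 where m0: "\<forall>m\<ge>m0. \<forall>x\<ge>0. \<forall>y\<ge>0. prob (\<Union>n. late_event (n + Suc m) x y) \<le> \<delta> * (Fb x * Gb y)"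
    using late_events_small[OF \<delta>(1)] by blast
  define m where "m = max 1 m0"
  have m: "m \<ge> 1" "m \<ge> m0" by (auto simp: m_def)
  obtain N where N: "\<forall>x\<ge>N. \<forall>y\<ge>N.
    prob {\<omega>\<in>space M. (\<Sum>i\<in>{1..m}. X i \<omega> * wt i \<omega>) > x \<and> (\<Sum>j\<in>{1..m}. Y j \<omega> * wt j \<omega>) > y}
      \<le> (1 + \<delta>) * main_sum m x y + \<delta> * (Fb x * Gb y)"
    using finite_sum_upper[OF m(1) \<delta>(1)] by blast
  show ?thesis
  proof (intro exI[of _ "max 1 N"] allI impI)
    fix x y assume xy: "x \<ge> max 1 N" "y \<ge> max 1 N"
    then have xy0: "x > 0" "y > 0" "x \<ge> 0" "y \<ge> 0" "x \<ge> N" "y \<ge> N" by auto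
    let ?D = "Delta (renewal_measure M \<theta>) F G C r x y T"
    have f: "Fb x * Gb y \<le> ?D / \<kappa>" using low[OF xy0(3,4)] \<kappa> by (simp add: field_simps)
    have "psi_and M r C1 C2 \<theta> X Y x y T \<le> ((1 + \<delta>) * main_sum m x y + \<delta> * (Fb x * Gb y)) + \<delta> * (Fb x * Gb y)"
      using psi_and_le[OF xy0(1,2), of m] N[rule_format, OF xy0(5,6)] m0[rule_format, OF m(2) xy0(3,4)] by linarith
    also have "\<dots> \<le> ((1 + \<delta>) * ?D + \<delta> * (?D / \<kappa>)) + \<delta> * (?D / \<kappa>)"
      using \<delta>(1) ms[OF xy0(3,4), of m] f by (intro add_mono mult_left_mono) auto
    also have "\<dots> = (1 + \<delta> * (1 + 2 / \<kappa>)) * ?D" by (simp add: algebra_simps)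
    finally show "psi_and M r C1 C2 \<theta> X Y x y T \<le> (1 + \<epsilon>) * ?D" unfolding \<delta>(2) .
  qed
qed

lemma psi_lower:
  assumes e: "\<epsilon> > 0"
  shows "\<exists>N. \<forall>x\<ge>N. \<forall>y\<ge>N. (1 - \<epsilon>) * Delta (renewal_measure M \<theta>) F G C r x y T \<le> psi_max M r C1 C2 \<theta> X Y x y T"
proof -
  obtain \<kappa> where \<kappa>: "\<kappa> > 0" and "\<forall>x\<ge>0. \<forall>y\<ge>0. \<kappa> * (Fb x * Gb y) \<le> Delta (renewal_measure M \<theta>) F G C r x y T"
    using Delta_lower by blast
  note low = this(2)[rule_format]
  \<comment> \<open>Three factors \<open>1 - \<delta>\<close> are lost, to the premium, the union
    bound and the shift by \<open>L\<close>; two additive errors come from truncation and from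
    intersections. The minimum with 1 keeps \<open>1 - \<delta>\<close> nonnegative.\<close>
  define \<delta> where "\<delta> = min 1 (\<epsilon> / (3 + 2 / \<kappa>))"
  have pos: "3 + 2 / \<kappa> > 0" using \<kappa> by (simp add: add_pos_pos)
  have \<delta>: "\<delta> > 0" "\<delta> \<le> 1" using e pos by (auto simp: \<delta>_def)
  have "\<delta> \<le> \<epsilon> / (3 + 2 / \<kappa>)" by (simp add: \<delta>_def)
  then have \<delta>e: "\<delta> * (3 + 2 / \<kappa>) \<le> \<epsilon>" using pos by (simp add: pos_le_divide_eq)
  obtain c \<sigma> where c: "c \<ge> 0" and \<sigma>: "0 < \<sigma>" "\<sigma> < 1"
    and "\<forall>m. \<forall>x\<ge>0. \<forall>y\<ge>0. main_sum m x y \<le> Delta (renewal_measure M \<theta>) F G C r x y T \<and>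
    Delta (renewal_measure M \<theta>) F G C r x y T \<le> main_sum m x y + c * \<sigma> ^ m * (Fb x * Gb y)"
    using Delta_main_sum by blast
  note ms = this(4)[rule_format]
  have "(\<lambda>m. c * \<sigma> ^ m) \<longlonglongrightarrow> c * 0" using \<sigma> by (intro tendsto_intros LIMSEQ_realpow_zero) auto
  then have "eventually (\<lambda>m. c * \<sigma> ^ m < \<delta>) sequentially" by (rule order_tendstoD) (use \<delta> in auto)
  then obtain m0 where m0: "\<forall>m\<ge>m0. c * \<sigma> ^ m < \<delta>" by (auto simp: eventually_sequentially)
  define m where "m = max 1 m0"
  have m: "m \<ge> 1" "c * \<sigma> ^ m \<le> \<delta>" using m0 by (auto simp: m_def intro: less_imp_le)
  obtain L where L: "L \<ge> 0" "prob {\<omega>\<in>space M. C1 T \<omega> \<le> L \<and> C2 T \<omega> \<le> L} \<ge> 1 - \<delta>"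
    using premium_bound[OF \<delta>(1)] by blast
  obtain N1 where N1: "\<forall>x\<ge>N1. \<forall>y\<ge>N1.
    (1 - \<delta>) * main_sum m x y - \<delta> * (Fb x * Gb y) \<le> prob (\<Union>(i, j)\<in>{1..m} \<times> {1..m}. claim_event i j x y)"
    using finite_union_lower[OF m(1) \<delta>(1)] by blast
  obtain N2 where N2: "\<forall>x\<ge>N2. \<forall>y\<ge>N2. \<forall>i j. mean_tail i j (x - L) (y - L) \<le> (1 + \<delta>) * mean_tail i j x y"
    using mean_tail_shift[OF L(1) \<delta>(1)] by blast
  show ?thesis
  proof (intro exI[of _ "max 1 (max N1 N2)"] allI impI)
    fix x y assume xy: "x \<ge> max 1 (max N1 N2)" "y \<ge> max 1 (max N1 N2)"
    then have xy0: "x > 0" "y > 0" "x \<ge> 0" "y \<ge> 0" by auto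
    have xyL: "x + L \<ge> N1" "y + L \<ge> N1" "x + L \<ge> N2" "y + L \<ge> N2" using xy L(1) by auto
    let ?D = "Delta (renewal_measure M \<theta>) F G C r x y T"
    define f where "f = Fb x * Gb y"
    define A where "A = main_sum m x y"
    define A' where "A' = main_sum m (x + L) (y + L)"
    define PU where "PU = prob (\<Union>(i, j)\<in>{1..m} \<times> {1..m}. claim_event i j (x + L) (y + L))"
    have f: "f \<le> ?D / \<kappa>" using low[OF xy0(3,4)] \<kappa> by (simp add: f_def field_simps)
    have f0: "f \<ge> 0" unfolding f_def by (rule FbGb_bounds)
    have nn: "main_sum m u v \<ge> 0" for u v
      unfolding main_sum_def using coef_pos mean_tail_nonneg
      by (intro sum_nonneg) (auto intro!: mult_nonneg_nonneg intro: less_imp_le)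
    have A: "A \<ge> 0" "A' \<ge> 0" by (simp_all add: A_def A'_def nn)
    have AD: "A \<le> ?D" using ms[OF xy0(3,4), of m] by (simp add: A_def)
    have DA: "?D - \<delta> * f \<le> A"
    proof -
      have "?D \<le> A + c * \<sigma> ^ m * f" using ms[OF xy0(3,4), of m] by (simp add: A_def f_def)
      also have "\<dots> \<le> A + \<delta> * f" using m(2) f0 by (intro add_left_mono mult_right_mono)
      finally show ?thesis by simp
    qed
    \<comment> \<open>The shift estimate is applied at \<open>x + L\<close> and
      \<open>y + L\<close>, so that it bounds the value at the original capitals by the value at the
      raised ones.\<close>
    have AA': "A \<le> (1 + \<delta>) * A'"
      unfolding A_def A'_def main_sum_def sum_distrib_left
    proof (rule sum_mono)
      fix p :: "nat \<times> nat"
      obtain i j where p: "p = (i, j)" by (cases p)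
      have "coef i j * mean_tail i j x y \<le> coef i j * ((1 + \<delta>) * mean_tail i j (x + L) (y + L))"
        using N2[rule_format, OF xyL(3,4), of i j] coef_pos[of i j] by (intro mult_left_mono) auto
      then show "(case p of (i, j) \<Rightarrow> coef i j * mean_tail i j x y)
        \<le> (1 + \<delta>) * (case p of (i, j) \<Rightarrow> coef i j * mean_tail i j (x + L) (y + L))"
        by (simp add: p mult.left_commute)
    qed
    have A'A: "(1 - \<delta>) * A \<le> A'"
    proof -
      have "(1 - \<delta>) * A \<le> (1 - \<delta>) * ((1 + \<delta>) * A')" using AA' \<delta> by (intro mult_left_mono) auto
      also have "\<dots> = A' - \<delta> * \<delta> * A'" by (simp add: algebra_simps)
      also have "\<dots> \<le> A'" using A \<delta> by simp
      finally show ?thesis .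
    qed
    have fL: "Fb (x + L) * Gb (y + L) \<le> f"
      unfolding f_def using L(1) Fb_pos Gb_pos by (intro mult_mono Fb_anti Gb_anti) (auto intro: less_imp_le)
    have PU: "(1 - \<delta>) * A' - \<delta> * f \<le> PU"
    proof -
      have "\<delta> * (Fb (x + L) * Gb (y + L)) \<le> \<delta> * f" using fL \<delta> by (intro mult_left_mono) auto
      then show ?thesis using N1[rule_format, OF xyL(1,2)] unfolding PU_def A'_def by linarith
    qed
    have psi: "(1 - \<delta>) * PU \<le> psi_max M r C1 C2 \<theta> X Y x y T"
    proof -
      have "(1 - \<delta>) * PU \<le> prob {\<omega>\<in>space M. C1 T \<omega> \<le> L \<and> C2 T \<omega> \<le> L} * PU"
        using L(2) by (intro mult_right_mono) (auto simp: PU_def)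
      then show ?thesis using psi_max_ge[OF xy0(1,2) L(1), of m] unfolding PU_def by linarith
    qed
    have d3: "1 - 3 * \<delta> \<le> (1 - \<delta>) * (1 - \<delta>) * (1 - \<delta>)"
    proof -
      have "(1 - \<delta>) * (1 - \<delta>) * (1 - \<delta>) = 1 - 3 * \<delta> + \<delta> * \<delta> * (3 - \<delta>)" by (simp add: algebra_simps)
      moreover have "\<delta> * \<delta> * (3 - \<delta>) \<ge> 0" using \<delta> by simp
      ultimately show ?thesis by simp
    qed
    have "?D * (1 - \<epsilon>) \<le> ?D * (1 - \<delta> * (3 + 2 / \<kappa>))"
      using \<delta>e A(1) AD by (intro mult_left_mono) auto
    also have "\<dots> = ?D - 3 * \<delta> * ?D - 2 * (\<delta> * (?D / \<kappa>))" by (simp add: algebra_simps)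
    also have "\<dots> \<le> ?D - 3 * \<delta> * A - 2 * (\<delta> * f)"
      using \<delta>(1) AD f by (intro diff_mono mult_left_mono) auto
    also have "\<dots> \<le> (1 - 3 * \<delta>) * A - \<delta> * f" using DA by (simp add: algebra_simps)
    also have "\<dots> \<le> (1 - \<delta>) * (1 - \<delta>) * (1 - \<delta>) * A - \<delta> * f"
      using d3 A by (intro diff_right_mono mult_right_mono)
    also have "\<dots> = (1 - \<delta>) * ((1 - \<delta>) * ((1 - \<delta>) * A)) - \<delta> * f" by (simp only: mult.assoc)
    also have "\<dots> \<le> (1 - \<delta>) * ((1 - \<delta>) * A') - (1 - \<delta>) * (\<delta> * f)"
    proof (intro diff_mono mult_left_mono A'A)
      show "(1 - \<delta>) * (\<delta> * f) \<le> \<delta> * f" using \<delta> f0 mult_right_mono[of "1 - \<delta>" 1 "\<delta> * f"] by simp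
    qed (use \<delta> in auto)
    also have "\<dots> = (1 - \<delta>) * ((1 - \<delta>) * A' - \<delta> * f)" by (simp only: right_diff_distrib)
    also have "\<dots> \<le> (1 - \<delta>) * PU" using PU \<delta> by (intro mult_left_mono) auto
    also note psi
    finally show "(1 - \<epsilon>) * ?D \<le> psi_max M r C1 C2 \<theta> X Y x y T" by (simp only: mult.commute)
  qed
qed

text \<open>As \<open>psi_max\<close> never exceeds \<open>psi_and\<close>, an upper bound for the
  latter and a lower bound for the former enclose both.\<close>

theorem ruin_asymptotics:
  "(\<lambda>(x, y). psi_max M r C1 C2 \<theta> X Y x y T)
     \<sim>[at_top \<times>\<^sub>F at_top] (\<lambda>(x, y). Delta (renewal_measure M \<theta>) F G C r x y T)"
  "(\<lambda>(x, y). psi_and M r C1 C2 \<theta> X Y x y T)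
     \<sim>[at_top \<times>\<^sub>F at_top] (\<lambda>(x, y). Delta (renewal_measure M \<theta>) F G C r x y T)"
proof -
  let ?D = "\<lambda>x y. Delta (renewal_measure M \<theta>) F G C r x y T"
  obtain \<kappa> where \<kappa>: "\<kappa> > 0" and "\<forall>x\<ge>0. \<forall>y\<ge>0. \<kappa> * (Fb x * Gb y) \<le> ?D x y"
    using Delta_lower by blast
  note low = this(2)[rule_format]
  have pos: "?D x y > 0" if "x \<ge> 0" "y \<ge> 0" for x y
    using low[OF that] \<kappa> Fb_pos[of x] Gb_pos[of y] by (smt (verit) mult_pos_pos)
  have ev: "eventually (\<lambda>p. (\<lambda>(x, y). ?D x y) p > 0) (at_top \<times>\<^sub>F at_top)"
    unfolding eventually_prod_at_top_iff by (intro exI[of _ 0]) (auto intro: pos)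
  have main: "\<exists>N. \<forall>x\<ge>N. \<forall>y\<ge>N. \<bar>psi_max M r C1 C2 \<theta> X Y x y T - ?D x y\<bar> \<le> \<epsilon> * ?D x y \<and>
      \<bar>psi_and M r C1 C2 \<theta> X Y x y T - ?D x y\<bar> \<le> \<epsilon> * ?D x y" if e: "\<epsilon> > 0" for \<epsilon>
  proof -
    obtain N1 where N1: "\<forall>x\<ge>N1. \<forall>y\<ge>N1. psi_and M r C1 C2 \<theta> X Y x y T \<le> (1 + \<epsilon>) * ?D x y"
      using psi_upper[OF e] by blast
    obtain N2 where N2: "\<forall>x\<ge>N2. \<forall>y\<ge>N2. (1 - \<epsilon>) * ?D x y \<le> psi_max M r C1 C2 \<theta> X Y x y T"
      using psi_lower[OF e] by blast
    show ?thesis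
    proof (intro exI[of _ "max 1 (max N1 N2)"] allI impI)
      fix x y assume xy: "x \<ge> max 1 (max N1 N2)" "y \<ge> max 1 (max N1 N2)"
      have up: "psi_and M r C1 C2 \<theta> X Y x y T \<le> ?D x y + \<epsilon> * ?D x y"
        using N1[rule_format, of x y] xy by (simp add: distrib_right)
      have lo: "?D x y - \<epsilon> * ?D x y \<le> psi_max M r C1 C2 \<theta> X Y x y T"
        using N2[rule_format, of x y] xy by (simp add: left_diff_distrib)
      have "psi_max M r C1 C2 \<theta> X Y x y T \<le> psi_and M r C1 C2 \<theta> X Y x y T"
        using xy by (intro psi_max_le_psi_and) auto
      then show "\<bar>psi_max M r C1 C2 \<theta> X Y x y T - ?D x y\<bar> \<le> \<epsilon> * ?D x y \<and>
        \<bar>psi_and M r C1 C2 \<theta> X Y x y T - ?D x y\<bar> \<le> \<epsilon> * ?D x y"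
        using up lo by (simp add: abs_le_iff)
    qed
  qed
  show "(\<lambda>(x, y). psi_max M r C1 C2 \<theta> X Y x y T) \<sim>[at_top \<times>\<^sub>F at_top] (\<lambda>(x, y). ?D x y)"
    unfolding asymp_equiv_prod_at_top_iff[OF ev] case_prod_conv using main by blast
  show "(\<lambda>(x, y). psi_and M r C1 C2 \<theta> X Y x y T) \<sim>[at_top \<times>\<^sub>F at_top] (\<lambda>(x, y). ?D x y)"
    unfolding asymp_equiv_prod_at_top_iff[OF ev] case_prod_conv using main by blast
qed

end

theorem theorem3p1:
  fixes M :: "'a measure"
    and X Y \<theta> :: "nat \<Rightarrow> 'a \<Rightarrow> real"
    and C1 C2 :: "real \<Rightarrow> 'a \<Rightarrow> real"
    and F G :: "real \<Rightarrow> real"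
    and r C T :: real
  assumes prob: "prob_space M"
    and r_nonneg: "r \<ge> 0"
    \<comment> \<open>inter-arrival times: i.i.d. positive\<close>
    and theta_rv: "\<And>i. \<theta> i \<in> borel_measurable M"
    and theta_pos: "\<And>i \<omega>. i \<ge> 1 \<Longrightarrow> \<omega> \<in> space M \<Longrightarrow> \<theta> i \<omega> > 0"
    and theta_indep: "prob_space.indep_vars M (\<lambda>_. borel) \<theta> {1..}"
    and theta_ident: "\<And>i. i \<ge> 1 \<Longrightarrow> distr M borel (\<theta> i) = distr M borel (\<theta> 1)"
    \<comment> \<open>claims\<close>
    and X_rv: "\<And>i. X i \<in> borel_measurable M"
    and Y_rv: "\<And>i. Y i \<in> borel_measurable M"
    and XY_ident: "\<And>i. i \<ge> 1 \<Longrightarrow>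
        distr M (borel \<Otimes>\<^sub>M borel) (\<lambda>\<omega>. (X i \<omega>, Y i \<omega>)) =
        distr M (borel \<Otimes>\<^sub>M borel) (\<lambda>\<omega>. (X 1 \<omega>, Y 1 \<omega>))"
    and X_nonneg: "\<And>i \<omega>. i \<ge> 1 \<Longrightarrow> \<omega> \<in> space M \<Longrightarrow> X i \<omega> \<ge> 0"
    and Y_nonneg: "\<And>i \<omega>. i \<ge> 1 \<Longrightarrow> \<omega> \<in> space M \<Longrightarrow> Y i \<omega> \<ge> 0"
    and F_dist: "\<And>i x. i \<ge> 1 \<Longrightarrow> F x = measure M {\<omega>\<in>space M. X i \<omega> \<le> x}"
    and G_dist: "\<And>i y. i \<ge> 1 \<Longrightarrow> G y = measure M {\<omega>\<in>space M. Y i \<omega> \<le> y}"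
    and F_endpoint: "\<And>x. F x < 1"
    and G_endpoint: "\<And>y. G y < 1"
    and F_class: "classD F \<and> classL F"
    and G_class: "classD G \<and> classL G"
    and C_pos: "C > 0"
    and SAI: "\<And>i. i \<ge> 1 \<Longrightarrow>
        (\<lambda>(u, v). measure M {\<omega>\<in>space M. X i \<omega> > u \<and> Y i \<omega> > v})
          \<sim>[at_top \<times>\<^sub>F at_top] (\<lambda>(u, v). C * tailf F u * tailf G v)"
    and XY_indep: "\<And>i j. i \<ge> 1 \<Longrightarrow> j \<ge> 1 \<Longrightarrow> i \<noteq> j \<Longrightarrow>
        prob_space.indep_var M borel (X i) borel (Y j)"
    and gtai: "\<And>n. n \<ge> 1 \<Longrightarrow> GTAI M X n Y n"
    \<comment> \<open>premium processes: non-decreasing cadlag paths starting at 0\<close>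
    and C1_rv: "\<And>t. C1 t \<in> borel_measurable M"
    and C2_rv: "\<And>t. C2 t \<in> borel_measurable M"
    and C1_0: "\<And>\<omega>. \<omega> \<in> space M \<Longrightarrow> C1 0 \<omega> = 0"
    and C2_0: "\<And>\<omega>. \<omega> \<in> space M \<Longrightarrow> C2 0 \<omega> = 0"
    and C1_mono: "\<And>\<omega>. \<omega> \<in> space M \<Longrightarrow> mono_on {0..} (\<lambda>t. C1 t \<omega>)"
    and C2_mono: "\<And>\<omega>. \<omega> \<in> space M \<Longrightarrow> mono_on {0..} (\<lambda>t. C2 t \<omega>)"
    and C1_rcont: "\<And>\<omega> t. \<omega> \<in> space M \<Longrightarrow> t \<ge> 0 \<Longrightarrow> continuous (at_right t) (\<lambda>s. C1 s \<omega>)"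
    and C2_rcont: "\<And>\<omega> t. \<omega> \<in> space M \<Longrightarrow> t \<ge> 0 \<Longrightarrow> continuous (at_right t) (\<lambda>s. C2 s \<omega>)"
    \<comment> \<open>mutual independence of claims, premiums and the renewal process\<close>
    and mutual_indep: "prob_space.indep_sets M
        (\<lambda>k::nat. if k = 0 then sigma_sets (space M) (events_of M X {1..} \<union> events_of M Y {1..})
                  else if k = 1 then sigma_sets (space M) (events_of M C1 {0..} \<union> events_of M C2 {0..})
                  else sigma_sets (space M) (events_of M \<theta> {1..}))
        {0, 1, 2}"
    \<comment> \<open>horizon\<close>
    and T_pos: "T > 0"
    and lam_pos: "renewal_fn M \<theta> T > 0"
  shows "(\<lambda>(x, y). psi_max M r C1 C2 \<theta> X Y x y T)
           \<sim>[at_top \<times>\<^sub>F at_top] (\<lambda>(x, y). Delta (renewal_measure M \<theta>) F G C r x y T)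
     \<and> (\<lambda>(x, y). psi_and M r C1 C2 \<theta> X Y x y T)
           \<sim>[at_top \<times>\<^sub>F at_top] (\<lambda>(x, y). Delta (renewal_measure M \<theta>) F G C r x y T)"
proof -
  have "renewal_risk M X Y \<theta> C1 C2 F G r C T"
    by (intro renewal_risk.intro renewal_risk_axioms.intro prob)
      (fact | rule F_class[THEN conjunct1] F_class[THEN conjunct2] G_class[THEN conjunct1] G_class[THEN conjunct2]
        | rule SAI[OF order_refl])+
  then show ?thesis by (intro conjI renewal_risk.ruin_asymptotics)
qed

end
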